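(* Let $k$ be a commutative ring and let $H$ be a comonoidal $k$-prebialgebra (that is, a prebialgebra satisfying (lc) and (rc)). Then $(\mathcal{M}^H,\otimes^r,H_s,a,l,r)$ is a monoidal category, where $\mathcal{M}^H$ is the category of right $H$-comodules, and $\otimes^r$, the unit object $H_s$, the associativity constraint $a$ and the left and right unit constraints $l,r$ are described in the context.
   Context: Conventions. $k$ is a commutative ring and $\otimes=\otimes_k$. A $k$-prebialgebra is a $k$-module $H$ that is both an associative unital $k$-algebra (unit $1$) and a coassociative counital $k$-coalgebra (comultiplication $\Delta$, counit $\varepsilon$) such that $\Delta(hk)=\Delta(h)\Delta(k)$ for all $h,k\in H$; it is not required that $\Delta(1)=1\otimes 1$ nor that $\varepsilon$ is multiplicative. Sweedler notation: $\Delta(h)=h_{(1)}\otimes h_{(2)}$, $\Delta(1)=1_{(1)}\otimes 1_{(2)}=1_{(1')}\otimes 1_{(2')}$, $\Delta^2=(\Delta\otimes H)\circ\Delta$; for a right $H$-comodule $M$ the coaction is $m\mapsto m_{[0]}\otimes m_{[1]}\in M\otimes H$. $H$ is comonoidal if (lc) $\Delta^2(1)=1_{(1)}\otimes 1_{(2)}1_{(1')}\otimes 1_{(2')}$ and (rc) $\Delta^2(1)=1_{(1)}\otimes 1_{(1')}1_{(2)}\otimes 1_{(2')}$. Let $H_s=\mathrm{Im}(\varepsilon_s)\subset H$, where $\varepsilon_s(h)=\langle\varepsilon,h1_{(2)}\rangle 1_{(1)}$. When (c) holds, for $y\in H_s$ one has $\Delta(y)=1_{(1)}\otimes y1_{(2)}=1_{(1)}\otimes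 1_{(2)}y\in H_s\otimes H$, and $H_s$ is a right $H$-comodule via $\Delta$. For right $H$-comodules $M,N$, $M\otimes N$ has the coassociative, in general non-counital, coaction $\rho(m\otimes n)=m_{[0]}\otimes n_{[0]}\otimes m_{[1]}n_{[1]}$. $M\otimes^r N\subset M\otimes N$ is the submodule generated by all elements $\langle\varepsilon,m_{[1]}n_{[1]}\rangle m_{[0]}\otimes n_{[0]}$; it is a counital right $H$-comodule under $\rho$. On morphisms $\otimes^r$ is the restriction of $\otimes$. The associativity constraint $a$ is induced by that of $k$-modules. The left unit constraint $l_M:H_s\otimes^r M\to M$ is the restriction of $y\otimes m\mapsto\langle\varepsilon,ym_{[1]}\rangle m_{[0]}$ and the right unit constraint $r_M:M\otimes^r H_s\to M$ is the restriction of $m\otimes y\mapsto\langle\varepsilon,m_{[1]}y\rangle m_{[0]}$. *)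

theory Defs
  imports "HOL-Algebra.Module"
begin

section \<open>Linear maps and tensor products over a commutative ring\<close>

definition linear_map ::
  "('k, 'r) ring_scheme \<Rightarrow> ('k, 'a, 'x) module_scheme \<Rightarrow> ('k, 'b, 'y) module_scheme \<Rightarrow> ('a \<Rightarrow> 'b) \<Rightarrow> bool"
  where "linear_map R M N f \<longleftrightarrow>
    f \<in> carrier M \<rightarrow> carrier N \<and>
    (\<forall>x\<in>carrier M. \<forall>y\<in>carrier M. f (x \<oplus>\<^bsub>M\<^esub> y) = f x \<oplus>\<^bsub>N\<^esub> f y) \<and>
    (\<forall>r\<in>carrier R. \<forall>x\<in>carrier M. f (r \<odot>\<^bsub>M\<^esub> x) = r \<odot>\<^bsub>N\<^esub> f x)"

definition scalar_module :: "('k, 'r) ring_scheme \<Rightarrow> ('k, 'k) module"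
  where "scalar_module R = \<lparr>carrier = carrier R, monoid.mult = monoid.mult R, one = one R,
    zero = zero R, add = add R, smult = monoid.mult R\<rparr>"

definition generated_submodule ::
  "('k, 'r) ring_scheme \<Rightarrow> ('k, 'a, 'x) module_scheme \<Rightarrow> 'a set \<Rightarrow> 'a set"
  where "generated_submodule R M X = \<Inter>{S. submodule S R M \<and> X \<subseteq> S}"

text \<open>
  A list \<open>[(m1, n1), \<dots>, (mp, np)]\<close> stands for the sum of the pure tensors of its entries.
  The tensor product is the commutative monoid presented by the symbols \<open>(m, n)\<close> and the
  \<open>R\<close>-balanced bilinear relations. Because of the rule \<open>zero\<close> it is already a group, the
  inverse of \<open>(m, n)\<close> being the class of \<open>(- m, n)\<close>, so it is the usual quotient of the free
  \<open>R\<close>-module. (In HOL-Algebra notation the symbol \<open>\<otimes>\<close> is the product of a ring; tensors are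
  always written with the named functions below.)
\<close>

inductive tensor_eq ::
  "('k, 'r) ring_scheme \<Rightarrow> ('k, 'a, 'x) module_scheme \<Rightarrow> ('k, 'b, 'y) module_scheme \<Rightarrow>
    ('a \<times> 'b) list \<Rightarrow> ('a \<times> 'b) list \<Rightarrow> bool"
  for R M N
  where
    refl: "set xs \<subseteq> carrier M \<times> carrier N \<Longrightarrow> tensor_eq R M N xs xs"
  | sym: "tensor_eq R M N xs ys \<Longrightarrow> tensor_eq R M N ys xs"
  | trans: "tensor_eq R M N xs ys \<Longrightarrow> tensor_eq R M N ys zs \<Longrightarrow> tensor_eq R M N xs zs"
  | append: "tensor_eq R M N xs xs' \<Longrightarrow> tensor_eq R M N ys ys' \<Longrightarrow>
      tensor_eq R M N (xs @ ys) (xs' @ ys')"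
  | commute: "set xs \<subseteq> carrier M \<times> carrier N \<Longrightarrow> set ys \<subseteq> carrier M \<times> carrier N \<Longrightarrow>
      tensor_eq R M N (xs @ ys) (ys @ xs)"
  | zero: "n \<in> carrier N \<Longrightarrow> tensor_eq R M N [(\<zero>\<^bsub>M\<^esub>, n)] []"
  | add_left: "m \<in> carrier M \<Longrightarrow> m' \<in> carrier M \<Longrightarrow> n \<in> carrier N \<Longrightarrow>
      tensor_eq R M N [(m \<oplus>\<^bsub>M\<^esub> m', n)] [(m, n), (m', n)]"
  | add_right: "m \<in> carrier M \<Longrightarrow> n \<in> carrier N \<Longrightarrow> n' \<in> carrier N \<Longrightarrow>
      tensor_eq R M N [(m, n \<oplus>\<^bsub>N\<^esub> n')] [(m, n), (m, n')]"
  | balanced: "r \<in> carrier R \<Longrightarrow> m \<in> carrier M \<Longrightarrow> n \<in> carrier N \<Longrightarrow>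
      tensor_eq R M N [(r \<odot>\<^bsub>M\<^esub> m, n)] [(m, r \<odot>\<^bsub>N\<^esub> n)]"

definition tensor_class ::
  "('k, 'r) ring_scheme \<Rightarrow> ('k, 'a, 'x) module_scheme \<Rightarrow> ('k, 'b, 'y) module_scheme \<Rightarrow>
    ('a \<times> 'b) list \<Rightarrow> ('a \<times> 'b) list set"
  where "tensor_class R M N xs = {ys. tensor_eq R M N xs ys}"

definition rep :: "'c list set \<Rightarrow> 'c list"
  where "rep X = (SOME xs. xs \<in> X)"

text \<open>
  The \<open>module\<close> record extends \<open>ring\<close>, so modules carry the irrelevant fields \<open>mult\<close> and \<open>one\<close>;
  they are left undefined when only a module is meant.
\<close>

definition tensor ::
  "('k, 'r) ring_scheme \<Rightarrow> ('k, 'a, 'x) module_scheme \<Rightarrow> ('k, 'b, 'y) module_scheme \<Rightarrow>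
    ('k, ('a \<times> 'b) list set) module"
  where "tensor R M N = \<lparr>
    carrier = tensor_class R M N ` lists (carrier M \<times> carrier N),
    monoid.mult = undefined, one = undefined,
    zero = tensor_class R M N [],
    add = (\<lambda>X Y. tensor_class R M N (rep X @ rep Y)),
    smult = (\<lambda>r X. tensor_class R M N (map (\<lambda>(m, n). (r \<odot>\<^bsub>M\<^esub> m, n)) (rep X)))\<rparr>"

definition pure ::
  "('k, 'r) ring_scheme \<Rightarrow> ('k, 'a, 'x) module_scheme \<Rightarrow> ('k, 'b, 'y) module_scheme \<Rightarrow>
    'a \<Rightarrow> 'b \<Rightarrow> ('a \<times> 'b) list set"
  where "pure R M N m n = tensor_class R M N [(m, n)]"

text \<open>
  For a balanced bilinear \<open>f\<close> into \<open>P\<close>, \<open>tensor_lift P f\<close> is the induced additive map on the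
  tensor product. It serves as Sweedler notation: \<open>tensor_lift P f (\<Delta> h)\<close> is the sum of
  \<open>f h(1) h(2)\<close>.
\<close>

definition tensor_lift :: "('c, 'z) ring_scheme \<Rightarrow> ('a \<Rightarrow> 'b \<Rightarrow> 'c) \<Rightarrow> ('a \<times> 'b) list set \<Rightarrow> 'c"
  where "tensor_lift P f X = foldr (\<lambda>(m, n) s. f m n \<oplus>\<^bsub>P\<^esub> s) (rep X) \<zero>\<^bsub>P\<^esub>"

definition tensor_map ::
  "('k, 'r) ring_scheme \<Rightarrow> ('k, 'c, 'x) module_scheme \<Rightarrow> ('k, 'd, 'y) module_scheme \<Rightarrow>
    ('a \<Rightarrow> 'c) \<Rightarrow> ('b \<Rightarrow> 'd) \<Rightarrow> ('a \<times> 'b) list set \<Rightarrow> ('c \<times> 'd) list set"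
  where "tensor_map R M' N' f g = tensor_lift (tensor R M' N') (\<lambda>m n. pure R M' N' (f m) (g n))"

text \<open>The canonical map from \<open>(M \<otimes> N) \<otimes> P\<close> to \<open>M \<otimes> (N \<otimes> P)\<close>.\<close>

definition tensor_assoc ::
  "('k, 'r) ring_scheme \<Rightarrow> ('k, 'a, 'x) module_scheme \<Rightarrow> ('k, 'b, 'y) module_scheme \<Rightarrow>
    ('k, 'c, 'z) module_scheme \<Rightarrow>
    (('a \<times> 'b) list set \<times> 'c) list set \<Rightarrow> ('a \<times> ('b \<times> 'c) list set) list set"
  where "tensor_assoc R M N P =
    (let T = tensor R M (tensor R N P) in
      tensor_lift T (\<lambda>t p. tensor_lift T (\<lambda>m n. pure R M (tensor R N P) m (pure R N P n p)) t))"


section \<open>Prebialgebras\<close>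

record ('k, 'h) prebialg = "('k, 'h) module" +
  comult :: "'h \<Rightarrow> ('h \<times> 'h) list set"
  counit :: "'h \<Rightarrow> 'k"

locale prebialgebra = module R H + ring H
  for R :: "('k, 'r) ring_scheme" (structure) and H :: "('k, 'h, 'x) prebialg_scheme" (structure) +
  assumes smult_mult_left:
      "\<lbrakk>r \<in> carrier R; x \<in> carrier H; y \<in> carrier H\<rbrakk> \<Longrightarrow>
        (r \<odot>\<^bsub>H\<^esub> x) \<otimes>\<^bsub>H\<^esub> y = r \<odot>\<^bsub>H\<^esub> (x \<otimes>\<^bsub>H\<^esub> y)"
    and smult_mult_right:
      "\<lbrakk>r \<in> carrier R; x \<in> carrier H; y \<in> carrier H\<rbrakk> \<Longrightarrow>
        x \<otimes>\<^bsub>H\<^esub> (r \<odot>\<^bsub>H\<^esub> y) = r \<odot>\<^bsub>H\<^esub> (x \<otimes>\<^bsub>H\<^esub> y)"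
    and comult_linear: "linear_map R H (tensor R H H) (comult H)"
    and counit_linear: "linear_map R H (scalar_module R) (counit H)"
    and coassoc:
      "h \<in> carrier H \<Longrightarrow>
        tensor_assoc R H H H (tensor_map R (tensor R H H) H (comult H) (\<lambda>x. x) (comult H h)) =
        tensor_map R H (tensor R H H) (\<lambda>x. x) (comult H) (comult H h)"
    and counit_left:
      "h \<in> carrier H \<Longrightarrow> tensor_lift H (\<lambda>a b. counit H a \<odot>\<^bsub>H\<^esub> b) (comult H h) = h"
    and counit_right:
      "h \<in> carrier H \<Longrightarrow> tensor_lift H (\<lambda>a b. counit H b \<odot>\<^bsub>H\<^esub> a) (comult H h) = h"
    and comult_mult:
      "\<lbrakk>h \<in> carrier H; k \<in> carrier H\<rbrakk> \<Longrightarrow>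
        comult H (h \<otimes>\<^bsub>H\<^esub> k) =
        tensor_lift (tensor R H H) (\<lambda>a b. tensor_lift (tensor R H H)
          (\<lambda>c d. pure R H H (a \<otimes>\<^bsub>H\<^esub> c) (b \<otimes>\<^bsub>H\<^esub> d)) (comult H k)) (comult H h)"

definition comult2 ::
  "('k, 'r) ring_scheme \<Rightarrow> ('k, 'h, 'x) prebialg_scheme \<Rightarrow> 'h \<Rightarrow> (('h \<times> 'h) list set \<times> 'h) list set"
  where "comult2 R H h = tensor_map R (tensor R H H) H (comult H) (\<lambda>x. x) (comult H h)"

text \<open>In both axioms \<open>a, b\<close> are the legs \<open>1(1), 1(2)\<close> and \<open>c, d\<close> the legs \<open>1(1'), 1(2')\<close>.\<close>

locale comonoidal_prebialgebra = prebialgebra R H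
  for R :: "('k, 'r) ring_scheme" (structure) and H :: "('k, 'h, 'x) prebialg_scheme" (structure) +
  assumes left_comonoidal:
      "comult2 R H \<one>\<^bsub>H\<^esub> =
        (let T = tensor R (tensor R H H) H in
          tensor_lift T (\<lambda>a b. tensor_lift T
            (\<lambda>c d. pure R (tensor R H H) H (pure R H H a (b \<otimes>\<^bsub>H\<^esub> c)) d)
            (comult H \<one>\<^bsub>H\<^esub>)) (comult H \<one>\<^bsub>H\<^esub>))"
    and right_comonoidal:
      "comult2 R H \<one>\<^bsub>H\<^esub> =
        (let T = tensor R (tensor R H H) H in
          tensor_lift T (\<lambda>a b. tensor_lift T
            (\<lambda>c d. pure R (tensor R H H) H (pure R H H a (c \<otimes>\<^bsub>H\<^esub> b)) d)
            (comult H \<one>\<^bsub>H\<^esub>)) (comult H \<one>\<^bsub>H\<^esub>))"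

definition eps_s :: "('k, 'h, 'x) prebialg_scheme \<Rightarrow> 'h \<Rightarrow> 'h"
  where "eps_s H h = tensor_lift H (\<lambda>a b. counit H (h \<otimes>\<^bsub>H\<^esub> b) \<odot>\<^bsub>H\<^esub> a) (comult H \<one>\<^bsub>H\<^esub>)"


section \<open>Right comodules\<close>

record ('k, 'h, 'm) comodule = "('k, 'm) module" +
  coact :: "'m \<Rightarrow> ('m \<times> 'h) list set"

definition right_comodule ::
  "('k, 'r) ring_scheme \<Rightarrow> ('k, 'h, 'x) prebialg_scheme \<Rightarrow> ('k, 'h, 'm) comodule \<Rightarrow> bool"
  where "right_comodule R H M \<longleftrightarrow>
    module R M \<and>
    linear_map R M (tensor R M H) (coact M) \<and>
    (\<forall>m\<in>carrier M.
      tensor_assoc R M H H (tensor_map R (tensor R M H) H (coact M) (\<lambda>h. h) (coact M m)) =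
      tensor_map R M (tensor R H H) (\<lambda>m. m) (comult H) (coact M m)) \<and>
    (\<forall>m\<in>carrier M. tensor_lift M (\<lambda>m0 m1. counit H m1 \<odot>\<^bsub>M\<^esub> m0) (coact M m) = m)"

text \<open>Maps are extensional, so that equality of morphisms is equality on the source.\<close>

definition comodule_hom ::
  "('k, 'r) ring_scheme \<Rightarrow> ('k, 'h, 'x) prebialg_scheme \<Rightarrow>
    ('k, 'h, 'm) comodule \<Rightarrow> ('k, 'h, 'n) comodule \<Rightarrow> ('m \<Rightarrow> 'n) set"
  where "comodule_hom R H M N = {f \<in> extensional (carrier M).
    linear_map R M N f \<and>
    (\<forall>m\<in>carrier M. coact N (f m) = tensor_map R N H f (\<lambda>h. h) (coact M m))}"

text \<open>
  Restriction of the structure of \<open>M\<close> to a submodule \<open>S\<close>. Over a general ring the canonical map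
  from \<open>S \<otimes> H\<close> to \<open>M \<otimes> H\<close> is not an inclusion of sets (nor always injective), so the restricted
  coaction is the element of \<open>S \<otimes> H\<close> whose image is the coaction of \<open>M\<close>. In all uses below \<open>S\<close> is
  a direct summand of \<open>M\<close> and the coaction takes values in the image.
\<close>

definition restrict_comodule ::
  "('k, 'r) ring_scheme \<Rightarrow> ('k, 'h, 'x) prebialg_scheme \<Rightarrow> ('k, 'h, 'm) comodule \<Rightarrow> 'm set \<Rightarrow>
    ('k, 'h, 'm) comodule"
  where "restrict_comodule R H M S = M\<lparr>carrier := S,
    coact := (\<lambda>s. THE t. t \<in> carrier (tensor R (M\<lparr>carrier := S\<rparr>) H) \<and>
      tensor_map R M H (\<lambda>x. x) (\<lambda>h. h) t = coact M s)\<rparr>"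

text \<open>Transport of structure along a map \<open>\<phi>\<close> that is injective on the carrier.\<close>

definition transport_comodule ::
  "('k, 'r) ring_scheme \<Rightarrow> ('k, 'h, 'x) prebialg_scheme \<Rightarrow> ('m \<Rightarrow> 'n) \<Rightarrow> ('k, 'h, 'm) comodule \<Rightarrow>
    ('k, 'h, 'n) comodule"
  where "transport_comodule R H \<phi> M =
    (let \<psi> = inv_into (carrier M) \<phi>;
         A = \<lparr>carrier = \<phi> ` carrier M, monoid.mult = undefined, one = undefined,
           zero = \<phi> \<zero>\<^bsub>M\<^esub>,
           add = (\<lambda>x y. \<phi> (\<psi> x \<oplus>\<^bsub>M\<^esub> \<psi> y)),
           smult = (\<lambda>r x. \<phi> (r \<odot>\<^bsub>M\<^esub> \<psi> x))\<rparr>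
     in module.extend A
          \<lparr>coact = (\<lambda>x. tensor_map R A H \<phi> (\<lambda>h. h) (coact M (\<psi> x)))\<rparr>)"

definition regular_comodule :: "('k, 'h, 'x) prebialg_scheme \<Rightarrow> ('k, 'h, 'h) comodule"
  where "regular_comodule H = \<lparr>carrier = carrier H, monoid.mult = monoid.mult H, one = one H,
    zero = zero H, add = add H, smult = smult H, coact = comult H\<rparr>"

definition H_s ::
  "('k, 'r) ring_scheme \<Rightarrow> ('k, 'h, 'x) prebialg_scheme \<Rightarrow> ('k, 'h, 'h) comodule"
  where "H_s R H = restrict_comodule R H (regular_comodule H) (eps_s H ` carrier H)"

text \<open>\<open>M \<otimes> N\<close> with its diagonal, in general non-counital, coaction.\<close>

definition tensor_comodule ::
  "('k, 'r) ring_scheme \<Rightarrow> ('k, 'h, 'x) prebialg_scheme \<Rightarrow>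
    ('k, 'h, 'm) comodule \<Rightarrow> ('k, 'h, 'n) comodule \<Rightarrow> ('k, 'h, ('m \<times> 'n) list set) comodule"
  where "tensor_comodule R H M N =
    (let T = tensor R M N; TH = tensor R T H in
      module.extend T \<lparr>coact = tensor_lift TH (\<lambda>m n.
        tensor_lift TH (\<lambda>m0 m1. tensor_lift TH (\<lambda>n0 n1.
          pure R T H (pure R M N m0 n0) (m1 \<otimes>\<^bsub>H\<^esub> n1)) (coact N n)) (coact M m))\<rparr>)"

definition rtensor_carrier ::
  "('k, 'r) ring_scheme \<Rightarrow> ('k, 'h, 'x) prebialg_scheme \<Rightarrow>
    ('k, 'h, 'm) comodule \<Rightarrow> ('k, 'h, 'n) comodule \<Rightarrow> ('m \<times> 'n) list set set"
  where "rtensor_carrier R H M N =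
    (let T = tensor R M N in
      generated_submodule R T
        {tensor_lift T (\<lambda>m0 m1. tensor_lift T (\<lambda>n0 n1.
            counit H (m1 \<otimes>\<^bsub>H\<^esub> n1) \<odot>\<^bsub>T\<^esub> pure R M N m0 n0) (coact N n)) (coact M m)
          | m n. m \<in> carrier M \<and> n \<in> carrier N})"

definition rtensor ::
  "('k, 'r) ring_scheme \<Rightarrow> ('k, 'h, 'x) prebialg_scheme \<Rightarrow>
    ('k, 'h, 'm) comodule \<Rightarrow> ('k, 'h, 'n) comodule \<Rightarrow> ('k, 'h, ('m \<times> 'n) list set) comodule"
  where "rtensor R H M N =
    restrict_comodule R H (tensor_comodule R H M N) (rtensor_carrier R H M N)"


section \<open>Monoidal categories\<close>

text \<open>
  Morphisms are organised in hom-sets, not assumed disjoint; composition is indexed by the three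
  objects: \<open>Comp \<C> A B C g f\<close> is \<open>g\<close> after \<open>f\<close>, for \<open>f : A \<rightarrow> B\<close> and \<open>g : B \<rightarrow> C\<close>.
  \<open>TensArr \<C> A A' B B' f g\<close> is the tensor product of \<open>f : A \<rightarrow> A'\<close> and \<open>g : B \<rightarrow> B'\<close>.
\<close>

record ('o, 'm) cat =
  Obj :: "'o set"
  Hom :: "'o \<Rightarrow> 'o \<Rightarrow> 'm set"
  Ident :: "'o \<Rightarrow> 'm"
  Comp :: "'o \<Rightarrow> 'o \<Rightarrow> 'o \<Rightarrow> 'm \<Rightarrow> 'm \<Rightarrow> 'm"

record ('o, 'm) moncat = "('o, 'm) cat" +
  TensObj :: "'o \<Rightarrow> 'o \<Rightarrow> 'o"
  TensArr :: "'o \<Rightarrow> 'o \<Rightarrow> 'o \<Rightarrow> 'o \<Rightarrow> 'm \<Rightarrow> 'm \<Rightarrow> 'm"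
  UnitObj :: "'o"
  Assoc :: "'o \<Rightarrow> 'o \<Rightarrow> 'o \<Rightarrow> 'm"
  LUnit :: "'o \<Rightarrow> 'm"
  RUnit :: "'o \<Rightarrow> 'm"

locale category =
  fixes \<C> :: "('o, 'm, 'z) cat_scheme"
  assumes ident_hom: "A \<in> Obj \<C> \<Longrightarrow> Ident \<C> A \<in> Hom \<C> A A"
    and comp_hom:
      "\<lbrakk>A \<in> Obj \<C>; B \<in> Obj \<C>; C \<in> Obj \<C>; f \<in> Hom \<C> A B; g \<in> Hom \<C> B C\<rbrakk> \<Longrightarrow>
        Comp \<C> A B C g f \<in> Hom \<C> A C"
    and comp_ident_left:
      "\<lbrakk>A \<in> Obj \<C>; B \<in> Obj \<C>; f \<in> Hom \<C> A B\<rbrakk> \<Longrightarrow> Comp \<C> A B B (Ident \<C> B) f = f"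
    and comp_ident_right:
      "\<lbrakk>A \<in> Obj \<C>; B \<in> Obj \<C>; f \<in> Hom \<C> A B\<rbrakk> \<Longrightarrow> Comp \<C> A A B f (Ident \<C> A) = f"
    and comp_assoc:
      "\<lbrakk>A \<in> Obj \<C>; B \<in> Obj \<C>; C \<in> Obj \<C>; D \<in> Obj \<C>;
        f \<in> Hom \<C> A B; g \<in> Hom \<C> B C; h \<in> Hom \<C> C D\<rbrakk> \<Longrightarrow>
        Comp \<C> A C D h (Comp \<C> A B C g f) = Comp \<C> A B D (Comp \<C> B C D h g) f"

definition isomorphism :: "('o, 'm, 'z) cat_scheme \<Rightarrow> 'o \<Rightarrow> 'o \<Rightarrow> 'm \<Rightarrow> bool"
  where "isomorphism \<C> A B f \<longleftrightarrow> f \<in> Hom \<C> A B \<and>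
    (\<exists>g\<in>Hom \<C> B A. Comp \<C> A B A g f = Ident \<C> A \<and> Comp \<C> B A B f g = Ident \<C> B)"

locale monoidal_category = category \<C>
  for \<C> :: "('o, 'm, 'z) moncat_scheme" +
  assumes tens_obj: "\<lbrakk>A \<in> Obj \<C>; B \<in> Obj \<C>\<rbrakk> \<Longrightarrow> TensObj \<C> A B \<in> Obj \<C>"
    and tens_hom:
      "\<lbrakk>A \<in> Obj \<C>; A' \<in> Obj \<C>; B \<in> Obj \<C>; B' \<in> Obj \<C>;
        f \<in> Hom \<C> A A'; g \<in> Hom \<C> B B'\<rbrakk> \<Longrightarrow>
        TensArr \<C> A A' B B' f g \<in> Hom \<C> (TensObj \<C> A B) (TensObj \<C> A' B')"
    and tens_ident:
      "\<lbrakk>A \<in> Obj \<C>; B \<in> Obj \<C>\<rbrakk> \<Longrightarrow>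
        TensArr \<C> A A B B (Ident \<C> A) (Ident \<C> B) = Ident \<C> (TensObj \<C> A B)"
    and tens_comp:
      "\<lbrakk>A \<in> Obj \<C>; A' \<in> Obj \<C>; A'' \<in> Obj \<C>; B \<in> Obj \<C>; B' \<in> Obj \<C>; B'' \<in> Obj \<C>;
        f \<in> Hom \<C> A A'; f' \<in> Hom \<C> A' A''; g \<in> Hom \<C> B B'; g' \<in> Hom \<C> B' B''\<rbrakk> \<Longrightarrow>
        TensArr \<C> A A'' B B'' (Comp \<C> A A' A'' f' f) (Comp \<C> B B' B'' g' g) =
        Comp \<C> (TensObj \<C> A B) (TensObj \<C> A' B') (TensObj \<C> A'' B'')
          (TensArr \<C> A' A'' B' B'' f' g') (TensArr \<C> A A' B B' f g)"
    and unit_obj: "UnitObj \<C> \<in> Obj \<C>"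
    and assoc_iso:
      "\<lbrakk>A \<in> Obj \<C>; B \<in> Obj \<C>; C \<in> Obj \<C>\<rbrakk> \<Longrightarrow>
        isomorphism \<C> (TensObj \<C> (TensObj \<C> A B) C) (TensObj \<C> A (TensObj \<C> B C)) (Assoc \<C> A B C)"
    and assoc_natural:
      "\<lbrakk>A \<in> Obj \<C>; A' \<in> Obj \<C>; B \<in> Obj \<C>; B' \<in> Obj \<C>; C \<in> Obj \<C>; C' \<in> Obj \<C>;
        f \<in> Hom \<C> A A'; g \<in> Hom \<C> B B'; h \<in> Hom \<C> C C'\<rbrakk> \<Longrightarrow>
        Comp \<C> (TensObj \<C> (TensObj \<C> A B) C) (TensObj \<C> (TensObj \<C> A' B') C')
          (TensObj \<C> A' (TensObj \<C> B' C'))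
          (Assoc \<C> A' B' C')
          (TensArr \<C> (TensObj \<C> A B) (TensObj \<C> A' B') C C' (TensArr \<C> A A' B B' f g) h) =
        Comp \<C> (TensObj \<C> (TensObj \<C> A B) C) (TensObj \<C> A (TensObj \<C> B C))
          (TensObj \<C> A' (TensObj \<C> B' C'))
          (TensArr \<C> A A' (TensObj \<C> B C) (TensObj \<C> B' C') f (TensArr \<C> B B' C C' g h))
          (Assoc \<C> A B C)"
    and lunit_iso:
      "A \<in> Obj \<C> \<Longrightarrow> isomorphism \<C> (TensObj \<C> (UnitObj \<C>) A) A (LUnit \<C> A)"
    and lunit_natural:
      "\<lbrakk>A \<in> Obj \<C>; A' \<in> Obj \<C>; f \<in> Hom \<C> A A'\<rbrakk> \<Longrightarrow>
        Comp \<C> (TensObj \<C> (UnitObj \<C>) A) (TensObj \<C> (UnitObj \<C>) A') A' (LUnit \<C> A')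
          (TensArr \<C> (UnitObj \<C>) (UnitObj \<C>) A A' (Ident \<C> (UnitObj \<C>)) f) =
        Comp \<C> (TensObj \<C> (UnitObj \<C>) A) A A' f (LUnit \<C> A)"
    and runit_iso:
      "A \<in> Obj \<C> \<Longrightarrow> isomorphism \<C> (TensObj \<C> A (UnitObj \<C>)) A (RUnit \<C> A)"
    and runit_natural:
      "\<lbrakk>A \<in> Obj \<C>; A' \<in> Obj \<C>; f \<in> Hom \<C> A A'\<rbrakk> \<Longrightarrow>
        Comp \<C> (TensObj \<C> A (UnitObj \<C>)) (TensObj \<C> A' (UnitObj \<C>)) A' (RUnit \<C> A')
          (TensArr \<C> A A' (UnitObj \<C>) (UnitObj \<C>) f (Ident \<C> (UnitObj \<C>))) =
        Comp \<C> (TensObj \<C> A (UnitObj \<C>)) A A' f (RUnit \<C> A)"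
    and pentagon:
      "\<lbrakk>A \<in> Obj \<C>; B \<in> Obj \<C>; C \<in> Obj \<C>; D \<in> Obj \<C>\<rbrakk> \<Longrightarrow>
        Comp \<C>
          (TensObj \<C> (TensObj \<C> (TensObj \<C> A B) C) D)
          (TensObj \<C> A (TensObj \<C> (TensObj \<C> B C) D))
          (TensObj \<C> A (TensObj \<C> B (TensObj \<C> C D)))
          (TensArr \<C> A A (TensObj \<C> (TensObj \<C> B C) D) (TensObj \<C> B (TensObj \<C> C D))
            (Ident \<C> A) (Assoc \<C> B C D))
          (Comp \<C>
            (TensObj \<C> (TensObj \<C> (TensObj \<C> A B) C) D)
            (TensObj \<C> (TensObj \<C> A (TensObj \<C> B C)) D)
            (TensObj \<C> A (TensObj \<C> (TensObj \<C> B C) D))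
            (Assoc \<C> A (TensObj \<C> B C) D)
            (TensArr \<C> (TensObj \<C> (TensObj \<C> A B) C) (TensObj \<C> A (TensObj \<C> B C)) D D
              (Assoc \<C> A B C) (Ident \<C> D))) =
        Comp \<C>
          (TensObj \<C> (TensObj \<C> (TensObj \<C> A B) C) D)
          (TensObj \<C> (TensObj \<C> A B) (TensObj \<C> C D))
          (TensObj \<C> A (TensObj \<C> B (TensObj \<C> C D)))
          (Assoc \<C> A B (TensObj \<C> C D))
          (Assoc \<C> (TensObj \<C> A B) C D)"
    and triangle:
      "\<lbrakk>A \<in> Obj \<C>; B \<in> Obj \<C>\<rbrakk> \<Longrightarrow>
        Comp \<C> (TensObj \<C> (TensObj \<C> A (UnitObj \<C>)) B) (TensObj \<C> A (TensObj \<C> (UnitObj \<C>) B))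
          (TensObj \<C> A B)
          (TensArr \<C> A A (TensObj \<C> (UnitObj \<C>) B) B (Ident \<C> A) (LUnit \<C> B))
          (Assoc \<C> A (UnitObj \<C>) B) =
        TensArr \<C> (TensObj \<C> A (UnitObj \<C>)) A B B (RUnit \<C> A) (Ident \<C> B)"


section \<open>The monoidal category of right comodules\<close>

text \<open>
  The objects of one category need carriers in one type. The type below contains a copy of the
  type \<open>'h\<close> of \<open>H\<close> (for the unit object), a copy of an arbitrary type \<open>'a\<close> (so that, \<open>'a\<close> being
  free in the theorem, every comodule is isomorphic to an object of such a category), and is closed
  under tensor products: an element of a tensor product of two modules with carriers in
  \<open>('h, 'a) univ\<close> is a class of lists of pairs, and is coded by one of its lists.
\<close>

datatype ('h, 'a) univ =
    HElem 'h
  | Atom 'a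
  | Formal "(('h, 'a) univ \<times> ('h, 'a) univ) list"

definition code :: "(('h, 'a) univ \<times> ('h, 'a) univ) list set \<Rightarrow> ('h, 'a) univ"
  where "code X = Formal (rep X)"

definition decode ::
  "('k, 'r) ring_scheme \<Rightarrow> ('k, ('h, 'a) univ, 'x) module_scheme \<Rightarrow>
    ('k, ('h, 'a) univ, 'y) module_scheme \<Rightarrow>
    ('h, 'a) univ \<Rightarrow> (('h, 'a) univ \<times> ('h, 'a) univ) list set"
  where "decode R M N = inv_into (carrier (tensor R M N)) code"

type_synonym ('k, 'h, 'a) ucomodule = "('k, 'h, ('h, 'a) univ) comodule"

definition boxtimes ::
  "('k, 'r) ring_scheme \<Rightarrow> ('k, 'h, 'x) prebialg_scheme \<Rightarrow>
    ('k, 'h, 'a) ucomodule \<Rightarrow> ('k, 'h, 'a) ucomodule \<Rightarrow> ('k, 'h, 'a) ucomodule"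
  where "boxtimes R H M N = transport_comodule R H code (rtensor R H M N)"

definition boxtimes_map ::
  "('k, 'r) ring_scheme \<Rightarrow> ('k, 'h, 'x) prebialg_scheme \<Rightarrow>
    ('k, 'h, 'a) ucomodule \<Rightarrow> ('k, 'h, 'a) ucomodule \<Rightarrow>
    ('k, 'h, 'a) ucomodule \<Rightarrow> ('k, 'h, 'a) ucomodule \<Rightarrow>
    (('h, 'a) univ \<Rightarrow> ('h, 'a) univ) \<Rightarrow> (('h, 'a) univ \<Rightarrow> ('h, 'a) univ) \<Rightarrow>
    ('h, 'a) univ \<Rightarrow> ('h, 'a) univ"
  where "boxtimes_map R H M M' N N' f g =
    (\<lambda>x\<in>carrier (boxtimes R H M N). code (tensor_map R M' N' f g (decode R M N x)))"

definition unit_comodule ::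
  "('k, 'r) ring_scheme \<Rightarrow> ('k, 'h, 'x) prebialg_scheme \<Rightarrow> ('k, 'h, 'a) ucomodule"
  where "unit_comodule R H = transport_comodule R H HElem (H_s R H)"

text \<open>
  The two iterated products are submodules of \<open>(M \<otimes> N) \<otimes> P\<close> and \<open>M \<otimes> (N \<otimes> P)\<close> (via the
  canonical maps, which are injective because all the submodules are direct summands), and the
  associativity constraint is the map between them induced by the associativity of the tensor
  product of modules.
\<close>

definition assoc_constraint ::
  "('k, 'r) ring_scheme \<Rightarrow> ('k, 'h, 'x) prebialg_scheme \<Rightarrow>
    ('k, 'h, 'a) ucomodule \<Rightarrow> ('k, 'h, 'a) ucomodule \<Rightarrow> ('k, 'h, 'a) ucomodule \<Rightarrow>
    ('h, 'a) univ \<Rightarrow> ('h, 'a) univ"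
  where "assoc_constraint R H M N P =
    (\<lambda>x\<in>carrier (boxtimes R H (boxtimes R H M N) P).
      THE y. y \<in> carrier (boxtimes R H M (boxtimes R H N P)) \<and>
        tensor_map R M (tensor R N P) (\<lambda>m. m) (decode R N P) (decode R M (boxtimes R H N P) y) =
        tensor_assoc R M N P
          (tensor_map R (tensor R M N) P (decode R M N) (\<lambda>p. p) (decode R (boxtimes R H M N) P x)))"

definition left_unit_constraint ::
  "('k, 'r) ring_scheme \<Rightarrow> ('k, 'h, 'x) prebialg_scheme \<Rightarrow> ('k, 'h, 'a) ucomodule \<Rightarrow>
    ('h, 'a) univ \<Rightarrow> ('h, 'a) univ"
  where "left_unit_constraint R H M =
    (\<lambda>x\<in>carrier (boxtimes R H (unit_comodule R H) M).
      tensor_lift M (\<lambda>u m. tensor_lift M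
        (\<lambda>m0 m1. counit H (inv_into UNIV HElem u \<otimes>\<^bsub>H\<^esub> m1) \<odot>\<^bsub>M\<^esub> m0) (coact M m))
      (decode R (unit_comodule R H) M x))"

definition right_unit_constraint ::
  "('k, 'r) ring_scheme \<Rightarrow> ('k, 'h, 'x) prebialg_scheme \<Rightarrow> ('k, 'h, 'a) ucomodule \<Rightarrow>
    ('h, 'a) univ \<Rightarrow> ('h, 'a) univ"
  where "right_unit_constraint R H M =
    (\<lambda>x\<in>carrier (boxtimes R H M (unit_comodule R H)).
      tensor_lift M (\<lambda>m u. tensor_lift M
        (\<lambda>m0 m1. counit H (m1 \<otimes>\<^bsub>H\<^esub> inv_into UNIV HElem u) \<odot>\<^bsub>M\<^esub> m0) (coact M m))
      (decode R M (unit_comodule R H) x))"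

definition comodule_moncat ::
  "('k, 'r) ring_scheme \<Rightarrow> ('k, 'h, 'x) prebialg_scheme \<Rightarrow>
    (('k, 'h, 'a) ucomodule, ('h, 'a) univ \<Rightarrow> ('h, 'a) univ) moncat"
  where "comodule_moncat R H = \<lparr>
    Obj = {M. right_comodule R H M},
    Hom = comodule_hom R H,
    Ident = (\<lambda>M. \<lambda>x\<in>carrier M. x),
    Comp = (\<lambda>M N P g f. compose (carrier M) g f),
    TensObj = boxtimes R H,
    TensArr = boxtimes_map R H,
    UnitObj = unit_comodule R H,
    Assoc = assoc_constraint R H,
    LUnit = left_unit_constraint R H,
    RUnit = right_unit_constraint R H\<rparr>"

end

theory Submission
  imports Defs
begin

text \<open>
  Let \<open>H\<close> be a prebialgebra. For right comodules \<open>M\<close>, \<open>N\<close> the diagonal coaction \<open>\<rho>\<close> of \<open>M \<otimes> N\<close> is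
  coassociative, since \<open>\<Delta>\<close> is multiplicative, but it need not be counital. For any coassociative
  coaction the map \<open>p = (id \<otimes> \<epsilon>) \<rho>\<close> satisfies \<open>\<rho> p = \<rho>\<close> (\<open>coact_counital_part\<close>). So \<open>p\<close> is an
  idempotent, its image is a comodule and a direct summand, and it commutes with colinear maps. For
  \<open>M \<otimes> N\<close> the image is \<open>M \<otimes>\<^sup>r N\<close>.

  Tensor products of coassociative coactions are associative together with their coactions, and the
  counital part of \<open>M \<otimes> N\<close> does not change if the factors are replaced by their counital parts
  (\<open>counital_part_tensor\<close>). Therefore \<open>(M \<otimes>\<^sup>r N) \<otimes>\<^sup>r P\<close> and \<open>M \<otimes>\<^sup>r (N \<otimes>\<^sup>r P)\<close> are both the counital
  part of \<open>M \<otimes> N \<otimes> P\<close>, and the associativity map of modules restricts to an isomorphism between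
  them. Iterated products embed into iterated tensor products of modules, where naturality and the
  pentagon are evident; the notion \<open>counital_embedding\<close> organises this transfer.

  The axioms (lc) and (rc) provide the unit. They give \<open>\<Delta>(y) = 1(1) \<otimes> 1(2) y = 1(1) \<otimes> y 1(2)\<close> for
  \<open>y\<close> in \<open>H\<^sub>s\<close>, and show that \<open>\<epsilon>\<^sub>s\<close> is an idempotent that makes \<open>H\<^sub>s\<close> a comodule. Moreover
  \<open>\<Delta>(y h) = h(1) \<otimes> y h(2)\<close> and \<open>\<Delta>(h y) = h(1) \<otimes> h(2) y\<close>, from which the coactions of \<open>l(y \<otimes> m)\<close>
  and \<open>r(m \<otimes> y)\<close> are \<open>m(0) \<otimes> y m(1)\<close> and \<open>m(0) \<otimes> m(1) y\<close> (\<open>coact_left_unit_map\<close>). By these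
  formulas \<open>l\<close> and \<open>r\<close> are colinear; \<open>y \<otimes> m\<close> and \<open>1 \<otimes> l(y \<otimes> m)\<close> have the same coaction, hence the
  same counital part, so \<open>l\<close> is invertible on \<open>H\<^sub>s \<otimes>\<^sup>r M\<close>, and similarly for \<open>r\<close>; and both sides of
  the triangle send \<open>(m \<otimes> y) \<otimes> n\<close> to the sum of \<open>\<epsilon>(m(1) y n(1)) m(0) \<otimes> n(0)\<close>.

  Computations in Sweedler notation are carried out with the operator \<open>sweedler\<close>, whose nested sums
  are checked for linearity by the simplifier.
\<close>


section \<open>The tensor product of two modules\<close>

lemma linear_mapI:
  assumes "\<And>x. x \<in> carrier M \<Longrightarrow> f x \<in> carrier N"
    and "\<And>x y. \<lbrakk>x \<in> carrier M; y \<in> carrier M\<rbrakk> \<Longrightarrow> f (x \<oplus>\<^bsub>M\<^esub> y) = f x \<oplus>\<^bsub>N\<^esub> f y"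
    and "\<And>r x. \<lbrakk>r \<in> carrier R; x \<in> carrier M\<rbrakk> \<Longrightarrow> f (r \<odot>\<^bsub>M\<^esub> x) = r \<odot>\<^bsub>N\<^esub> f x"
  shows "linear_map R M N f"
  using assms unfolding linear_map_def by auto

lemma linear_map_closed: "linear_map R M N f \<Longrightarrow> x \<in> carrier M \<Longrightarrow> f x \<in> carrier N"
  and linear_map_add: "linear_map R M N f \<Longrightarrow> x \<in> carrier M \<Longrightarrow> y \<in> carrier M \<Longrightarrow>
    f (x \<oplus>\<^bsub>M\<^esub> y) = f x \<oplus>\<^bsub>N\<^esub> f y"
  and linear_map_smult: "linear_map R M N f \<Longrightarrow> r \<in> carrier R \<Longrightarrow> x \<in> carrier M \<Longrightarrow>
    f (r \<odot>\<^bsub>M\<^esub> x) = r \<odot>\<^bsub>N\<^esub> f x"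
  unfolding linear_map_def by auto

lemma linear_map_zero:
  assumes "module R M" "module R N" "linear_map R M N f"
  shows "f \<zero>\<^bsub>M\<^esub> = \<zero>\<^bsub>N\<^esub>"
proof -
  interpret M: module R M by fact
  interpret N: module R N by fact
  show ?thesis
    using linear_map_smult[OF assms(3), of "\<zero>\<^bsub>R\<^esub>" "\<zero>\<^bsub>M\<^esub>"] linear_map_closed[OF assms(3), of "\<zero>\<^bsub>M\<^esub>"]
    by simp
qed

lemma linear_map_compose:
  "linear_map R M N f \<Longrightarrow> linear_map R N P g \<Longrightarrow> linear_map R M P (\<lambda>x. g (f x))"
  unfolding linear_map_def by (auto simp: Pi_iff)

lemma linear_map_cong:
  assumes "linear_map R M N f" "module R M" "\<And>x. x \<in> carrier M \<Longrightarrow> g x = f x"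
  shows "linear_map R M N g"
proof -
  interpret M: module R M by fact
  show ?thesis using assms(1,3) unfolding linear_map_def by (auto simp: Pi_iff)
qed

text \<open>
  A bilinear map is one that is linear in each argument separately; phrased through
  \<open>linear_map\<close>, bilinearity of a concrete expression is checked by the same rules as linearity.
\<close>

definition bilinear_map ::
  "('k, 'r) ring_scheme \<Rightarrow> ('k, 'a, 'x) module_scheme \<Rightarrow> ('k, 'b, 'y) module_scheme \<Rightarrow>
    ('k, 'c, 'z) module_scheme \<Rightarrow> ('a \<Rightarrow> 'b \<Rightarrow> 'c) \<Rightarrow> bool"
  where "bilinear_map R M N P f \<longleftrightarrow>
    (\<forall>m\<in>carrier M. linear_map R N P (f m)) \<and> (\<forall>n\<in>carrier N. linear_map R M P (\<lambda>m. f m n))"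

lemma bilinear_mapI:
  assumes "\<And>m. m \<in> carrier M \<Longrightarrow> linear_map R N P (\<lambda>n. f m n)"
    and "\<And>n. n \<in> carrier N \<Longrightarrow> linear_map R M P (\<lambda>m. f m n)"
  shows "bilinear_map R M N P f"
  using assms unfolding bilinear_map_def by auto

lemma bilinear_map_left:
    "bilinear_map R M N P f \<Longrightarrow> n \<in> carrier N \<Longrightarrow> linear_map R M P (\<lambda>m. f m n)"
  and bilinear_map_right:
    "bilinear_map R M N P f \<Longrightarrow> m \<in> carrier M \<Longrightarrow> linear_map R N P (f m)"
  and bilinear_map_closed:
    "bilinear_map R M N P f \<Longrightarrow> m \<in> carrier M \<Longrightarrow> n \<in> carrier N \<Longrightarrow> f m n \<in> carrier P"
  unfolding bilinear_map_def by (auto dest: linear_map_closed)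

definition formal_sum :: "('c, 'z) ring_scheme \<Rightarrow> ('a \<Rightarrow> 'b \<Rightarrow> 'c) \<Rightarrow> ('a \<times> 'b) list \<Rightarrow> 'c"
  where "formal_sum P f xs = foldr (\<lambda>(m, n) s. f m n \<oplus>\<^bsub>P\<^esub> s) xs \<zero>\<^bsub>P\<^esub>"

lemma tensor_lift_formal_sum: "tensor_lift P f t = formal_sum P f (rep t)"
  by (simp add: tensor_lift_def formal_sum_def)

lemma formal_sum_Nil [simp]: "formal_sum P f [] = \<zero>\<^bsub>P\<^esub>"
  and formal_sum_Cons [simp]: "formal_sum P f ((m, n) # xs) = f m n \<oplus>\<^bsub>P\<^esub> formal_sum P f xs"
  by (simp_all add: formal_sum_def)

lemma formal_sum_closed:
  assumes "abelian_monoid P" "\<And>m n. (m, n) \<in> set xs \<Longrightarrow> f m n \<in> carrier P"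
  shows "formal_sum P f xs \<in> carrier P"
proof -
  interpret abelian_monoid P by fact
  show ?thesis using assms(2) by (induction xs) auto
qed

lemma formal_sum_append:
  assumes "abelian_monoid P" "\<And>m n. (m, n) \<in> set (xs @ ys) \<Longrightarrow> f m n \<in> carrier P"
  shows "formal_sum P f (xs @ ys) = formal_sum P f xs \<oplus>\<^bsub>P\<^esub> formal_sum P f ys"
proof -
  interpret abelian_monoid P by fact
  show ?thesis using assms(2)
  proof (induction xs)
    case Nil
    then show ?case using formal_sum_closed[OF assms(1), of ys f] by simp
  next
    case (Cons x xs)
    then show ?case
      using formal_sum_closed[OF assms(1), of ys f] formal_sum_closed[OF assms(1), of xs f]
      by (cases x) (auto simp: a_assoc)
  qed
qed

lemma formal_sum_cong:
  "(\<And>m n. (m, n) \<in> set xs \<Longrightarrow> f m n = g m n) \<Longrightarrow> formal_sum P f xs = formal_sum P g xs"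
  by (induction xs) auto

lemma linear_map_formal_sum:
  assumes "module R P" "module R Q" "linear_map R P Q g"
    and "\<And>m n. (m, n) \<in> set xs \<Longrightarrow> f m n \<in> carrier P"
  shows "g (formal_sum P f xs) = formal_sum Q (\<lambda>m n. g (f m n)) xs"
proof -
  interpret P: module R P by fact
  show ?thesis using assms(4)
    by (induction xs)
      (auto simp: linear_map_zero[OF assms(1-3)] linear_map_add[OF assms(3)]
        formal_sum_closed[OF P.abelian_monoid_axioms])
qed

text \<open>
  Tensors are classes of words, that is, of lists of pairs. All module laws are checked on words,
  where \<open>scale r\<close> is scalar multiplication and concatenation is addition.
\<close>

locale two_modules = M: module R M + N: module R N
  for R :: "('k, 'r) ring_scheme" and M :: "('k, 'a, 'x) module_scheme"
    and N :: "('k, 'b, 'y) module_scheme"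
begin

abbreviation "teq \<equiv> tensor_eq R M N"
abbreviation "cls \<equiv> tensor_class R M N"
abbreviation "words \<equiv> lists (carrier M \<times> carrier N)"
abbreviation "scale r \<equiv> map (\<lambda>(m, n). (r \<odot>\<^bsub>M\<^esub> m, n))"

lemma eq_words:
  assumes "teq xs ys"
  shows "xs \<in> words \<and> ys \<in> words"
  using assms by (induction) (auto simp: subset_iff)

lemma eq_append_commute: "xs \<in> words \<Longrightarrow> ys \<in> words \<Longrightarrow> teq (xs @ ys) (ys @ xs)"
  by (intro tensor_eq.commute) auto

lemma eq_refl: "xs \<in> words \<Longrightarrow> teq xs xs"
  by (intro tensor_eq.refl) auto

lemma class_eq_iff: "ys \<in> words \<Longrightarrow> cls xs = cls ys \<longleftrightarrow> teq xs ys"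
  unfolding tensor_class_def
  by (blast intro: tensor_eq.sym tensor_eq.trans eq_refl)

lemma rep_class: "xs \<in> words \<Longrightarrow> teq xs (rep (cls xs))"
  unfolding rep_def tensor_class_def using someI[of "\<lambda>ys. ys \<in> {ys. teq xs ys}" xs] eq_refl by blast

lemma rep_words: "t \<in> carrier (tensor R M N) \<Longrightarrow> rep t \<in> words"
  and class_rep: "t \<in> carrier (tensor R M N) \<Longrightarrow> cls (rep t) = t"
proof -
  assume "t \<in> carrier (tensor R M N)"
  then obtain xs where xs: "xs \<in> words" "t = cls xs" by (auto simp: tensor_def)
  show w: "rep t \<in> words" using rep_class[OF xs(1)] eq_words xs(2) by blast
  show "cls (rep t) = t" using rep_class[OF xs(1)] xs class_eq_iff[OF w] by metis
qed

lemma class_closed: "xs \<in> words \<Longrightarrow> cls xs \<in> carrier (tensor R M N)"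
  by (simp add: tensor_def)

lemma scale_words: "r \<in> carrier R \<Longrightarrow> xs \<in> words \<Longrightarrow> scale r xs \<in> words"
  by (induction xs) auto

lemma eq_scale:
  assumes "teq xs ys" "r \<in> carrier R"
  shows "teq (scale r xs) (scale r ys)"
  using assms(1)
proof (induction)
  case (refl xs)
  then show ?case using scale_words[OF assms(2), of xs] eq_refl by blast
next
  case (commute xs ys)
  then have "xs \<in> words" "ys \<in> words" by auto
  then show ?case using eq_append_commute scale_words[OF assms(2)] by simp
next
  case (balanced s m n)
  have "r \<odot>\<^bsub>M\<^esub> (s \<odot>\<^bsub>M\<^esub> m) = s \<odot>\<^bsub>M\<^esub> (r \<odot>\<^bsub>M\<^esub> m)"
    using balanced assms(2) by (simp flip: M.smult_assoc1 add: M.m_comm)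
  then show ?case using balanced assms(2) by (simp add: tensor_eq.balanced)
next
  case (sym xs ys)
  then show ?case by (blast intro: tensor_eq.sym)
next
  case (trans xs ys zs)
  then show ?case by (blast intro: tensor_eq.trans)
next
  case (append xs xs' ys ys')
  then show ?case by (simp add: tensor_eq.append)
next
  case (zero n)
  then show ?case using assms(2) by (simp add: tensor_eq.zero)
next
  case (add_left m m' n)
  then show ?case using assms(2) by (simp add: M.smult_r_distr tensor_eq.add_left)
next
  case (add_right m n n')
  then show ?case using assms(2) by (simp add: tensor_eq.add_right)
qed

lemma add_class:
  "xs \<in> words \<Longrightarrow> ys \<in> words \<Longrightarrow> cls xs \<oplus>\<^bsub>tensor R M N\<^esub> cls ys = cls (xs @ ys)"
  using rep_class[of xs] rep_class[of ys]
  by (simp add: tensor_def class_eq_iff tensor_eq.append tensor_eq.sym)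

lemma smult_class:
  "r \<in> carrier R \<Longrightarrow> xs \<in> words \<Longrightarrow> r \<odot>\<^bsub>tensor R M N\<^esub> cls xs = cls (scale r xs)"
  using rep_class[of xs] by (simp add: tensor_def class_eq_iff scale_words eq_scale tensor_eq.sym)

lemma zero_class: "\<zero>\<^bsub>tensor R M N\<^esub> = cls []"
  by (simp add: tensor_def)

lemma tensor_cases:
  assumes "t \<in> carrier (tensor R M N)"
  obtains xs where "xs \<in> words" "t = cls xs"
  using assms by (auto simp: tensor_def)

text \<open>
  After additivity in the first argument both words contain the same pairs, in different orders.
\<close>

lemma eq_scale_add:
  assumes "r \<in> carrier R" "s \<in> carrier R" "xs \<in> words"
  shows "teq (scale (r \<oplus>\<^bsub>R\<^esub> s) xs) (scale r xs @ scale s xs)"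
  using assms(3)
proof (induction xs)
  case Nil
  then show ?case by (simp add: tensor_eq.refl)
next
  case (Cons x xs)
  obtain m n where x: "x = (m, n)" "m \<in> carrier M" "n \<in> carrier N" using Cons.hyps by (cases x) auto
  let ?r = "(r \<odot>\<^bsub>M\<^esub> m, n)" and ?s = "(s \<odot>\<^bsub>M\<^esub> m, n)"
  have w: "scale r xs \<in> words" "scale s xs \<in> words" "[?r] \<in> words" "[?s] \<in> words"
    using scale_words assms Cons.hyps x by auto
  have "teq ([((r \<oplus>\<^bsub>R\<^esub> s) \<odot>\<^bsub>M\<^esub> m, n)] @ scale (r \<oplus>\<^bsub>R\<^esub> s) xs)
      ([?r, ?s] @ (scale r xs @ scale s xs))"
    by (rule tensor_eq.append) (use x assms Cons.IH in \<open>simp_all add: M.smult_l_distr tensor_eq.add_left\<close>)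
  moreover have "teq ([?r] @ (([?s] @ scale r xs) @ scale s xs)) ([?r] @ ((scale r xs @ [?s]) @ scale s xs))"
    by (rule tensor_eq.append[OF eq_refl[OF w(3)]
        tensor_eq.append[OF eq_append_commute[OF w(4,1)] eq_refl[OF w(2)]]])
  then have "teq ([?r, ?s] @ (scale r xs @ scale s xs)) (?r # (scale r xs @ [?s]) @ scale s xs)"
    by simp
  ultimately have "teq ([((r \<oplus>\<^bsub>R\<^esub> s) \<odot>\<^bsub>M\<^esub> m, n)] @ scale (r \<oplus>\<^bsub>R\<^esub> s) xs)
      (?r # (scale r xs @ [?s]) @ scale s xs)"
    by (rule tensor_eq.trans)
  then show ?case by (simp add: x)
qed

lemma module_tensor: "module R (tensor R M N)"
proof (rule moduleI)
  let ?T = "tensor R M N"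
  show "cring R" by (rule M.R.cring_axioms)
  show smult_add: "(a \<oplus>\<^bsub>R\<^esub> b) \<odot>\<^bsub>?T\<^esub> x = a \<odot>\<^bsub>?T\<^esub> x \<oplus>\<^bsub>?T\<^esub> b \<odot>\<^bsub>?T\<^esub> x"
    if "a \<in> carrier R" "b \<in> carrier R" "x \<in> carrier ?T" for a b x
    using that(3)
  proof (rule tensor_cases)
    fix xs assume xs: "xs \<in> words" "x = cls xs"
    have "cls (scale (a \<oplus>\<^bsub>R\<^esub> b) xs) = cls (scale a xs @ scale b xs)"
      using eq_scale_add[OF that(1,2) xs(1)] eq_words class_eq_iff by blast
    then show ?thesis using that xs by (simp add: smult_class add_class scale_words)
  qed
  show one: "\<one>\<^bsub>R\<^esub> \<odot>\<^bsub>?T\<^esub> x = x" if "x \<in> carrier ?T" for x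
    using that
  proof (rule tensor_cases)
    fix xs assume xs: "xs \<in> words" "x = cls xs"
    have "scale \<one>\<^bsub>R\<^esub> xs = xs" using xs(1) by (induction xs) auto
    then show ?thesis using xs by (simp add: smult_class)
  qed
  have null: "\<zero>\<^bsub>R\<^esub> \<odot>\<^bsub>?T\<^esub> x = \<zero>\<^bsub>?T\<^esub>" if "x \<in> carrier ?T" for x
    using that
  proof (rule tensor_cases)
    fix xs assume xs: "xs \<in> words" "x = cls xs"
    have "teq (scale \<zero>\<^bsub>R\<^esub> xs) []" using xs(1)
    proof (induction xs)
      case Nil
      then show ?case by (simp add: tensor_eq.refl)
    next
      case (Cons x xs)
      then obtain m n where x: "x = (m, n)" "m \<in> carrier M" "n \<in> carrier N" by (cases x) auto
      have "teq ([(\<zero>\<^bsub>M\<^esub>, n)] @ scale \<zero>\<^bsub>R\<^esub> xs) ([] @ [])"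
        using x Cons by (intro tensor_eq.append tensor_eq.zero) auto
      then show ?case by (simp add: x)
    qed
    then show ?thesis using xs by (simp add: smult_class zero_class class_eq_iff)
  qed
  show "a \<odot>\<^bsub>?T\<^esub> x \<in> carrier ?T" if "a \<in> carrier R" "x \<in> carrier ?T" for a x
    using that(2) by (rule tensor_cases) (simp add: that smult_class class_closed scale_words)
  \<comment> \<open>the scalar \<open>- 1\<close> provides the additive inverses\<close>
  then have neg: "\<ominus>\<^bsub>R\<^esub> \<one>\<^bsub>R\<^esub> \<odot>\<^bsub>?T\<^esub> x \<in> carrier ?T" if "x \<in> carrier ?T" for x using that by simp
  show "abelian_group ?T"
  proof (rule abelian_groupI)
    show "\<exists>y\<in>carrier ?T. y \<oplus>\<^bsub>?T\<^esub> x = \<zero>\<^bsub>?T\<^esub>" if "x \<in> carrier ?T" for x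
    proof (rule bexI[OF _ neg[OF that]])
      have "(\<ominus>\<^bsub>R\<^esub> \<one>\<^bsub>R\<^esub> \<oplus>\<^bsub>R\<^esub> \<one>\<^bsub>R\<^esub>) \<odot>\<^bsub>?T\<^esub> x = \<ominus>\<^bsub>R\<^esub> \<one>\<^bsub>R\<^esub> \<odot>\<^bsub>?T\<^esub> x \<oplus>\<^bsub>?T\<^esub> \<one>\<^bsub>R\<^esub> \<odot>\<^bsub>?T\<^esub> x"
        using that by (intro smult_add) auto
      then show "\<ominus>\<^bsub>R\<^esub> \<one>\<^bsub>R\<^esub> \<odot>\<^bsub>?T\<^esub> x \<oplus>\<^bsub>?T\<^esub> x = \<zero>\<^bsub>?T\<^esub>"
        using that by (simp add: M.R.l_neg null one)
    qed
    show "x \<oplus>\<^bsub>?T\<^esub> y \<in> carrier ?T" if "x \<in> carrier ?T" "y \<in> carrier ?T" for x y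
    proof -
      from that obtain xs ys where "xs \<in> words" "x = cls xs" "ys \<in> words" "y = cls ys"
        by (metis tensor_cases)
      then show ?thesis by (simp add: add_class class_closed del: in_lists_conv_set)
    qed
    show "x \<oplus>\<^bsub>?T\<^esub> y \<oplus>\<^bsub>?T\<^esub> z = x \<oplus>\<^bsub>?T\<^esub> (y \<oplus>\<^bsub>?T\<^esub> z)"
      if "x \<in> carrier ?T" "y \<in> carrier ?T" "z \<in> carrier ?T" for x y z
    proof -
      from that obtain xs ys zs where "xs \<in> words" "x = cls xs" "ys \<in> words" "y = cls ys"
        "zs \<in> words" "z = cls zs" by (metis tensor_cases)
      then show ?thesis by (simp add: add_class del: in_lists_conv_set)
    qed
    show "x \<oplus>\<^bsub>?T\<^esub> y = y \<oplus>\<^bsub>?T\<^esub> x" if "x \<in> carrier ?T" "y \<in> carrier ?T" for x y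
      using that(1)
    proof (rule tensor_cases)
      fix xs assume xs: "xs \<in> words" "x = cls xs"
      show ?thesis using that(2)
      proof (rule tensor_cases)
        fix ys assume "ys \<in> words" "y = cls ys"
        with xs show ?thesis using class_eq_iff[of "ys @ xs" "xs @ ys"]
          by (simp add: add_class eq_append_commute)
      qed
    qed
    show "\<zero>\<^bsub>?T\<^esub> \<in> carrier ?T" by (simp add: zero_class class_closed)
    show "\<zero>\<^bsub>?T\<^esub> \<oplus>\<^bsub>?T\<^esub> x = x" if "x \<in> carrier ?T" for x
      using that by (rule tensor_cases) (simp add: add_class zero_class)
  qed
  show "a \<odot>\<^bsub>?T\<^esub> (x \<oplus>\<^bsub>?T\<^esub> y) = a \<odot>\<^bsub>?T\<^esub> x \<oplus>\<^bsub>?T\<^esub> a \<odot>\<^bsub>?T\<^esub> y"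
    if "a \<in> carrier R" "x \<in> carrier ?T" "y \<in> carrier ?T" for a x y
    using that(2)
  proof (rule tensor_cases)
    fix xs assume xs: "xs \<in> words" "x = cls xs"
    show ?thesis using that(3) by (rule tensor_cases)
      (simp add: xs that(1) smult_class add_class scale_words)
  qed
  show "(a \<otimes>\<^bsub>R\<^esub> b) \<odot>\<^bsub>?T\<^esub> x = a \<odot>\<^bsub>?T\<^esub> (b \<odot>\<^bsub>?T\<^esub> x)"
    if "a \<in> carrier R" "b \<in> carrier R" "x \<in> carrier ?T" for a b x
    using that(3)
  proof (rule tensor_cases)
    fix xs assume xs: "xs \<in> words" "x = cls xs"
    have "scale (a \<otimes>\<^bsub>R\<^esub> b) xs = scale a (scale b xs)"
      using xs(1) that by (induction xs) (auto simp: M.smult_assoc1)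
    then show ?thesis using xs that by (simp add: smult_class scale_words del: map_map map_eq_conv)
  qed
qed

lemma pure_bilinear: "bilinear_map R M N (tensor R M N) (pure R M N)"
proof (intro bilinear_mapI linear_mapI)
  fix m n assume m: "m \<in> carrier M" and n: "n \<in> carrier N"
  then show "pure R M N m n \<in> carrier (tensor R M N)"
    by (simp add: pure_def class_closed)
  then show "pure R M N m n \<in> carrier (tensor R M N)" .
  fix r assume r: "r \<in> carrier R"
  show left: "pure R M N (r \<odot>\<^bsub>M\<^esub> m) n = r \<odot>\<^bsub>tensor R M N\<^esub> pure R M N m n"
    using m n r by (simp add: pure_def smult_class)
  have "pure R M N m (r \<odot>\<^bsub>N\<^esub> n) = pure R M N (r \<odot>\<^bsub>M\<^esub> m) n"
    unfolding pure_def using m n r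
    by (subst class_eq_iff) (auto intro: tensor_eq.balanced[THEN tensor_eq.sym])
  with left show "pure R M N m (r \<odot>\<^bsub>N\<^esub> n) = r \<odot>\<^bsub>tensor R M N\<^esub> pure R M N m n" by simp
next
  fix m n n' assume "m \<in> carrier M" "n \<in> carrier N" "n' \<in> carrier N"
  then show "pure R M N m (n \<oplus>\<^bsub>N\<^esub> n') = pure R M N m n \<oplus>\<^bsub>tensor R M N\<^esub> pure R M N m n'"
    unfolding pure_def by (subst add_class) (auto simp: class_eq_iff tensor_eq.add_right)
next
  fix m m' n assume "m \<in> carrier M" "m' \<in> carrier M" "n \<in> carrier N"
  then show "pure R M N (m \<oplus>\<^bsub>M\<^esub> m') n = pure R M N m n \<oplus>\<^bsub>tensor R M N\<^esub> pure R M N m' n"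
    unfolding pure_def by (subst add_class) (auto simp: class_eq_iff tensor_eq.add_left)
qed

text \<open>
  Every tensor is a sum of pure ones. The empty sum needs no case of its own, because it equals
  \<open>0 \<otimes> 0\<close>.
\<close>

lemma tensor_induct:
  assumes "t \<in> carrier (tensor R M N)"
    and "\<And>m n. \<lbrakk>m \<in> carrier M; n \<in> carrier N\<rbrakk> \<Longrightarrow> Q (pure R M N m n)"
    and "\<And>x y. \<lbrakk>x \<in> carrier (tensor R M N); y \<in> carrier (tensor R M N); Q x; Q y\<rbrakk> \<Longrightarrow>
      Q (x \<oplus>\<^bsub>tensor R M N\<^esub> y)"
  shows "Q t"
  using assms(1)
proof (rule tensor_cases)
  fix xs assume xs: "xs \<in> words" "t = cls xs"
  have "Q (cls xs)" using xs(1)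
  proof (induction xs)
    case Nil
    have "cls [(\<zero>\<^bsub>M\<^esub>, \<zero>\<^bsub>N\<^esub>)] = cls []" by (simp add: class_eq_iff tensor_eq.zero)
    then show ?case using assms(2)[of "\<zero>\<^bsub>M\<^esub>" "\<zero>\<^bsub>N\<^esub>"] by (simp add: pure_def)
  next
    case (Cons x xs)
    then obtain m n where x: "x = (m, n)" "m \<in> carrier M" "n \<in> carrier N" by (cases x) auto
    have "cls (x # xs) = pure R M N m n \<oplus>\<^bsub>tensor R M N\<^esub> cls xs"
      unfolding pure_def using x Cons by (subst add_class) auto
    then show ?case using assms(2)[OF x(2,3)] assms(3)[of "pure R M N m n" "cls xs"] Cons x
      by (simp add: pure_def class_closed)
  qed
  then show ?thesis by (simp add: xs(2))
qed

text \<open>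
  The universal property: each defining relation of the tensor product is respected by a bilinear
  map into a module.
\<close>

lemma formal_sum_eq:
  assumes "module R P" "bilinear_map R M N P f" "teq xs ys"
  shows "formal_sum P f xs = formal_sum P f ys"
proof -
  interpret P: module R P by fact
  note mono = P.abelian_monoid_axioms
  note lin = bilinear_map_left[OF assms(2)] bilinear_map_right[OF assms(2)]
  note closed = bilinear_map_closed[OF assms(2)]
  show ?thesis using assms(3)
  proof (induction)
    case (append xs xs' ys ys')
    then show ?case using eq_words[OF append.hyps(1)] eq_words[OF append.hyps(2)]
      by (subst (1 2) formal_sum_append[OF mono]) (auto intro!: closed)
  next
    case (commute xs ys)
    then have "formal_sum P f xs \<in> carrier P" "formal_sum P f ys \<in> carrier P"
      by (auto intro!: formal_sum_closed[OF mono] closed)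
    moreover have "formal_sum P f (xs @ ys) = formal_sum P f xs \<oplus>\<^bsub>P\<^esub> formal_sum P f ys"
        "formal_sum P f (ys @ xs) = formal_sum P f ys \<oplus>\<^bsub>P\<^esub> formal_sum P f xs"
      using commute by (auto intro!: formal_sum_append[OF mono] closed)
    ultimately show ?case by (simp add: P.a_comm)
  next
    case (zero n)
    then show ?case using linear_map_zero[OF M.module_axioms assms(1) lin(1), of n] by simp
  next
    case (add_left m m' n)
    then show ?case using linear_map_add[OF lin(1), of n m m'] closed by (simp add: P.a_assoc)
  next
    case (add_right m n n')
    then show ?case using linear_map_add[OF lin(2), of m n n'] closed by (simp add: P.a_assoc)
  next
    case (balanced r m n)
    then show ?case using linear_map_smult[OF lin(1), of n r m] linear_map_smult[OF lin(2), of m r n]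
      by simp
  qed simp_all
qed

lemma tensor_lift_class:
  assumes "module R P" "bilinear_map R M N P f" "xs \<in> words"
  shows "tensor_lift P f (cls xs) = formal_sum P f xs"
  using formal_sum_eq[OF assms(1,2) tensor_eq.sym[OF rep_class[OF assms(3)]]]
  by (simp add: tensor_lift_formal_sum)

lemma tensor_lift_pure:
  assumes "module R P" "bilinear_map R M N P f" "m \<in> carrier M" "n \<in> carrier N"
  shows "tensor_lift P f (pure R M N m n) = f m n"
proof -
  interpret P: module R P by fact
  show ?thesis using assms(3,4) bilinear_map_closed[OF assms(2-4)]
    by (simp add: pure_def tensor_lift_class[OF assms(1,2)])
qed

lemma tensor_lift_closed:
  assumes "module R P" "t \<in> carrier (tensor R M N)"
    and "\<And>m n. \<lbrakk>m \<in> carrier M; n \<in> carrier N\<rbrakk> \<Longrightarrow> f m n \<in> carrier P"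
  shows "tensor_lift P f t \<in> carrier P"
proof -
  interpret P: module R P by fact
  show ?thesis using rep_words[OF assms(2)] assms(3) unfolding tensor_lift_formal_sum
    by (intro formal_sum_closed P.abelian_monoid_axioms) auto
qed

lemma tensor_lift_linear:
  assumes "module R P" "bilinear_map R M N P f"
  shows "linear_map R (tensor R M N) P (tensor_lift P f)"
proof (rule linear_mapI)
  interpret P: module R P by fact
  note closed = bilinear_map_closed[OF assms(2)]
  show "tensor_lift P f t \<in> carrier P" if "t \<in> carrier (tensor R M N)" for t
    using tensor_lift_closed[OF assms(1) that] closed by blast
  fix t assume "t \<in> carrier (tensor R M N)"
  then obtain xs where xs: "xs \<in> words" "t = cls xs" by (rule tensor_cases)
  note lift = tensor_lift_class[OF assms]
  {
    fix u assume "u \<in> carrier (tensor R M N)"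
    then obtain ys where ys: "ys \<in> words" "u = cls ys" by (rule tensor_cases)
    show "tensor_lift P f (t \<oplus>\<^bsub>tensor R M N\<^esub> u) = tensor_lift P f t \<oplus>\<^bsub>P\<^esub> tensor_lift P f u"
      using xs ys by (auto simp: add_class lift intro!: formal_sum_append[OF P.abelian_monoid_axioms] closed)
  next
    fix r assume r: "r \<in> carrier R"
    have "formal_sum P f (scale r xs) = r \<odot>\<^bsub>P\<^esub> formal_sum P f xs" using xs(1)
    proof (induction xs)
      case Nil
      then show ?case using r by simp
    next
      case (Cons x xs)
      then obtain m n where x: "x = (m, n)" "m \<in> carrier M" "n \<in> carrier N" by (cases x) auto
      have "formal_sum P f xs \<in> carrier P" using Cons closed
        by (intro formal_sum_closed[OF P.abelian_monoid_axioms]) auto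
      then show ?case
        using x r Cons closed linear_map_smult[OF bilinear_map_left[OF assms(2)], of n r m]
        by (simp add: P.smult_r_distr)
    qed
    then show "tensor_lift P f (r \<odot>\<^bsub>tensor R M N\<^esub> t) = r \<odot>\<^bsub>P\<^esub> tensor_lift P f t"
      using xs r by (simp add: smult_class lift scale_words)
  }
qed

end

section \<open>Sweedler calculus\<close>

text \<open>
  The sum of \<open>f m n\<close> over the legs \<open>m\<close>, \<open>n\<close> of a tensor \<open>t\<close> in \<open>M \<otimes> N\<close>, with values in \<open>P\<close>.
  It agrees with \<open>tensor_lift\<close>, but records the source, so that well-typedness and linearity of
  nested sums can be decided by conditional rewriting; and the integrand only matters on the
  carriers, so that the congruence rule holds without side conditions.
\<close>

definition sweedler ::
  "('k, 'a, 'x) module_scheme \<Rightarrow> ('k, 'b, 'y) module_scheme \<Rightarrow> ('k, 'c, 'z) module_scheme \<Rightarrow>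
    ('a \<Rightarrow> 'b \<Rightarrow> 'c) \<Rightarrow> ('a \<times> 'b) list set \<Rightarrow> 'c"
  where "sweedler M N P f =
    tensor_lift P (\<lambda>m n. if m \<in> carrier M \<and> n \<in> carrier N then f m n else undefined)"

lemma sweedler_cong:
  assumes "t = t'" "\<And>m n. \<lbrakk>m \<in> carrier M; n \<in> carrier N\<rbrakk> \<Longrightarrow> f m n = g m n"
  shows "sweedler M N P f t = sweedler M N P g t'"
proof -
  have "(\<lambda>m n. if m \<in> carrier M \<and> n \<in> carrier N then f m n else undefined) =
      (\<lambda>m n. if m \<in> carrier M \<and> n \<in> carrier N then g m n else undefined)"
    using assms(2) by (intro ext) auto
  then show ?thesis by (simp add: sweedler_def assms(1))
qed

lemma sweedler_cong_simp [cong]: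
  assumes "M = M'" "N = N'" "P = P'" "t = t'"
    and "\<And>m n. \<lbrakk>m \<in> carrier M'; n \<in> carrier N'\<rbrakk> \<Longrightarrow> f m n = g m n"
  shows "sweedler M N P f t = sweedler M' N' P' g t'"
  using assms by (auto intro: sweedler_cong)

text \<open>
  The simplification rules of this locale decide membership in carriers and (bi)linearity of
  expressions that are built from pure tensors, scalar multiples and sums over legs, by recursion
  on the expression. They discharge almost all side conditions of the computations below, which
  can then follow the usual calculations in Sweedler notation.
\<close>

locale tensor_calculus = cring R for R :: "('k, 'r) ring_scheme"
begin

lemma two_modulesI: "module R M \<Longrightarrow> module R N \<Longrightarrow> two_modules R M N"
  by (rule two_modules.intro)

lemma module_tensor [simp]: "module R M \<Longrightarrow> module R N \<Longrightarrow> module R (tensor R M N)"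
  by (rule two_modules.module_tensor[OF two_modulesI])

lemma carrier_scalar [simp]: "carrier (scalar_module R) = carrier R"
  by (simp add: scalar_module_def)

lemma smult_closed [simp]:
  "module R M \<Longrightarrow> r \<in> carrier R \<Longrightarrow> m \<in> carrier M \<Longrightarrow> r \<odot>\<^bsub>M\<^esub> m \<in> carrier M"
  by (rule module.smult_closed)

lemma pure_closed [simp]:
  "module R M \<Longrightarrow> module R N \<Longrightarrow> m \<in> carrier M \<Longrightarrow> n \<in> carrier N \<Longrightarrow>
    pure R M N m n \<in> carrier (tensor R M N)"
  by (rule bilinear_map_closed[OF two_modules.pure_bilinear[OF two_modulesI]])

lemma tensor_lift_sweedler:
  assumes "module R M" "module R N" "t \<in> carrier (tensor R M N)"
  shows "tensor_lift P f t = sweedler M N P f t"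
proof -
  interpret two_modules R M N using assms(1,2) by (rule two_modulesI)
  show ?thesis unfolding sweedler_def tensor_lift_formal_sum
    using rep_words[OF assms(3)] by (intro formal_sum_cong) auto
qed

lemma sweedler_closed [simp]:
  assumes "module R M" "module R N" "module R P" "t \<in> carrier (tensor R M N)"
    and "\<And>m n. \<lbrakk>m \<in> carrier M; n \<in> carrier N\<rbrakk> \<Longrightarrow> f m n \<in> carrier P"
  shows "sweedler M N P f t \<in> carrier P"
  using two_modules.tensor_lift_closed[OF two_modulesI[OF assms(1,2)] assms(3,4), of f] assms
  by (simp flip: tensor_lift_sweedler)

lemma bilinear_mapI' [simp]:
  assumes "\<And>m. m \<in> carrier M \<Longrightarrow> linear_map R N P (\<lambda>n. f m n)"
    and "\<And>n. n \<in> carrier N \<Longrightarrow> linear_map R M P (\<lambda>m. f m n)"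
  shows "bilinear_map R M N P f"
  using assms by (rule bilinear_mapI)

lemma sweedler_pure [simp]:
  assumes "module R M" "module R N" "module R P" "bilinear_map R M N P f"
    "m \<in> carrier M" "n \<in> carrier N"
  shows "sweedler M N P f (pure R M N m n) = f m n"
  using two_modules.tensor_lift_pure[OF two_modulesI[OF assms(1,2)] assms(3-6)] assms
  by (simp flip: tensor_lift_sweedler)

lemma sweedler_linear:
  assumes "module R M" "module R N" "module R P" "bilinear_map R M N P f"
  shows "linear_map R (tensor R M N) P (sweedler M N P f)"
  using two_modules.tensor_lift_linear[OF two_modulesI[OF assms(1,2)] assms(3,4)]
  by (rule linear_map_cong) (simp_all add: assms(1,2) flip: tensor_lift_sweedler)

text \<open>Pure tensors generate, so identities between linear maps need only be tested on them.\<close>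

lemma tensor_eqI:
  assumes "module R M" "module R N"
    and f: "linear_map R (tensor R M N) P f" and g: "linear_map R (tensor R M N) P g"
    and "\<And>m n. \<lbrakk>m \<in> carrier M; n \<in> carrier N\<rbrakk> \<Longrightarrow> f (pure R M N m n) = g (pure R M N m n)"
    and "t \<in> carrier (tensor R M N)"
  shows "f t = g t"
  using assms(6)
  by (rule two_modules.tensor_induct[OF two_modulesI[OF assms(1,2)]])
    (simp_all add: assms(5) linear_map_add[OF f] linear_map_add[OF g])

text \<open>
  A sum over the legs of \<open>t\<close> is a finite sum over a word that represents \<open>t\<close>, and linear maps
  commute with finite sums.
\<close>

lemma linear_sweedler:
  assumes "module R M" "module R N" "module R P" "module R Q" "linear_map R P Q g"
    and "t \<in> carrier (tensor R M N)"
    and "\<And>m n. \<lbrakk>m \<in> carrier M; n \<in> carrier N\<rbrakk> \<Longrightarrow> f m n \<in> carrier P"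
  shows "g (sweedler M N P f t) = sweedler M N Q (\<lambda>m n. g (f m n)) t"
proof -
  interpret two_modules R M N using assms(1,2) by (rule two_modulesI)
  have "g (formal_sum P f (rep t)) = formal_sum Q (\<lambda>m n. g (f m n)) (rep t)"
    using rep_words[OF assms(6)] assms(7) by (intro linear_map_formal_sum[OF assms(3-5)]) auto
  then show ?thesis by (simp add: assms flip: tensor_lift_formal_sum tensor_lift_sweedler)
qed


lemma linear_id [simp]: "linear_map R M M (\<lambda>x. x)"
  by (rule linear_mapI) simp_all

lemma linear_pure_left [simp]:
  "module R M \<Longrightarrow> module R N \<Longrightarrow> linear_map R X M f \<Longrightarrow> n \<in> carrier N \<Longrightarrow>
    linear_map R X (tensor R M N) (\<lambda>x. pure R M N (f x) n)"
  by (erule linear_map_compose)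
    (rule bilinear_map_left[OF two_modules.pure_bilinear[OF two_modulesI]])

lemma linear_pure_right [simp]:
  "module R M \<Longrightarrow> module R N \<Longrightarrow> linear_map R X N f \<Longrightarrow> m \<in> carrier M \<Longrightarrow>
    linear_map R X (tensor R M N) (\<lambda>x. pure R M N m (f x))"
  by (erule linear_map_compose)
    (rule bilinear_map_right[OF two_modules.pure_bilinear[OF two_modulesI]])

lemma linear_sweedler_argument [simp]:
  "module R M \<Longrightarrow> module R N \<Longrightarrow> module R P \<Longrightarrow> linear_map R X (tensor R M N) g \<Longrightarrow>
    bilinear_map R M N P f \<Longrightarrow> linear_map R X P (\<lambda>x. sweedler M N P f (g x))"
  by (erule linear_map_compose) (rule sweedler_linear)

lemma linear_smult_vector [simp]:
  assumes "module R P" "linear_map R X P f" "r \<in> carrier R"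
  shows "linear_map R X P (\<lambda>x. r \<odot>\<^bsub>P\<^esub> f x)"
proof -
  interpret P: module R P by fact
  show ?thesis using assms(2,3)
    by (auto intro!: linear_mapI simp: linear_map_add linear_map_smult linear_map_closed
      P.smult_r_distr m_comm simp flip: P.smult_assoc1)
qed

lemma linear_smult_scalar [simp]:
  assumes "module R P" "linear_map R X (scalar_module R) f" "p \<in> carrier P"
  shows "linear_map R X P (\<lambda>x. f x \<odot>\<^bsub>P\<^esub> p)"
proof -
  interpret P: module R P by fact
  show ?thesis using assms(3) linear_map_add[OF assms(2)] linear_map_smult[OF assms(2)]
      linear_map_closed[OF assms(2)]
    by (auto intro!: linear_mapI simp: P.smult_l_distr P.smult_assoc1 scalar_module_def)
qed

lemma sweedler_add:
  assumes "module R M" "module R N" "module R P" "t \<in> carrier (tensor R M N)"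
    and "\<And>m n. \<lbrakk>m \<in> carrier M; n \<in> carrier N\<rbrakk> \<Longrightarrow> f m n \<in> carrier P"
    and "\<And>m n. \<lbrakk>m \<in> carrier M; n \<in> carrier N\<rbrakk> \<Longrightarrow> g m n \<in> carrier P"
  shows "sweedler M N P (\<lambda>m n. f m n \<oplus>\<^bsub>P\<^esub> g m n) t = sweedler M N P f t \<oplus>\<^bsub>P\<^esub> sweedler M N P g t"
proof -
  interpret two_modules R M N using assms(1,2) by (rule two_modulesI)
  interpret P: module R P by fact
  have "formal_sum P (\<lambda>m n. f m n \<oplus>\<^bsub>P\<^esub> g m n) xs = formal_sum P f xs \<oplus>\<^bsub>P\<^esub> formal_sum P g xs"
    if "xs \<in> words" for xs
    using that
  proof (induction xs)
    case (Cons x xs)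
    then obtain m n where "x = (m, n)" "m \<in> carrier M" "n \<in> carrier N" by (cases x) auto
    moreover have "formal_sum P f xs \<in> carrier P" "formal_sum P g xs \<in> carrier P"
      using Cons.hyps assms(5,6) by (auto intro!: formal_sum_closed[OF P.abelian_monoid_axioms])
    ultimately show ?case using Cons.IH assms(5,6) by (simp add: P.a_ac)
  qed simp
  then show ?thesis using rep_words[OF assms(4)] assms(1,2,4)
    by (simp add: tensor_lift_formal_sum flip: tensor_lift_sweedler)
qed

lemma sweedler_smult:
  assumes "module R M" "module R N" "module R P" "t \<in> carrier (tensor R M N)" "r \<in> carrier R"
    and "\<And>m n. \<lbrakk>m \<in> carrier M; n \<in> carrier N\<rbrakk> \<Longrightarrow> f m n \<in> carrier P"
  shows "r \<odot>\<^bsub>P\<^esub> sweedler M N P f t = sweedler M N P (\<lambda>m n. r \<odot>\<^bsub>P\<^esub> f m n) t"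
  by (rule linear_sweedler[where g = "\<lambda>p. r \<odot>\<^bsub>P\<^esub> p"]) (simp_all add: assms)

lemma linear_sweedler_integrand [simp]:
  assumes "module R X" "module R M" "module R N" "module R P" "t \<in> carrier (tensor R M N)"
    and lin: "\<And>m n. \<lbrakk>m \<in> carrier M; n \<in> carrier N\<rbrakk> \<Longrightarrow> linear_map R X P (\<lambda>x. f x m n)"
  shows "linear_map R X P (\<lambda>x. sweedler M N P (f x) t)"
proof -
  interpret X: module R X by fact
  note closed = linear_map_closed[OF lin]
  show ?thesis
    by (intro linear_mapI)
      (simp_all add: assms(1-5) closed linear_map_add[OF lin] linear_map_smult[OF lin]
        sweedler_add sweedler_smult)
qed

lemma sweedler_eta [simp]:
  assumes "module R M" "module R N" "t \<in> carrier (tensor R M N)"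
  shows "sweedler M N (tensor R M N) (pure R M N) t = t"
  by (rule tensor_eqI[OF assms(1,2) _ _ _ assms(3), where P = "tensor R M N"])
    (simp_all add: assms)

text \<open>
  Sums over the legs of two tensors that do not depend on each other are finite sums over
  representing words, so they commute.
\<close>

lemma sweedler_swap:
  assumes "module R M" "module R N" "module R M'" "module R N'" "module R P"
    and "t \<in> carrier (tensor R M N)" "u \<in> carrier (tensor R M' N')"
    and "\<And>a b c d. \<lbrakk>a \<in> carrier M; b \<in> carrier N; c \<in> carrier M'; d \<in> carrier N'\<rbrakk> \<Longrightarrow>
      f a b c d \<in> carrier P"
  shows "sweedler M N P (\<lambda>a b. sweedler M' N' P (\<lambda>c d. f a b c d) u) t =
    sweedler M' N' P (\<lambda>c d. sweedler M N P (\<lambda>a b. f a b c d) t) u"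
proof -
  interpret A: two_modules R M N using assms(1,2) by (rule two_modulesI)
  interpret P: module R P by fact
  have "formal_sum P (\<lambda>a b. sweedler M' N' P (\<lambda>c d. f a b c d) u) xs =
      sweedler M' N' P (\<lambda>c d. formal_sum P (\<lambda>a b. f a b c d) xs) u"
    if "xs \<in> A.words" for xs
    using that
  proof (induction xs)
    case Nil
    have "\<zero>\<^bsub>R\<^esub> \<odot>\<^bsub>P\<^esub> sweedler M' N' P (\<lambda>c d. \<zero>\<^bsub>P\<^esub>) u = sweedler M' N' P (\<lambda>c d. \<zero>\<^bsub>R\<^esub> \<odot>\<^bsub>P\<^esub> \<zero>\<^bsub>P\<^esub>) u"
      by (rule sweedler_smult) (simp_all add: assms)
    then show ?case using assms by simp
  next
    case (Cons x xs)
    then obtain m n where "x = (m, n)" "m \<in> carrier M" "n \<in> carrier N" by (cases x) auto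
    moreover have "formal_sum P (\<lambda>a b. f a b c d) xs \<in> carrier P"
      if "c \<in> carrier M'" "d \<in> carrier N'" for c d
      using Cons.hyps that assms(8) by (auto intro!: formal_sum_closed[OF P.abelian_monoid_axioms])
    ultimately show ?case using Cons.IH by (simp add: sweedler_add assms)
  qed
  then show ?thesis using A.rep_words[OF assms(6)] assms(1,2,6)
    by (simp add: tensor_lift_formal_sum flip: tensor_lift_sweedler[of M N])
qed

text \<open>The next rules, applied from left to right, bring a nested expression into the form of
  iterated sums of scalar multiples of pure tensors.\<close>

lemma sweedler_sweedler:
  assumes "module R M" "module R N" "module R M'" "module R N'" "module R P"
    and "bilinear_map R M' N' P g" "t \<in> carrier (tensor R M N)"
    and "\<And>m n. \<lbrakk>m \<in> carrier M; n \<in> carrier N\<rbrakk> \<Longrightarrow> f m n \<in> carrier (tensor R M' N')"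
  shows "sweedler M' N' P g (sweedler M N (tensor R M' N') f t) =
    sweedler M N P (\<lambda>m n. sweedler M' N' P g (f m n)) t"
  by (rule linear_sweedler) (simp_all add: assms sweedler_linear)

lemma pure_sweedler_left:
  assumes "module R M" "module R N" "module R A" "module R B" "b \<in> carrier B"
    and "t \<in> carrier (tensor R M N)"
    and "\<And>m n. \<lbrakk>m \<in> carrier M; n \<in> carrier N\<rbrakk> \<Longrightarrow> f m n \<in> carrier A"
  shows "pure R A B (sweedler M N A f t) b =
    sweedler M N (tensor R A B) (\<lambda>m n. pure R A B (f m n) b) t"
  by (rule linear_sweedler[where g = "\<lambda>a. pure R A B a b"]) (simp_all add: assms)

lemma pure_sweedler_right:
  assumes "module R M" "module R N" "module R A" "module R B" "a \<in> carrier A"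
    and "t \<in> carrier (tensor R M N)"
    and "\<And>m n. \<lbrakk>m \<in> carrier M; n \<in> carrier N\<rbrakk> \<Longrightarrow> f m n \<in> carrier B"
  shows "pure R A B a (sweedler M N B f t) =
    sweedler M N (tensor R A B) (\<lambda>m n. pure R A B a (f m n)) t"
  by (rule linear_sweedler[where g = "\<lambda>b. pure R A B a b"]) (simp_all add: assms)

lemma pure_smult_left:
  "module R A \<Longrightarrow> module R B \<Longrightarrow> r \<in> carrier R \<Longrightarrow> a \<in> carrier A \<Longrightarrow> b \<in> carrier B \<Longrightarrow>
    pure R A B (r \<odot>\<^bsub>A\<^esub> a) b = r \<odot>\<^bsub>tensor R A B\<^esub> pure R A B a b"
  by (rule linear_map_smult[where f = "\<lambda>a. pure R A B a b" and M = A]) simp_all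

lemma pure_smult_right:
  "module R A \<Longrightarrow> module R B \<Longrightarrow> r \<in> carrier R \<Longrightarrow> a \<in> carrier A \<Longrightarrow> b \<in> carrier B \<Longrightarrow>
    pure R A B a (r \<odot>\<^bsub>B\<^esub> b) = r \<odot>\<^bsub>tensor R A B\<^esub> pure R A B a b"
  by (rule linear_map_smult[where f = "\<lambda>b. pure R A B a b" and M = B]) simp_all

section \<open>Functoriality and associativity of the tensor product\<close>

lemma tensor_map_sweedler:
  assumes "module R M" "module R N" "t \<in> carrier (tensor R M N)"
  shows "tensor_map R M' N' f g t =
    sweedler M N (tensor R M' N') (\<lambda>m n. pure R M' N' (f m) (g n)) t"
  by (simp add: tensor_map_def tensor_lift_sweedler[OF assms])

lemma linear_map_apply:
  "linear_map R M N f \<Longrightarrow> linear_map R X M g \<Longrightarrow> linear_map R X N (\<lambda>x. f (g x))"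
  by (rule linear_map_compose)

lemma tensor_map_linear:
  assumes "module R M" "module R N" "module R M'" "module R N'"
    and "linear_map R M M' f" "linear_map R N N' g"
  shows "linear_map R (tensor R M N) (tensor R M' N') (tensor_map R M' N' f g)"
  by (rule linear_map_cong[OF sweedler_linear[OF assms(1,2), of _ "\<lambda>m n. pure R M' N' (f m) (g n)"]])
    (simp_all add: assms linear_map_closed[OF assms(5)] linear_map_closed[OF assms(6)]
      tensor_map_sweedler[of M N])

lemma tensor_map_pure:
  assumes "module R M" "module R N" "module R M'" "module R N'"
    and "linear_map R M M' f" "linear_map R N N' g" "m \<in> carrier M" "n \<in> carrier N"
  shows "tensor_map R M' N' f g (pure R M N m n) = pure R M' N' (f m) (g n)"
  by (simp add: assms linear_map_closed[OF assms(5)] linear_map_closed[OF assms(6)]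
      tensor_map_sweedler[of M N])

lemma tensor_map_closed:
  assumes "module R M" "module R N" "module R M'" "module R N'"
    and "linear_map R M M' f" "linear_map R N N' g" "t \<in> carrier (tensor R M N)"
  shows "tensor_map R M' N' f g t \<in> carrier (tensor R M' N')"
  by (rule linear_map_closed[OF tensor_map_linear[OF assms(1-6)] assms(7)])

lemma tensor_map_compose:
  assumes "module R M" "module R N" "module R M'" "module R N'" "module R M''" "module R N''"
    and "linear_map R M M' f" "linear_map R N N' g" "linear_map R M' M'' f'" "linear_map R N' N'' g'"
    and "t \<in> carrier (tensor R M N)"
  shows "tensor_map R M'' N'' f' g' (tensor_map R M' N' f g t) =
    tensor_map R M'' N'' (\<lambda>m. f' (f m)) (\<lambda>n. g' (g n)) t"
  by (rule tensor_eqI[OF assms(1,2)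
      linear_map_compose[OF tensor_map_linear[OF assms(1-4,7,8)] tensor_map_linear[OF assms(3-6,9,10)]]
      tensor_map_linear[OF assms(1,2,5,6) linear_map_compose[OF assms(7,9)] linear_map_compose[OF assms(8,10)]]
      _ assms(11)])
    (simp add: tensor_map_pure[of M N] tensor_map_pure[of M' N'] assms
      linear_map_closed[OF assms(7)] linear_map_closed[OF assms(8)]
      linear_map_compose[OF assms(7,9)] linear_map_compose[OF assms(8,10)])

lemma tensor_map_cong:
  assumes "module R M" "module R N" "t \<in> carrier (tensor R M N)"
    and "\<And>m. m \<in> carrier M \<Longrightarrow> f m = f' m" "\<And>n. n \<in> carrier N \<Longrightarrow> g n = g' n"
  shows "tensor_map R M' N' f g t = tensor_map R M' N' f' g' t"
  by (simp add: tensor_map_sweedler[OF assms(1-3)] assms(4,5))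

lemma tensor_map_id:
  assumes "module R M" "module R N" "t \<in> carrier (tensor R M N)"
    and "\<And>m. m \<in> carrier M \<Longrightarrow> f m = m" "\<And>n. n \<in> carrier N \<Longrightarrow> g n = n"
  shows "tensor_map R M N f g t = t"
  by (simp add: tensor_map_sweedler[OF assms(1-3)] assms)

lemma tensor_assoc_sweedler:
  assumes "module R M" "module R N" "module R P" "t \<in> carrier (tensor R (tensor R M N) P)"
  shows "tensor_assoc R M N P t =
    sweedler (tensor R M N) P (tensor R M (tensor R N P)) (\<lambda>u p.
      sweedler M N (tensor R M (tensor R N P)) (\<lambda>m n. pure R M (tensor R N P) m (pure R N P n p)) u) t"
  by (simp add: tensor_assoc_def Let_def assms tensor_lift_sweedler[of "tensor R M N" P]
      tensor_lift_sweedler[of M N])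

lemma tensor_assoc_linear:
  assumes "module R M" "module R N" "module R P"
  shows "linear_map R (tensor R (tensor R M N) P) (tensor R M (tensor R N P)) (tensor_assoc R M N P)"
  by (rule linear_map_cong[OF _ _ tensor_assoc_sweedler]) (simp_all add: assms sweedler_linear)

lemma tensor_assoc_pure:
  assumes "module R M" "module R N" "module R P" "t \<in> carrier (tensor R M N)" "p \<in> carrier P"
  shows "tensor_assoc R M N P (pure R (tensor R M N) P t p) =
    sweedler M N (tensor R M (tensor R N P)) (\<lambda>m n. pure R M (tensor R N P) m (pure R N P n p)) t"
  by (simp add: tensor_assoc_sweedler assms)

lemma tensor3_eqI:
  assumes M: "module R M" and N: "module R N" and P: "module R P" and Q: "module R Q"
    and f: "linear_map R (tensor R (tensor R M N) P) Q f"
    and g: "linear_map R (tensor R (tensor R M N) P) Q g"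
    and eq: "\<And>m n p. \<lbrakk>m \<in> carrier M; n \<in> carrier N; p \<in> carrier P\<rbrakk> \<Longrightarrow>
      f (pure R (tensor R M N) P (pure R M N m n) p) = g (pure R (tensor R M N) P (pure R M N m n) p)"
    and t: "t \<in> carrier (tensor R (tensor R M N) P)"
  shows "f t = g t"
proof (rule tensor_eqI[OF _ P f g _ t])
  fix s p assume s: "s \<in> carrier (tensor R M N)" and p: "p \<in> carrier P"
  show "f (pure R (tensor R M N) P s p) = g (pure R (tensor R M N) P s p)"
    by (rule tensor_eqI[OF M N _ _ _ s, where P = Q])
      (simp_all add: M N P p linear_map_apply[OF f] linear_map_apply[OF g] eq)
qed (simp add: M N)

lemma tensor3_eqI':
  assumes M: "module R M" and N: "module R N" and P: "module R P" and Q: "module R Q"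
    and f: "linear_map R (tensor R M (tensor R N P)) Q f"
    and g: "linear_map R (tensor R M (tensor R N P)) Q g"
    and eq: "\<And>m n p. \<lbrakk>m \<in> carrier M; n \<in> carrier N; p \<in> carrier P\<rbrakk> \<Longrightarrow>
      f (pure R M (tensor R N P) m (pure R N P n p)) = g (pure R M (tensor R N P) m (pure R N P n p))"
    and t: "t \<in> carrier (tensor R M (tensor R N P))"
  shows "f t = g t"
proof (rule tensor_eqI[OF M _ f g _ t])
  fix m s assume m: "m \<in> carrier M" and s: "s \<in> carrier (tensor R N P)"
  show "f (pure R M (tensor R N P) m s) = g (pure R M (tensor R N P) m s)"
    by (rule tensor_eqI[OF N P _ _ _ s, where P = Q])
      (simp_all add: M N P m linear_map_apply[OF f] linear_map_apply[OF g] eq)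
qed (simp add: N P)

lemma tensor_assoc_closed [simp]:
  "module R M \<Longrightarrow> module R N \<Longrightarrow> module R P \<Longrightarrow> t \<in> carrier (tensor R (tensor R M N) P) \<Longrightarrow>
    tensor_assoc R M N P t \<in> carrier (tensor R M (tensor R N P))"
  by (rule linear_map_closed[OF tensor_assoc_linear])

lemma linear_tensor_assoc [simp]:
  "module R M \<Longrightarrow> module R N \<Longrightarrow> module R P \<Longrightarrow> linear_map R X (tensor R (tensor R M N) P) f \<Longrightarrow>
    linear_map R X (tensor R M (tensor R N P)) (\<lambda>x. tensor_assoc R M N P (f x))"
  by (rule linear_map_apply[OF tensor_assoc_linear])

lemma tensor_assoc_pure_pure:
  "module R M \<Longrightarrow> module R N \<Longrightarrow> module R P \<Longrightarrow> m \<in> carrier M \<Longrightarrow> n \<in> carrier N \<Longrightarrow> p \<in> carrier P \<Longrightarrow>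
    tensor_assoc R M N P (pure R (tensor R M N) P (pure R M N m n) p) =
    pure R M (tensor R N P) m (pure R N P n p)"
  by (simp add: tensor_assoc_pure)

definition tensor_unassoc where
  "tensor_unassoc M N P = (let T = tensor R (tensor R M N) P in
    sweedler M (tensor R N P) T (\<lambda>m. sweedler N P T (\<lambda>n p. pure R (tensor R M N) P (pure R M N m n) p)))"

lemma tensor_unassoc_linear:
  "module R M \<Longrightarrow> module R N \<Longrightarrow> module R P \<Longrightarrow>
    linear_map R (tensor R M (tensor R N P)) (tensor R (tensor R M N) P) (tensor_unassoc M N P)"
  unfolding tensor_unassoc_def Let_def by (rule sweedler_linear) simp_all

lemma tensor_unassoc_closed [simp]:
  "module R M \<Longrightarrow> module R N \<Longrightarrow> module R P \<Longrightarrow> t \<in> carrier (tensor R M (tensor R N P)) \<Longrightarrow>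
    tensor_unassoc M N P t \<in> carrier (tensor R (tensor R M N) P)"
  by (rule linear_map_closed[OF tensor_unassoc_linear])

lemma tensor_unassoc_pure:
  "module R M \<Longrightarrow> module R N \<Longrightarrow> module R P \<Longrightarrow> m \<in> carrier M \<Longrightarrow> n \<in> carrier N \<Longrightarrow> p \<in> carrier P \<Longrightarrow>
    tensor_unassoc M N P (pure R M (tensor R N P) m (pure R N P n p)) =
    pure R (tensor R M N) P (pure R M N m n) p"
  by (simp add: tensor_unassoc_def Let_def)

lemma tensor_unassoc_assoc:
  assumes "module R M" "module R N" "module R P" "t \<in> carrier (tensor R (tensor R M N) P)"
  shows "tensor_unassoc M N P (tensor_assoc R M N P t) = t"
  by (rule tensor3_eqI[OF assms(1-3) _ linear_map_compose[OF tensor_assoc_linear tensor_unassoc_linear]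
      linear_id _ assms(4)])
    (simp_all add: assms tensor_assoc_pure_pure tensor_unassoc_pure)

lemma tensor_assoc_unassoc:
  assumes "module R M" "module R N" "module R P" "t \<in> carrier (tensor R M (tensor R N P))"
  shows "tensor_assoc R M N P (tensor_unassoc M N P t) = t"
  by (rule tensor3_eqI'[OF assms(1-3) _ linear_map_compose[OF tensor_unassoc_linear tensor_assoc_linear]
      linear_id _ assms(4)])
    (simp_all add: assms tensor_assoc_pure_pure tensor_unassoc_pure)

text \<open>
  Naturality and the pentagon hold for modules because both sides rearrange the brackets of a pure
  tensor in the same way.
\<close>

lemma tensor_assoc_natural:
  assumes "module R M" "module R N" "module R P" "module R M'" "module R N'" "module R P'"
    and f: "linear_map R M M' f" and g: "linear_map R N N' g" and h: "linear_map R P P' h"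
    and "t \<in> carrier (tensor R (tensor R M N) P)"
  shows "tensor_assoc R M' N' P' (tensor_map R (tensor R M' N') P' (tensor_map R M' N' f g) h t) =
    tensor_map R M' (tensor R N' P') f (tensor_map R N' P' g h) (tensor_assoc R M N P t)"
proof -
  have fg: "linear_map R (tensor R M N) (tensor R M' N') (tensor_map R M' N' f g)"
    by (rule tensor_map_linear) (simp_all add: assms)
  have gh: "linear_map R (tensor R N P) (tensor R N' P') (tensor_map R N' P' g h)"
    by (rule tensor_map_linear) (simp_all add: assms)
  show ?thesis
    by (rule tensor3_eqI[OF assms(1-3) _ linear_map_compose[OF tensor_map_linear tensor_assoc_linear]
        linear_map_compose[OF tensor_assoc_linear tensor_map_linear] _ assms(10)])
      (simp_all add: assms fg gh tensor_assoc_pure_pure linear_map_closed[OF f] linear_map_closed[OF g]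
        linear_map_closed[OF h] tensor_map_pure[of "tensor R M N" P] tensor_map_pure[of M N]
        tensor_map_pure[of M "tensor R N P"] tensor_map_pure[of N P])
qed

lemma tensor_assoc_pentagon:
  assumes M: "module R M" and N: "module R N" and P: "module R P" and Q: "module R Q"
    and t: "t \<in> carrier (tensor R (tensor R (tensor R M N) P) Q)"
  shows "tensor_map R M (tensor R N (tensor R P Q)) (\<lambda>m. m) (tensor_assoc R N P Q)
      (tensor_assoc R M (tensor R N P) Q
        (tensor_map R (tensor R M (tensor R N P)) Q (tensor_assoc R M N P) (\<lambda>q. q) t)) =
    tensor_assoc R M N (tensor R P Q) (tensor_assoc R (tensor R M N) P Q t)"
    (is "?l t = ?r t")
proof -
  note [simp] = M N P Q
  have a1: "linear_map R (tensor R (tensor R (tensor R M N) P) Q) (tensor R (tensor R M (tensor R N P)) Q)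
      (tensor_map R (tensor R M (tensor R N P)) Q (tensor_assoc R M N P) (\<lambda>q. q))"
    by (rule tensor_map_linear) (simp_all add: tensor_assoc_linear)
  have a2: "linear_map R (tensor R M (tensor R (tensor R N P) Q)) (tensor R M (tensor R N (tensor R P Q)))
      (tensor_map R M (tensor R N (tensor R P Q)) (\<lambda>m. m) (tensor_assoc R N P Q))"
    by (rule tensor_map_linear) (simp_all add: tensor_assoc_linear)
  note [simp] = linear_map_apply[OF a1] linear_map_apply[OF a2]
  show ?thesis
  proof (rule tensor_eqI[OF _ Q _ _ _ t, where f = ?l and g = ?r and P = "tensor R M (tensor R N (tensor R P Q))"])
    fix u q assume u: "u \<in> carrier (tensor R (tensor R M N) P)" and [simp]: "q \<in> carrier Q"
    show "?l (pure R (tensor R (tensor R M N) P) Q u q) = ?r (pure R (tensor R (tensor R M N) P) Q u q)"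
    proof (rule tensor3_eqI[OF M N P _ _ _ _ u, where Q = "tensor R M (tensor R N (tensor R P Q))"])
      fix m n p assume [simp]: "m \<in> carrier M" "n \<in> carrier N" "p \<in> carrier P"
      let ?t = "pure R (tensor R (tensor R M N) P) Q (pure R (tensor R M N) P (pure R M N m n) p) q"
      show "?l ?t = ?r ?t"
        by (simp add: tensor_assoc_linear tensor_map_pure[of "tensor R (tensor R M N) P" Q]
            tensor_assoc_pure_pure tensor_map_pure[of M "tensor R (tensor R N P) Q"])
    qed simp_all
  qed simp_all
qed

end

section \<open>Records with the same underlying module\<close>

text \<open>
  Comodule records carry a coaction on top of a module, so \<open>tensor_comodule R H M N\<close> and
  \<open>tensor R M N\<close> are different objects. Tensor products and linear maps only look at four of the
  fields, and the lemmas of this section allow one record to be replaced by the other.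
\<close>

definition same_module ::
  "('k, 'a, 'x) module_scheme \<Rightarrow> ('k, 'a, 'y) module_scheme \<Rightarrow> bool"
  where "same_module M M' \<longleftrightarrow> carrier M = carrier M' \<and> zero M = zero M' \<and>
    add M = add M' \<and> smult M = smult M'"

lemma same_module_refl: "same_module M M"
  and same_module_sym: "same_module M M' \<Longrightarrow> same_module M' M"
  by (simp_all add: same_module_def)

lemma same_module_tensor_eq:
  assumes "same_module M M'" "same_module N N'" "tensor_eq R M N xs ys"
  shows "tensor_eq R M' N' xs ys"
  using assms(3)
proof (induction)
  case (sym xs ys)
  then show ?case by (blast intro: tensor_eq.sym)
next
  case (trans xs ys zs)
  then show ?case by (blast intro: tensor_eq.trans)
next
  case (append xs xs' ys ys')
  then show ?case by (simp add: tensor_eq.append)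
next
  case (zero n)
  then show ?case using assms(1,2) tensor_eq.zero[of n N' R M'] by (simp add: same_module_def)
next
  case (add_left m m' n)
  then show ?case using assms(1,2) tensor_eq.add_left[of m M' m' n N' R] by (simp add: same_module_def)
next
  case (add_right m n n')
  then show ?case using assms(1,2) tensor_eq.add_right[of m M' n N' n' R] by (simp add: same_module_def)
next
  case (balanced r m n)
  then show ?case using assms(1,2) tensor_eq.balanced[of r R m M' n N'] by (simp add: same_module_def)
qed (use assms(1,2) in \<open>auto simp: same_module_def intro: tensor_eq.refl tensor_eq.commute\<close>)

lemma same_module_tensor_class:
  assumes "same_module M M'" "same_module N N'"
  shows "tensor_class R M N = tensor_class R M' N'"
  unfolding tensor_class_def
  using same_module_tensor_eq[OF assms] same_module_tensor_eq[OF assms[THEN same_module_sym]]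
  by blast

lemma same_module_tensor:
  assumes "same_module M M'" "same_module N N'"
  shows "tensor R M N = tensor R M' N'"
  using assms unfolding tensor_def same_module_tensor_class[OF assms] by (simp add: same_module_def)

lemma same_module_pure:
  assumes "same_module M M'" "same_module N N'"
  shows "pure R M N = pure R M' N'"
  by (intro ext) (simp add: pure_def same_module_tensor_class[OF assms])

lemma same_module_linear_map:
  assumes "same_module M M'" "same_module N N'"
  shows "linear_map R M N f = linear_map R M' N' f"
  using assms by (simp add: linear_map_def same_module_def)

lemma same_module_sweedler:
  assumes "same_module M M'" "same_module N N'" "same_module P P'"
  shows "sweedler M N P f t = sweedler M' N' P' f t"
  using assms by (simp add: sweedler_def tensor_lift_def same_module_def)

lemma same_module_module:
  assumes "same_module M M'" "module R M"
  shows "module R M'"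
proof -
  interpret M: module R M by fact
  have eqs: "carrier M' = carrier M" "zero M' = zero M" "add M' = add M" "smult M' = smult M"
    using assms(1) by (simp_all add: same_module_def)
  have neg: "\<exists>y\<in>carrier M. y \<oplus>\<^bsub>M\<^esub> x = \<zero>\<^bsub>M\<^esub>" if "x \<in> carrier M" for x
    using M.l_neg[OF that] M.a_inv_closed[OF that] by blast
  have "abelian_group M'"
    by (rule abelian_groupI; unfold eqs)
      (simp_all add: M.a_ac neg)
  then show ?thesis
    by (rule moduleI[OF M.R.cring_axioms]; unfold eqs)
      (simp_all add: M.smult_l_distr M.smult_r_distr M.smult_assoc1)
qed

lemma same_module_iff: "same_module M M' \<Longrightarrow> module R M \<longleftrightarrow> module R M'"
  by (rule iffI; erule same_module_module[rotated]) (simp_all add: same_module_sym)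

lemma same_module_tensor_map:
  assumes "same_module M M'" "same_module N N'"
  shows "tensor_map R M N f g = tensor_map R M' N' f g"
  unfolding tensor_map_def same_module_tensor[OF assms] same_module_pure[OF assms] ..

lemma same_module_tensor_assoc:
  assumes "same_module M M'" "same_module N N'" "same_module P P'"
  shows "tensor_assoc R M N P = tensor_assoc R M' N' P'"
  unfolding tensor_assoc_def same_module_tensor[OF assms(2,3)] same_module_pure[OF assms(2,3)]
    same_module_tensor[OF assms(1) same_module_refl] same_module_pure[OF assms(1) same_module_refl] ..

lemma same_module_rewrite:
  assumes "same_module T T'"
  shows "carrier T = carrier T'" "zero T = zero T'" "add T = add T'" "smult T = smult T'"
    and "tensor R T N = tensor R T' N" "tensor R N T = tensor R N T'"
    and "pure R T N = pure R T' N" "pure R N T = pure R N T'"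
    and "linear_map R T N f = linear_map R T' N f" "linear_map R N T e = linear_map R N T' e"
    and "sweedler T N P g t = sweedler T' N P g t" "sweedler N T P h u = sweedler N T' P h u"
    and "sweedler N P T k v = sweedler N P T' k v"
    and "module R T = module R T'"
    and "tensor_map R T N a b = tensor_map R T' N a b" "tensor_map R N T c d = tensor_map R N T' c d"
    and "tensor_assoc R T N P = tensor_assoc R T' N P" "tensor_assoc R N T P = tensor_assoc R N T' P"
    and "tensor_assoc R N P T = tensor_assoc R N P T'"
proof -
  show "carrier T = carrier T'" "zero T = zero T'" "add T = add T'" "smult T = smult T'"
    using assms by (simp_all add: same_module_def)
qed (rule same_module_tensor[OF assms same_module_refl] same_module_tensor[OF same_module_refl assms]
    same_module_pure[OF assms same_module_refl] same_module_pure[OF same_module_refl assms]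
    same_module_linear_map[OF assms same_module_refl] same_module_linear_map[OF same_module_refl assms]
    same_module_sweedler[OF assms same_module_refl same_module_refl]
    same_module_sweedler[OF same_module_refl assms same_module_refl]
    same_module_sweedler[OF same_module_refl same_module_refl assms]
    same_module_iff[OF assms]
    same_module_tensor_map[OF assms same_module_refl] same_module_tensor_map[OF same_module_refl assms]
    same_module_tensor_assoc[OF assms same_module_refl same_module_refl]
    same_module_tensor_assoc[OF same_module_refl assms same_module_refl]
    same_module_tensor_assoc[OF same_module_refl same_module_refl assms])+

lemma same_module_tensor_comodule:
  "same_module (tensor_comodule R H M N) (tensor R M N)"
  by (simp add: same_module_def tensor_comodule_def Let_def module.extend_def)

lemma same_module_regular_comodule: "same_module (regular_comodule H) H"
  by (simp add: same_module_def regular_comodule_def)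

section \<open>Comodules without counit\<close>

sublocale prebialgebra \<subseteq> tensor_calculus R ..

context prebialgebra
begin

abbreviation mult_H (infixl "\<cdot>" 70) where "x \<cdot> y \<equiv> x \<otimes>\<^bsub>H\<^esub> y"
abbreviation diagonal_tensor (infixl "\<otimes>\<^sub>H" 75) where "M \<otimes>\<^sub>H N \<equiv> tensor_comodule R H M N"
abbreviation counital_tensor (infixl "\<boxtimes>" 75) where "M \<boxtimes> N \<equiv> boxtimes R H M N"

lemma module_H [simp]: "module R H"
  by (rule module_axioms)

lemma comult_closed [simp]: "h \<in> carrier H \<Longrightarrow> comult H h \<in> carrier (tensor R H H)"
  by (rule linear_map_closed[OF comult_linear])

lemma counit_closed [simp]: "h \<in> carrier H \<Longrightarrow> counit H h \<in> carrier R"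
  using linear_map_closed[OF counit_linear] by simp

lemma linear_comult [simp]:
  "linear_map R X H f \<Longrightarrow> linear_map R X (tensor R H H) (\<lambda>x. comult H (f x))"
  by (rule linear_map_compose[OF _ comult_linear])

lemma linear_counit [simp]:
  "linear_map R X H f \<Longrightarrow> linear_map R X (scalar_module R) (\<lambda>x. counit H (f x))"
  by (rule linear_map_compose[OF _ counit_linear])

lemma ring_H: "ring H"
  by (rule prebialgebra.axioms(2)[OF prebialgebra_axioms])

lemma linear_mult_left [simp]:
  assumes "linear_map R X H f" "h \<in> carrier H"
  shows "linear_map R X H (\<lambda>x. f x \<cdot> h)"
  using linear_map_add[OF assms(1)] linear_map_smult[OF assms(1)] linear_map_closed[OF assms(1)] assms(2)
  by (intro linear_mapI) (simp_all add: ringE(3)[OF ring_H] smult_mult_left)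

lemma linear_mult_right [simp]:
  assumes "linear_map R X H f" "h \<in> carrier H"
  shows "linear_map R X H (\<lambda>x. h \<cdot> f x)"
  using linear_map_add[OF assms(1)] linear_map_smult[OF assms(1)] linear_map_closed[OF assms(1)] assms(2)
  by (intro linear_mapI) (simp_all add: ringE(4)[OF ring_H] smult_mult_right)


lemma mult_assoc:
  "x \<in> carrier H \<Longrightarrow> y \<in> carrier H \<Longrightarrow> z \<in> carrier H \<Longrightarrow> (x \<cdot> y) \<cdot> z = x \<cdot> (y \<cdot> z)"
  by (rule monoid.m_assoc[OF ring.is_monoid[OF ring_H]])

text \<open>
  A right comodule without the counit axiom. This is the kind of structure that the full tensor
  product \<open>M \<otimes> N\<close> carries, and most of the argument takes place at this level.
\<close>

definition semicomodule :: "('k, 'h, 'm) comodule \<Rightarrow> bool"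
  where "semicomodule T \<longleftrightarrow> module R T \<and> linear_map R T (tensor R T H) (coact T) \<and>
    (\<forall>t\<in>carrier T.
      tensor_assoc R T H H (tensor_map R (tensor R T H) H (coact T) (\<lambda>h. h) (coact T t)) =
      tensor_map R T (tensor R H H) (\<lambda>t. t) (comult H) (coact T t))"

lemma right_comodule_iff:
  "right_comodule R H M \<longleftrightarrow> semicomodule M \<and>
    (\<forall>m\<in>carrier M. sweedler M H M (\<lambda>m0 m1. counit H m1 \<odot>\<^bsub>M\<^esub> m0) (coact M m) = m)"
proof (cases "module R M \<and> linear_map R M (tensor R M H) (coact M)")
  case True
  then have "tensor_lift M f (coact M m) = sweedler M H M f (coact M m)" if "m \<in> carrier M" for f m
    using that by (intro tensor_lift_sweedler) (simp_all add: linear_map_def Pi_iff)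
  with True show ?thesis unfolding right_comodule_def semicomodule_def by simp
next
  case False
  then show ?thesis unfolding right_comodule_def semicomodule_def by blast
qed

lemma semicomodule_module [simp]: "semicomodule T \<Longrightarrow> module R T"
  by (simp add: semicomodule_def)

lemma coact_linear: "semicomodule T \<Longrightarrow> linear_map R T (tensor R T H) (coact T)"
  by (simp add: semicomodule_def)

lemma coact_closed [simp]:
  "semicomodule T \<Longrightarrow> t \<in> carrier T \<Longrightarrow> coact T t \<in> carrier (tensor R T H)"
  by (rule linear_map_closed[OF coact_linear])

lemma linear_coact [simp]:
  "semicomodule T \<Longrightarrow> linear_map R X T f \<Longrightarrow> linear_map R X (tensor R T H) (\<lambda>x. coact T (f x))"
  by (rule linear_map_compose[OF _ coact_linear])

lemma coact_sweedler:
  assumes "semicomodule T" "module R A" "module R B" "t \<in> carrier (tensor R A B)"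
    and "\<And>a b. \<lbrakk>a \<in> carrier A; b \<in> carrier B\<rbrakk> \<Longrightarrow> f a b \<in> carrier T"
  shows "coact T (sweedler A B T f t) = sweedler A B (tensor R T H) (\<lambda>a b. coact T (f a b)) t"
  by (rule linear_sweedler) (simp_all add: assms coact_linear)

lemma comult_sweedler:
  assumes "module R A" "module R B" "t \<in> carrier (tensor R A B)"
    and "\<And>a b. \<lbrakk>a \<in> carrier A; b \<in> carrier B\<rbrakk> \<Longrightarrow> f a b \<in> carrier H"
  shows "comult H (sweedler A B H f t) = sweedler A B (tensor R H H) (\<lambda>a b. comult H (f a b)) t"
  by (rule linear_sweedler) (simp_all add: assms comult_linear)

text \<open>
  Coassociativity tested against an arbitrary trilinear map \<open>f\<close>: the sums of
  \<open>f t(0)(0) t(0)(1) t(1)\<close> and of \<open>f t(0) t(1)(1) t(1)(2)\<close> agree. This is the form in which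
  coassociativity enters every computation.
\<close>

lemma coassoc_sweedler:
  assumes T: "semicomodule T" and t: "t \<in> carrier T" and P: "module R P"
    and "\<And>b c. \<lbrakk>b \<in> carrier H; c \<in> carrier H\<rbrakk> \<Longrightarrow> linear_map R T P (\<lambda>a. f a b c)"
    and "\<And>a c. \<lbrakk>a \<in> carrier T; c \<in> carrier H\<rbrakk> \<Longrightarrow> linear_map R H P (\<lambda>b. f a b c)"
    and "\<And>a b. \<lbrakk>a \<in> carrier T; b \<in> carrier H\<rbrakk> \<Longrightarrow> linear_map R H P (\<lambda>c. f a b c)"
  shows "sweedler T H P (\<lambda>t0 t1. sweedler T H P (\<lambda>a b. f a b t1) (coact T t0)) (coact T t) =
    sweedler T H P (\<lambda>t0 t1. sweedler H H P (\<lambda>b c. f t0 b c) (comult H t1)) (coact T t)"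
proof -
  let ?g = "sweedler T (tensor R H H) P (\<lambda>a. sweedler H H P (f a))"
  have "tensor_assoc R T H H (tensor_map R (tensor R T H) H (coact T) (\<lambda>h. h) (coact T t)) =
      tensor_map R T (tensor R H H) (\<lambda>t. t) (comult H) (coact T t)"
    using T t unfolding semicomodule_def by blast
  from arg_cong[OF this, of ?g] show ?thesis
    using assms linear_map_closed[OF assms(4)]
    by (simp add: tensor_map_sweedler[of T H] tensor_assoc_sweedler sweedler_sweedler)
qed

lemma mult_sweedler_left:
  assumes "module R A" "module R B" "h \<in> carrier H" "t \<in> carrier (tensor R A B)"
    and "\<And>a b. \<lbrakk>a \<in> carrier A; b \<in> carrier B\<rbrakk> \<Longrightarrow> f a b \<in> carrier H"
  shows "sweedler A B H f t \<cdot> h = sweedler A B H (\<lambda>a b. f a b \<cdot> h) t"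
  by (rule linear_sweedler[where g = "\<lambda>x. x \<cdot> h"]) (simp_all add: assms)

lemma mult_sweedler_right:
  assumes "module R A" "module R B" "h \<in> carrier H" "t \<in> carrier (tensor R A B)"
    and "\<And>a b. \<lbrakk>a \<in> carrier A; b \<in> carrier B\<rbrakk> \<Longrightarrow> f a b \<in> carrier H"
  shows "h \<cdot> sweedler A B H f t = sweedler A B H (\<lambda>a b. h \<cdot> f a b) t"
  by (rule linear_sweedler[where g = "\<lambda>x. h \<cdot> x"]) (simp_all add: assms)

lemma comult_mult_sweedler:
  "h \<in> carrier H \<Longrightarrow> k \<in> carrier H \<Longrightarrow> comult H (h \<cdot> k) =
    sweedler H H (tensor R H H) (\<lambda>a b. sweedler H H (tensor R H H)
      (\<lambda>c d. pure R H H (a \<cdot> c) (b \<cdot> d)) (comult H k)) (comult H h)"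
  by (simp add: comult_mult tensor_lift_sweedler[of H H])

lemma counit_left_sweedler:
  assumes "h \<in> carrier H" "module R P" "linear_map R H P f"
  shows "sweedler H H P (\<lambda>a b. counit H a \<odot>\<^bsub>P\<^esub> f b) (comult H h) = f h"
proof -
  have "f (sweedler H H H (\<lambda>a b. counit H a \<odot>\<^bsub>H\<^esub> b) (comult H h)) = f h"
    using counit_left[OF assms(1)] by (simp add: tensor_lift_sweedler[of H H] assms(1))
  moreover have "f (sweedler H H H (\<lambda>a b. counit H a \<odot>\<^bsub>H\<^esub> b) (comult H h)) =
      sweedler H H P (\<lambda>a b. f (counit H a \<odot>\<^bsub>H\<^esub> b)) (comult H h)"
    by (rule linear_sweedler) (simp_all add: assms)
  ultimately show ?thesis by (simp add: linear_map_smult[OF assms(3)])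
qed

lemma counit_right_sweedler:
  assumes "h \<in> carrier H" "module R P" "linear_map R H P f"
  shows "sweedler H H P (\<lambda>a b. counit H b \<odot>\<^bsub>P\<^esub> f a) (comult H h) = f h"
proof -
  have "f (sweedler H H H (\<lambda>a b. counit H b \<odot>\<^bsub>H\<^esub> a) (comult H h)) = f h"
    using counit_right[OF assms(1)] by (simp add: tensor_lift_sweedler[of H H] assms(1))
  moreover have "f (sweedler H H H (\<lambda>a b. counit H b \<odot>\<^bsub>H\<^esub> a) (comult H h)) =
      sweedler H H P (\<lambda>a b. f (counit H b \<odot>\<^bsub>H\<^esub> a)) (comult H h)"
    by (rule linear_sweedler) (simp_all add: assms)
  ultimately show ?thesis by (simp add: linear_map_smult[OF assms(3)])
qed

section \<open>The diagonal coaction\<close>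

lemmas tensor_comodule_simps [simp] = same_module_rewrite[OF same_module_tensor_comodule]

lemma tensor_comodule_coact:
  assumes "semicomodule M" "semicomodule N" "t \<in> carrier (tensor R M N)"
  shows "coact (M \<otimes>\<^sub>H N) t =
    sweedler M N (tensor R (tensor R M N) H) (\<lambda>m n. sweedler M H (tensor R (tensor R M N) H) (\<lambda>m0 m1.
    sweedler N H (tensor R (tensor R M N) H) (\<lambda>n0 n1.
      pure R (tensor R M N) H (pure R M N m0 n0) (m1 \<cdot> n1)) (coact N n)) (coact M m)) t"
  using assms
  by (simp add: tensor_comodule_def Let_def module.extend_def tensor_lift_sweedler[of M N] tensor_lift_sweedler[of M H]
    tensor_lift_sweedler[of N H])

lemma tensor_comodule_coact_linear [simp]:
  assumes "semicomodule M" "semicomodule N"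
  shows "linear_map R (tensor R M N) (tensor R (tensor R M N) H) (coact (M \<otimes>\<^sub>H N))"
  by (rule linear_map_cong[OF _ _ tensor_comodule_coact]) (simp_all add: assms)

lemma tensor_comodule_linear_coact [simp]:
  assumes "semicomodule M" "semicomodule N" "linear_map R X (tensor R M N) f"
  shows "linear_map R X (tensor R (tensor R M N) H) (\<lambda>x. coact (M \<otimes>\<^sub>H N) (f x))"
  by (rule linear_map_compose[OF assms(3) tensor_comodule_coact_linear[OF assms(1,2)]])

lemma tensor_comodule_coact_closed [simp]:
  assumes "semicomodule M" "semicomodule N" "t \<in> carrier (tensor R M N)"
  shows "coact (M \<otimes>\<^sub>H N) t \<in> carrier (tensor R (tensor R M N) H)"
  by (rule linear_map_closed[OF tensor_comodule_coact_linear[OF assms(1,2)] assms(3)])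

lemma tensor_comodule_coact_pure [simp]:
  assumes "semicomodule M" "semicomodule N" "m \<in> carrier M" "n \<in> carrier N"
  shows "coact (M \<otimes>\<^sub>H N) (pure R M N m n) =
    sweedler M H (tensor R (tensor R M N) H) (\<lambda>m0 m1.
    sweedler N H (tensor R (tensor R M N) H) (\<lambda>n0 n1.
      pure R (tensor R M N) H (pure R M N m0 n0) (m1 \<cdot> n1)) (coact N n)) (coact M m)"
  by (simp add: tensor_comodule_coact assms)

text \<open>
  Coassociativity of the diagonal coaction is coassociativity of the two factors, used one after
  the other, followed by multiplicativity of \<open>\<Delta>\<close>.
\<close>

lemma semicomodule_tensor [simp]:
  assumes M: "semicomodule M" and N: "semicomodule N"
  shows "semicomodule (M \<otimes>\<^sub>H N)"
proof -
  let ?T = "tensor R M N" and ?\<rho> = "coact (M \<otimes>\<^sub>H N)"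
  let ?Q = "tensor R ?T (tensor R H H)"
  note lin = tensor_comodule_coact_linear[OF M N]
  have "tensor_assoc R ?T H H (tensor_map R (tensor R ?T H) H ?\<rho> (\<lambda>h. h) (?\<rho> t)) =
      tensor_map R ?T (tensor R H H) (\<lambda>t. t) (comult H) (?\<rho> t)"
    if "t \<in> carrier ?T" for t
  proof (rule tensor_eqI[OF _ _ _ _ _ that])
    show "linear_map R ?T ?Q (\<lambda>t. tensor_assoc R ?T H H (tensor_map R (tensor R ?T H) H ?\<rho> (\<lambda>h. h) (?\<rho> t)))"
      by (intro linear_map_compose[OF linear_map_compose[OF lin tensor_map_linear] tensor_assoc_linear])
        (simp_all add: M N)
    show "linear_map R ?T ?Q (\<lambda>t. tensor_map R ?T (tensor R H H) (\<lambda>t. t) (comult H) (?\<rho> t))"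
      by (intro linear_map_compose[OF lin tensor_map_linear]) (simp_all add: M N)
    fix m n assume m: "m \<in> carrier M" and n: "n \<in> carrier N"
    let ?lhs = "sweedler M H ?Q (\<lambda>m0 m1. sweedler N H ?Q (\<lambda>n0 n1.
      sweedler M H ?Q (\<lambda>a b. sweedler N H ?Q (\<lambda>c d.
        pure R ?T (tensor R H H) (pure R M N a c) (pure R H H (b \<cdot> d) (m1 \<cdot> n1)))
          (coact N n0)) (coact M m0)) (coact N n)) (coact M m)"
    have "tensor_assoc R ?T H H (tensor_map R (tensor R ?T H) H ?\<rho> (\<lambda>h. h) (?\<rho> (pure R M N m n))) = ?lhs"
      by (simp add: M N m n tensor_map_sweedler[of "tensor R M N" H] sweedler_sweedler
          pure_sweedler_left pure_sweedler_right tensor_assoc_sweedler)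
    also have "\<dots> = sweedler M H ?Q (\<lambda>m0 m1. sweedler M H ?Q (\<lambda>a b. sweedler N H ?Q (\<lambda>n0 n1.
      sweedler N H ?Q (\<lambda>c d.
        pure R ?T (tensor R H H) (pure R M N a c) (pure R H H (b \<cdot> d) (m1 \<cdot> n1)))
          (coact N n0)) (coact N n)) (coact M m0)) (coact M m)"
      by (rule sweedler_cong[OF HOL.refl], rule sweedler_swap) (simp_all add: M N m n)
    also have "\<dots> = sweedler M H ?Q (\<lambda>m0 m1. sweedler M H ?Q (\<lambda>a b. sweedler N H ?Q (\<lambda>n0 n1.
      sweedler H H ?Q (\<lambda>c d.
        pure R ?T (tensor R H H) (pure R M N a n0) (pure R H H (b \<cdot> c) (m1 \<cdot> d)))
          (comult H n1)) (coact N n)) (coact M m0)) (coact M m)"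
      by (simp add: coassoc_sweedler M N m n)
    also have "\<dots> = sweedler M H ?Q (\<lambda>m0 m1. sweedler H H ?Q (\<lambda>a b. sweedler N H ?Q (\<lambda>n0 n1.
      sweedler H H ?Q (\<lambda>c d.
        pure R ?T (tensor R H H) (pure R M N m0 n0) (pure R H H (a \<cdot> c) (b \<cdot> d)))
          (comult H n1)) (coact N n)) (comult H m1)) (coact M m)"
      by (rule coassoc_sweedler) (simp_all add: M N m n)
    also have "\<dots> = sweedler M H ?Q (\<lambda>m0 m1. sweedler N H ?Q (\<lambda>n0 n1. sweedler H H ?Q (\<lambda>a b.
      sweedler H H ?Q (\<lambda>c d.
        pure R ?T (tensor R H H) (pure R M N m0 n0) (pure R H H (a \<cdot> c) (b \<cdot> d)))
          (comult H n1)) (comult H m1)) (coact N n)) (coact M m)"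
      by (rule sweedler_cong[OF HOL.refl], rule sweedler_swap) (simp_all add: M N m n)
    also have "\<dots> = tensor_map R ?T (tensor R H H) (\<lambda>t. t) (comult H) (?\<rho> (pure R M N m n))"
      by (simp add: M N m n tensor_map_sweedler[of "tensor R M N" H] sweedler_sweedler
          pure_sweedler_right comult_mult_sweedler)
    finally show "tensor_assoc R ?T H H (tensor_map R (tensor R ?T H) H ?\<rho> (\<lambda>h. h) (?\<rho> (pure R M N m n))) =
      tensor_map R ?T (tensor R H H) (\<lambda>t. t) (comult H) (?\<rho> (pure R M N m n))" .
  qed (simp_all add: M N)
  with lin M N show ?thesis unfolding semicomodule_def by simp
qed

section \<open>Colinear maps\<close>

text \<open>
  The morphisms of \<open>comodule_hom\<close> without extensionality, which maps that are given by a formula,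
  such as tensor products of maps, do not have.
\<close>

definition colinear :: "('k, 'h, 'm) comodule \<Rightarrow> ('k, 'h, 'n) comodule \<Rightarrow> ('m \<Rightarrow> 'n) \<Rightarrow> bool"
  where "colinear M N f \<longleftrightarrow> linear_map R M N f \<and>
    (\<forall>m\<in>carrier M. coact N (f m) = tensor_map R N H f (\<lambda>h. h) (coact M m))"

lemma comodule_hom_iff: "f \<in> comodule_hom R H M N \<longleftrightarrow> f \<in> extensional (carrier M) \<and> colinear M N f"
  by (auto simp: comodule_hom_def colinear_def)

lemma colinear_linear: "colinear M N f \<Longrightarrow> linear_map R M N f"
  by (simp add: colinear_def)

lemma colinear_closed: "colinear M N f \<Longrightarrow> m \<in> carrier M \<Longrightarrow> f m \<in> carrier N"
  by (rule linear_map_closed[OF colinear_linear])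

lemma colinearI:
  assumes "semicomodule M" "linear_map R M N f"
    and "\<And>m. m \<in> carrier M \<Longrightarrow> coact N (f m) = sweedler M H (tensor R N H) (\<lambda>a b. pure R N H (f a) b) (coact M m)"
  shows "colinear M N f"
  using assms by (simp add: colinear_def tensor_map_sweedler[of M H])

lemma colinear_coact:
  assumes "semicomodule M" "colinear M N f" "m \<in> carrier M"
  shows "coact N (f m) = sweedler M H (tensor R N H) (\<lambda>a b. pure R N H (f a) b) (coact M m)"
  using assms by (simp add: colinear_def tensor_map_sweedler[of M H])

lemma colinear_cong:
  assumes "colinear M N f" "semicomodule M" "\<And>m. m \<in> carrier M \<Longrightarrow> g m = f m"
  shows "colinear M N g"
proof (rule colinearI)
  show "linear_map R M N g"
    by (rule linear_map_cong[OF colinear_linear[OF assms(1)] _ assms(3)]) (simp_all add: assms(2))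
qed (simp_all add: assms colinear_coact[OF assms(2,1)])

lemma colinear_id: "semicomodule M \<Longrightarrow> colinear M M (\<lambda>m. m)"
  by (rule colinearI) simp_all

lemma colinear_compose:
  assumes M: "semicomodule M" and N: "semicomodule N" and P: "semicomodule P"
    and f: "colinear M N f" and g: "colinear N P g"
  shows "colinear M P (\<lambda>m. g (f m))"
proof (rule colinearI[OF M])
  note lf = colinear_linear[OF f] and lg = colinear_linear[OF g]
  show "linear_map R M P (\<lambda>m. g (f m))" by (rule linear_map_compose[OF lf lg])
  fix m assume m: "m \<in> carrier M"
  then show "coact P (g (f m)) = sweedler M H (tensor R P H) (\<lambda>a b. pure R P H (g (f a)) b) (coact M m)"
    by (simp add: colinear_coact[OF N g] colinear_coact[OF M f] colinear_closed[OF f]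
        colinear_closed[OF g] M N P sweedler_sweedler linear_map_apply[OF lg])
qed

lemma colinear_tensor_map:
  assumes M: "semicomodule M" "semicomodule M'" and N: "semicomodule N" "semicomodule N'"
    and f: "colinear M M' f" and g: "colinear N N' g"
  shows "colinear (M \<otimes>\<^sub>H N) (M' \<otimes>\<^sub>H N') (tensor_map R M' N' f g)"
proof (rule colinearI)
  note lf = colinear_linear[OF f] and lg = colinear_linear[OF g]
  note closed = colinear_closed[OF f] colinear_closed[OF g]
  have lin: "linear_map R (tensor R M N) (tensor R M' N') (tensor_map R M' N' f g)"
    by (rule tensor_map_linear) (simp_all add: M N lf lg)
  then show "linear_map R (M \<otimes>\<^sub>H N) (M' \<otimes>\<^sub>H N') (tensor_map R M' N' f g)"
    by simp
  fix t assume "t \<in> carrier (M \<otimes>\<^sub>H N)"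
  then have t: "t \<in> carrier (tensor R M N)" by simp
  have "coact (M' \<otimes>\<^sub>H N') (tensor_map R M' N' f g t) =
      sweedler (tensor R M N) H (tensor R (tensor R M' N') H)
        (\<lambda>a b. pure R (tensor R M' N') H (tensor_map R M' N' f g a) b)
        (coact (M \<otimes>\<^sub>H N) t)"
  proof (rule tensor_eqI[OF _ _ _ _ _ t, where P = "tensor R (tensor R M' N') H"])
    fix m n assume m: "m \<in> carrier M" and n: "n \<in> carrier N"
    show "coact (M' \<otimes>\<^sub>H N') (tensor_map R M' N' f g (pure R M N m n)) =
      sweedler (tensor R M N) H (tensor R (tensor R M' N') H)
        (\<lambda>a b. pure R (tensor R M' N') H (tensor_map R M' N' f g a) b)
        (coact (M \<otimes>\<^sub>H N) (pure R M N m n))"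
      by (simp add: m n M N closed lf lg tensor_map_pure[of M N] colinear_coact[OF M(1) f]
          colinear_coact[OF N(1) g] sweedler_sweedler linear_map_apply[OF lin]
          linear_map_closed[OF lin])
  qed (simp_all add: M N lin linear_map_apply[OF lin] linear_map_closed[OF lin])
  then show "coact (M' \<otimes>\<^sub>H N') (tensor_map R M' N' f g t) =
      sweedler (M \<otimes>\<^sub>H N) H (tensor R (M' \<otimes>\<^sub>H N') H)
        (\<lambda>a b. pure R (M' \<otimes>\<^sub>H N') H (tensor_map R M' N' f g a) b)
        (coact (M \<otimes>\<^sub>H N) t)"
    by simp
qed (simp_all add: M N)

text \<open>
  Rebracketing changes nothing in \<open>M \<otimes> N \<otimes> P\<close>, and in the last leg of the coaction it replaces
  \<open>(m(1) n(1)) p(1)\<close> by \<open>m(1) (n(1) p(1))\<close>.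
\<close>

lemma colinear_tensor_assoc:
  assumes M: "semicomodule M" and N: "semicomodule N" and P: "semicomodule P"
  shows "colinear ((M \<otimes>\<^sub>H N) \<otimes>\<^sub>H P)
    (M \<otimes>\<^sub>H (N \<otimes>\<^sub>H P)) (tensor_assoc R M N P)"
proof (rule colinearI)
  let ?A = "(M \<otimes>\<^sub>H N) \<otimes>\<^sub>H P"
  let ?B = "M \<otimes>\<^sub>H (N \<otimes>\<^sub>H P)"
  let ?S = "tensor R (tensor R M N) P" and ?T = "tensor R M (tensor R N P)"
  have lin: "linear_map R ?S ?T (tensor_assoc R M N P)"
    by (rule tensor_assoc_linear) (simp_all add: M N P)
  then show "linear_map R ?A ?B (tensor_assoc R M N P)" by simp
  have cA: "linear_map R ?S (tensor R ?S H) (coact ?A)"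
    using tensor_comodule_coact_linear[of "M \<otimes>\<^sub>H N" P] by (simp add: M N P)
  have cB: "linear_map R ?T (tensor R ?T H) (coact ?B)"
    using tensor_comodule_coact_linear[of M "N \<otimes>\<^sub>H P"] by (simp add: M N P)
  note lins = linear_map_apply[OF lin] linear_map_apply[OF cA] linear_map_apply[OF cB]
    linear_map_closed[OF lin] linear_map_closed[OF cA]
  fix t assume "t \<in> carrier ?A"
  then have t: "t \<in> carrier ?S" by simp
  have "coact ?B (tensor_assoc R M N P t) =
      sweedler ?S H (tensor R ?T H) (\<lambda>a b. pure R ?T H (tensor_assoc R M N P a) b) (coact ?A t)"
  proof (rule tensor3_eqI[OF _ _ _ _ _ _ _ t, where Q = "tensor R ?T H"])
    fix m n p assume [simp]: "m \<in> carrier M" "n \<in> carrier N" "p \<in> carrier P"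
    show "coact ?B (tensor_assoc R M N P (pure R (tensor R M N) P (pure R M N m n) p)) =
      sweedler ?S H (tensor R ?T H) (\<lambda>a b. pure R ?T H (tensor_assoc R M N P a) b)
        (coact ?A (pure R (tensor R M N) P (pure R M N m n) p))"
      using tensor_comodule_coact_pure[of "M \<otimes>\<^sub>H N" P "pure R M N m n" p]
        tensor_comodule_coact_pure[of M "N \<otimes>\<^sub>H P" m "pure R N P n p"]
      by (simp add: M N P tensor_assoc_pure_pure sweedler_sweedler lins mult_assoc)
  qed (simp_all add: M N P lins)
  then show "coact ?B (tensor_assoc R M N P t) =
      sweedler ?A H (tensor R ?B H) (\<lambda>a b. pure R ?B H (tensor_assoc R M N P a) b) (coact ?A t)"
    by simp
qed (simp_all add: M N P)

section \<open>The counital part of a coaction\<close>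

text \<open>
  The endomorphism \<open>(id \<otimes> \<epsilon>) \<rho>\<close>. For a coassociative coaction it is idempotent, and its image
  consists of the elements that satisfy the counit axiom.
\<close>

definition counital_part :: "('k, 'h, 'm) comodule \<Rightarrow> 'm \<Rightarrow> 'm"
  where "counital_part T t = sweedler T H T (\<lambda>a b. counit H b \<odot>\<^bsub>T\<^esub> a) (coact T t)"

lemma counital_part_linear: "semicomodule T \<Longrightarrow> linear_map R T T (counital_part T)"
  unfolding counital_part_def by simp

lemma counital_part_closed [simp]:
  "semicomodule T \<Longrightarrow> t \<in> carrier T \<Longrightarrow> counital_part T t \<in> carrier T"
  by (rule linear_map_closed[OF counital_part_linear])

text \<open>
  The source of all properties of \<open>p = (id \<otimes> \<epsilon>) \<rho>\<close>: by coassociativity \<open>\<rho> p\<close> sums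
  \<open>\<epsilon>(t(1)(2)) t(0) \<otimes> t(1)(1)\<close>, and the counit axiom of \<open>H\<close> removes \<open>\<epsilon>\<close>. So \<open>\<rho> p = \<rho>\<close>, and
  anything that depends on an element only through its coaction does not notice \<open>p\<close>.
\<close>

lemma coact_counital_part:
  assumes T: "semicomodule T" and t: "t \<in> carrier T"
  shows "coact T (counital_part T t) = coact T t"
proof -
  have "coact T (counital_part T t) =
      sweedler T H (tensor R T H) (\<lambda>a b. coact T (counit H b \<odot>\<^bsub>T\<^esub> a)) (coact T t)"
    by (simp add: counital_part_def T t coact_sweedler)
  also have "\<dots> = sweedler T H (tensor R T H) (\<lambda>a b. sweedler T H (tensor R T H)
      (\<lambda>c d. counit H b \<odot>\<^bsub>tensor R T H\<^esub> pure R T H c d) (coact T a)) (coact T t)"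
    by (simp add: T t linear_map_smult[OF coact_linear[OF T]] flip: sweedler_smult)
  also have "\<dots> = sweedler T H (tensor R T H) (\<lambda>a b. sweedler H H (tensor R T H)
      (\<lambda>c d. counit H d \<odot>\<^bsub>tensor R T H\<^esub> pure R T H a c) (comult H b)) (coact T t)"
    by (rule coassoc_sweedler) (simp_all add: T t)
  also have "\<dots> = coact T t"
    by (simp add: T t counit_right_sweedler)
  finally show ?thesis .
qed

lemma counital_part_coact:
  assumes T: "semicomodule T" and t: "t \<in> carrier T"
  shows "sweedler T H (tensor R T H) (\<lambda>a b. pure R T H (counital_part T a) b) (coact T t) = coact T t"
proof -
  have "sweedler T H (tensor R T H) (\<lambda>a b. pure R T H (counital_part T a) b) (coact T t) =
      sweedler T H (tensor R T H) (\<lambda>a b. sweedler T H (tensor R T H)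
      (\<lambda>c d. counit H d \<odot>\<^bsub>tensor R T H\<^esub> pure R T H c b) (coact T a)) (coact T t)"
    by (simp add: counital_part_def T t pure_sweedler_left pure_smult_left)
  also have "\<dots> = sweedler T H (tensor R T H) (\<lambda>a b. sweedler H H (tensor R T H)
      (\<lambda>c d. counit H c \<odot>\<^bsub>tensor R T H\<^esub> pure R T H a d) (comult H b)) (coact T t)"
    by (rule coassoc_sweedler) (simp_all add: T t)
  also have "\<dots> = coact T t"
    by (simp add: T t counit_left_sweedler)
  finally show ?thesis .
qed

lemma counital_part_idem:
  "semicomodule T \<Longrightarrow> t \<in> carrier T \<Longrightarrow> counital_part T (counital_part T t) = counital_part T t"
  by (simp add: counital_part_def[of T "counital_part T t"] coact_counital_part)
    (simp add: counital_part_def)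

text \<open>
  As \<open>p\<close> is defined by the coaction alone, colinear maps commute with it.
\<close>

lemma counital_part_natural:
  assumes M: "semicomodule M" and N: "semicomodule N" and f: "colinear M N f" and m: "m \<in> carrier M"
  shows "counital_part N (f m) = f (counital_part M m)"
proof -
  note lf = colinear_linear[OF f]
  have "f (counital_part M m) = sweedler M H N (\<lambda>a b. f (counit H b \<odot>\<^bsub>M\<^esub> a)) (coact M m)"
    unfolding counital_part_def by (rule linear_sweedler[OF _ _ _ _ lf]) (simp_all add: M N m)
  then show ?thesis
    by (simp add: counital_part_def colinear_coact[OF M f] M N m sweedler_sweedler
        colinear_closed[OF f] linear_map_apply[OF lf] linear_map_smult[OF lf])
qed

text \<open>
  The diagonal coaction of \<open>m \<otimes> n\<close> only uses the coactions of \<open>m\<close> and of \<open>n\<close>, which do not change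
  under \<open>p\<close>. Consequently cutting down the factors of a tensor product first makes no difference;
  this is why the two ways of bracketing a threefold product have the same image in
  \<open>M \<otimes> N \<otimes> P\<close>.
\<close>

lemma counital_part_tensor:
  assumes M: "semicomodule M" and N: "semicomodule N" and t: "t \<in> carrier (tensor R M N)"
  shows "counital_part (M \<otimes>\<^sub>H N)
      (tensor_map R M N (counital_part M) (counital_part N) t) =
    counital_part (M \<otimes>\<^sub>H N) t"
proof -
  have lin: "linear_map R (tensor R M N) (tensor R M N) (counital_part (M \<otimes>\<^sub>H N))"
    using counital_part_linear[OF semicomodule_tensor[OF M N]] by simp
  have lin': "linear_map R (tensor R M N) (tensor R M N) (tensor_map R M N (counital_part M) (counital_part N))"
    by (rule tensor_map_linear) (simp_all add: M N counital_part_linear)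
  show ?thesis
    by (rule tensor_eqI[OF _ _ linear_map_compose[OF lin' lin] lin _ t])
      (simp_all add: M N tensor_map_pure[of M N] counital_part_linear
        counital_part_def[of "M \<otimes>\<^sub>H N"] coact_counital_part)
qed

end

section \<open>Comodules cut out by an idempotent\<close>

lemma submodule_image:
  assumes "module R M" "module R N" "linear_map R M N f"
  shows "submodule (f ` carrier M) R N"
proof -
  interpret M: module R M by fact
  interpret N: module R N by fact
  note lin = linear_map_closed[OF assms(3)] linear_map_add[OF assms(3)]
    linear_map_smult[OF assms(3)] linear_map_zero[OF assms]
  have add: "f x \<oplus>\<^bsub>N\<^esub> f y \<in> f ` carrier M" if "x \<in> carrier M" "y \<in> carrier M" for x y
    using that by (intro image_eqI[of _ f "x \<oplus>\<^bsub>M\<^esub> y"]) (simp_all add: lin)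
  have smult: "r \<odot>\<^bsub>N\<^esub> f x \<in> f ` carrier M" if "r \<in> carrier R" "x \<in> carrier M" for r x
    using that by (intro image_eqI[of _ f "r \<odot>\<^bsub>M\<^esub> x"]) (simp_all add: lin)
  have zero: "\<zero>\<^bsub>N\<^esub> \<in> f ` carrier M"
    by (rule image_eqI[of _ f "\<zero>\<^bsub>M\<^esub>"]) (simp_all add: lin)
  have neg: "\<ominus>\<^bsub>N\<^esub> f x \<in> f ` carrier M" if "x \<in> carrier M" for x
    using smult[of "\<ominus>\<^bsub>R\<^esub> \<one>\<^bsub>R\<^esub>" x] that by (simp add: N.smult_l_minus lin)
  show ?thesis
    by (rule N.submoduleI) (auto simp: lin(1) zero intro: add smult neg)
qed

text \<open>
  Both the products of the category and its unit object arise in the same way: an idempotent \<open>e\<close>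
  cuts a counital direct summand out of a coassociative coaction, and the summand is moved to
  another type along an injection \<open>\<phi>\<close>. The condition on \<open>coact T (e t)\<close> says that the coaction of
  the image of \<open>e\<close> lies in the summand tensored with \<open>H\<close>.
\<close>

locale split_subcomodule = prebialgebra R H
  for R :: "('k, 'r) ring_scheme" (structure) and H :: "('k, 'h, 'x) prebialg_scheme" (structure) +
  fixes T :: "('k, 'h, 't) comodule" and e :: "'t \<Rightarrow> 't" and \<phi> :: "'t \<Rightarrow> 'a"
  assumes T: "semicomodule T"
    and linear_e: "linear_map R T T e"
    and e_idem: "t \<in> carrier T \<Longrightarrow> e (e t) = e t"
    and coact_e: "t \<in> carrier T \<Longrightarrow>
      sweedler T H (tensor R T H) (\<lambda>a b. pure R T H (e a) b) (coact T (e t)) = coact T (e t)"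
    and counit_e: "t \<in> carrier T \<Longrightarrow> counital_part T (e t) = e t"
    and inj_\<phi>: "inj_on \<phi> (e ` carrier T)"
begin

abbreviation "S \<equiv> e ` carrier T"

definition image_comodule :: "('k, 'h, 'a) comodule"
  where "image_comodule = transport_comodule R H \<phi> (restrict_comodule R H T S)"

abbreviation "A \<equiv> image_comodule"
abbreviation "incl \<equiv> inv_into S \<phi>"
abbreviation "retr t \<equiv> \<phi> (e t)"

lemma module_T [simp]: "module R T"
  by (rule semicomodule_module[OF T])

lemma e_closed [simp]: "t \<in> carrier T \<Longrightarrow> e t \<in> carrier T"
  by (rule linear_map_closed[OF linear_e])

lemma incl_phi [simp]: "s \<in> S \<Longrightarrow> incl (\<phi> s) = s"
  by (rule inv_into_f_f[OF inj_\<phi>])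

lemma incl_retr [simp]: "t \<in> carrier T \<Longrightarrow> incl (retr t) = e t"
  by simp

lemma A_carrier: "carrier A = \<phi> ` S"
  and A_zero: "zero A = \<phi> \<zero>\<^bsub>T\<^esub>"
  and A_add: "x \<oplus>\<^bsub>A\<^esub> y = \<phi> (incl x \<oplus>\<^bsub>T\<^esub> incl y)"
  and A_smult: "r \<odot>\<^bsub>A\<^esub> x = \<phi> (r \<odot>\<^bsub>T\<^esub> incl x)"
  by (simp_all add: image_comodule_def transport_comodule_def restrict_comodule_def Let_def
      module.extend_def)

lemma e_on_S: "s \<in> S \<Longrightarrow> e s = s"
  using e_idem by auto

lemma retr_closed [simp]: "t \<in> carrier T \<Longrightarrow> retr t \<in> carrier A"
  by (simp add: A_carrier)

lemma incl_in_S: "x \<in> carrier A \<Longrightarrow> incl x \<in> S"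
  by (auto simp: A_carrier)

lemma S_closed: "s \<in> S \<Longrightarrow> s \<in> carrier T"
  by auto

lemma incl_closed [simp]: "x \<in> carrier A \<Longrightarrow> incl x \<in> carrier T"
  using incl_in_S S_closed by blast

lemma phi_incl: "x \<in> carrier A \<Longrightarrow> \<phi> (incl x) = x"
  by (auto simp: A_carrier)

lemma e_incl [simp]: "x \<in> carrier A \<Longrightarrow> e (incl x) = incl x"
  by (rule e_on_S[OF incl_in_S])

lemma retr_incl [simp]: "x \<in> carrier A \<Longrightarrow> retr (incl x) = x"
  by (simp add: phi_incl)

lemma S_submodule: "submodule S R T"
  by (rule submodule_image[OF module_T module_T linear_e])

lemma S_add: "s \<in> S \<Longrightarrow> s' \<in> S \<Longrightarrow> s \<oplus>\<^bsub>T\<^esub> s' \<in> S"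
  and S_smult: "r \<in> carrier R \<Longrightarrow> s \<in> S \<Longrightarrow> r \<odot>\<^bsub>T\<^esub> s \<in> S"
  and S_neg: "s \<in> S \<Longrightarrow> \<ominus>\<^bsub>T\<^esub> s \<in> S"
  by (rule module.submoduleE(5,4,3)[OF module_T S_submodule]; assumption)+

lemma S_zero: "\<zero>\<^bsub>T\<^esub> \<in> S"
  using subgroup.one_closed[OF submodule.axioms(1)[OF S_submodule]] by simp

lemma incl_add: "x \<in> carrier A \<Longrightarrow> y \<in> carrier A \<Longrightarrow> incl (x \<oplus>\<^bsub>A\<^esub> y) = incl x \<oplus>\<^bsub>T\<^esub> incl y"
  and incl_smult: "r \<in> carrier R \<Longrightarrow> x \<in> carrier A \<Longrightarrow> incl (r \<odot>\<^bsub>A\<^esub> x) = r \<odot>\<^bsub>T\<^esub> incl x"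
  and incl_zero: "incl \<zero>\<^bsub>A\<^esub> = \<zero>\<^bsub>T\<^esub>"
  by (simp_all add: A_add A_smult A_zero S_add S_smult S_zero incl_in_S)

lemma A_eqI: "x \<in> carrier A \<Longrightarrow> y \<in> carrier A \<Longrightarrow> incl x = incl y \<Longrightarrow> x = y"
  using phi_incl by metis

lemma phi_closed: "s \<in> S \<Longrightarrow> \<phi> s \<in> carrier A"
  by (simp add: A_carrier)

lemma A_add_closed: "x \<in> carrier A \<Longrightarrow> y \<in> carrier A \<Longrightarrow> x \<oplus>\<^bsub>A\<^esub> y \<in> carrier A"
  and A_smult_closed: "r \<in> carrier R \<Longrightarrow> x \<in> carrier A \<Longrightarrow> r \<odot>\<^bsub>A\<^esub> x \<in> carrier A"
  and A_zero_closed: "\<zero>\<^bsub>A\<^esub> \<in> carrier A"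
  by (simp_all add: A_add A_smult A_zero phi_closed S_add S_smult S_zero incl_in_S)

lemma module_A [simp]: "module R A"
proof (rule moduleI)
  interpret T: module R T by simp
  show "cring R" by (rule is_cring)
  note closed = A_add_closed A_smult_closed A_zero_closed
  note incl_simps = incl_add incl_smult incl_zero closed
  show "abelian_group A"
  proof (rule abelian_groupI)
    fix x assume x: "x \<in> carrier A"
    show "\<exists>y\<in>carrier A. y \<oplus>\<^bsub>A\<^esub> x = \<zero>\<^bsub>A\<^esub>"
    proof (rule bexI)
      show "\<phi> (\<ominus>\<^bsub>T\<^esub> incl x) \<in> carrier A" "\<phi> (\<ominus>\<^bsub>T\<^esub> incl x) \<oplus>\<^bsub>A\<^esub> x = \<zero>\<^bsub>A\<^esub>"
        using x by (simp_all add: phi_closed A_add A_zero S_neg incl_in_S T.l_neg)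
    qed
  qed (auto intro!: A_eqI simp: incl_simps T.a_ac)
  fix a b x y assume "a \<in> carrier R" "b \<in> carrier R" "x \<in> carrier A" "y \<in> carrier A"
  then show "(a \<oplus>\<^bsub>R\<^esub> b) \<odot>\<^bsub>A\<^esub> x = a \<odot>\<^bsub>A\<^esub> x \<oplus>\<^bsub>A\<^esub> b \<odot>\<^bsub>A\<^esub> x"
    "a \<odot>\<^bsub>A\<^esub> (x \<oplus>\<^bsub>A\<^esub> y) = a \<odot>\<^bsub>A\<^esub> x \<oplus>\<^bsub>A\<^esub> a \<odot>\<^bsub>A\<^esub> y"
    "(a \<otimes>\<^bsub>R\<^esub> b) \<odot>\<^bsub>A\<^esub> x = a \<odot>\<^bsub>A\<^esub> (b \<odot>\<^bsub>A\<^esub> x)"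
    by (auto intro!: A_eqI simp: incl_simps T.smult_l_distr T.smult_r_distr T.smult_assoc1)
qed (auto intro!: A_eqI simp: incl_smult A_smult_closed module.smult_one[OF module_T])

lemma incl_linear: "linear_map R A T incl"
  by (rule linear_mapI) (simp_all add: incl_add incl_smult)

lemma retr_linear: "linear_map R T A (\<lambda>t. retr t)"
proof (rule linear_mapI)
  interpret T: module R T by simp
  fix x y r assume x: "x \<in> carrier T"
  then show "retr x \<in> carrier A" by simp
  show "retr (x \<oplus>\<^bsub>T\<^esub> y) = retr x \<oplus>\<^bsub>A\<^esub> retr y" if "y \<in> carrier T"
    using x that by (simp add: A_add linear_map_add[OF linear_e])
  show "retr (r \<odot>\<^bsub>T\<^esub> x) = r \<odot>\<^bsub>A\<^esub> retr x" if "r \<in> carrier R"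
    using x that by (simp add: A_smult linear_map_smult[OF linear_e])
qed

text \<open>
  Since the coaction of an element of the summand lies in the summand tensored with \<open>H\<close>, the
  first leg may be multiplied by \<open>e\<close> at will.
\<close>

lemma sweedler_coact_e:
  assumes "x \<in> carrier A" "module R P" "bilinear_map R T H P f"
  shows "sweedler T H P (\<lambda>a b. f (e a) b) (coact T (incl x)) = sweedler T H P f (coact T (incl x))"
proof -
  have "sweedler T H P f (sweedler T H (tensor R T H) (\<lambda>a b. pure R T H (e a) b) (coact T (incl x))) =
      sweedler T H P (\<lambda>a b. f (e a) b) (coact T (incl x))"
    using T assms by (simp add: sweedler_sweedler del: bilinear_mapI')
  then show ?thesis using coact_e[of "incl x"] assms(1) by simp
qed

text \<open>
  The map from \<open>S \<otimes> H\<close> to \<open>T \<otimes> H\<close> has the left inverse \<open>e \<otimes> id\<close>, so it is injective and the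
  definite description in \<open>restrict_comodule\<close> picks \<open>(e \<otimes> id) (\<rho> s)\<close>.
\<close>

lemma restrict_coact:
  assumes "s \<in> S"
  shows "coact (restrict_comodule R H T S) s =
    tensor_map R (T\<lparr>carrier := S\<rparr>) H e (\<lambda>h. h) (coact T s)"
proof -
  let ?S = "T\<lparr>carrier := S\<rparr>"
  have S [simp]: "module R ?S"
    by (rule submodule.submodule_is_module[OF S_submodule module_T])
  have e: "linear_map R T ?S e"
    by (rule linear_mapI) (simp_all add: linear_map_add[OF linear_e] linear_map_smult[OF linear_e])
  have i: "linear_map R ?S T (\<lambda>t. t)"
    by (rule linear_mapI) auto
  have s: "s \<in> carrier T" "e s = s" using assms e_idem by auto
  show ?thesis unfolding restrict_comodule_def
  proof (simp, rule the_equality, intro conjI)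
    show "tensor_map R ?S H e (\<lambda>h. h) (coact T s) \<in> carrier (tensor R ?S H)"
      by (rule tensor_map_closed[OF _ module_H _ module_H e linear_id]) (simp_all add: T s)
    have "tensor_map R T H (\<lambda>t. t) (\<lambda>h. h) (tensor_map R ?S H e (\<lambda>h. h) (coact T s)) =
        tensor_map R T H e (\<lambda>h. h) (coact T s)"
      by (rule tensor_map_compose[OF _ module_H _ module_H _ module_H e linear_id i linear_id]) (simp_all add: T s)
    then show "tensor_map R T H (\<lambda>t. t) (\<lambda>h. h) (tensor_map R ?S H e (\<lambda>h. h) (coact T s)) = coact T s"
      using coact_e[OF s(1)] by (simp add: tensor_map_sweedler[of T H] T s)
  next
    fix t assume t: "t \<in> carrier (tensor R ?S H) \<and> tensor_map R T H (\<lambda>t. t) (\<lambda>h. h) t = coact T s"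
    then have "tensor_map R ?S H e (\<lambda>h. h) (coact T s) =
        tensor_map R ?S H e (\<lambda>h. h) (tensor_map R T H (\<lambda>t. t) (\<lambda>h. h) t)"
      by simp
    also have "\<dots> = tensor_map R ?S H e (\<lambda>h. h) t"
      by (rule tensor_map_compose[OF _ module_H _ module_H _ module_H i linear_id e linear_id]) (use t in simp_all)
    also have "\<dots> = t"
    proof (rule tensor_map_id[OF S module_H])
      show "t \<in> carrier (tensor R ?S H)" using t ..
      show "e m = m" if "m \<in> carrier ?S" for m using that by (intro e_on_S) simp
    qed (rule HOL.refl)
    finally show "t = tensor_map R ?S H e (\<lambda>h. h) (coact T s)" ..
  qed
qed

text \<open>
  After the transport along \<open>\<phi>\<close> as well, the coaction is obtained by including into \<open>T\<close>, coacting
  there, and retracting the first leg. This formula takes the place of the definitions of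
  restriction and transport.
\<close>

lemma A_coact:
  assumes x: "x \<in> carrier A"
  shows "coact A x = sweedler T H (tensor R A H) (\<lambda>a b. pure R A H (retr a) b) (coact T (incl x))"
proof -
  let ?S = "T\<lparr>carrier := S\<rparr>"
  have S [simp]: "module R ?S"
    by (rule submodule.submodule_is_module[OF S_submodule module_T])
  have e: "linear_map R T ?S e"
    by (rule linear_mapI) (simp_all add: linear_map_add[OF linear_e] linear_map_smult[OF linear_e])
  have \<phi>: "linear_map R ?S A \<phi>"
    by (rule linear_mapI) (simp_all add: phi_closed A_add A_smult)
  obtain B :: "('k, 'a) module" where B: "same_module B A"
    "coact A x = tensor_map R B H \<phi> (\<lambda>h. h) (coact (restrict_comodule R H T S) (incl x))"
  proof
    let ?B = "\<lparr>carrier = \<phi> ` S, monoid.mult = undefined, one = undefined, zero = \<phi> \<zero>\<^bsub>T\<^esub>,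
      add = (\<lambda>x y. \<phi> (incl x \<oplus>\<^bsub>T\<^esub> incl y)), smult = (\<lambda>r x. \<phi> (r \<odot>\<^bsub>T\<^esub> incl x))\<rparr>"
    show "same_module ?B A"
      by (simp add: same_module_def A_carrier A_zero A_add A_smult fun_eq_iff)
    show "coact A x = tensor_map R ?B H \<phi> (\<lambda>h. h) (coact (restrict_comodule R H T S) (incl x))"
      by (simp add: image_comodule_def transport_comodule_def restrict_comodule_def Let_def
          module.extend_def)
  qed
  have "coact A x = tensor_map R A H \<phi> (\<lambda>h. h) (tensor_map R ?S H e (\<lambda>h. h) (coact T (incl x)))"
    by (simp add: B(2) restrict_coact[OF incl_in_S[OF x]] same_module_tensor_map[OF B(1) same_module_refl])
  also have "\<dots> = tensor_map R A H (\<lambda>t. retr t) (\<lambda>h. h) (coact T (incl x))"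
    by (rule tensor_map_compose[OF _ module_H _ module_H _ module_H e linear_id \<phi> linear_id]) (simp_all add: T x)
  finally show ?thesis using x T by (simp add: tensor_map_sweedler[of T H])
qed

lemma linear_retr [simp]: "linear_map R X T f \<Longrightarrow> linear_map R X A (\<lambda>x. retr (f x))"
  by (rule linear_map_apply[OF retr_linear])

lemma linear_incl [simp]: "linear_map R X A f \<Longrightarrow> linear_map R X T (\<lambda>x. incl (f x))"
  by (rule linear_map_apply[OF incl_linear])

lemma A_coact_linear: "linear_map R A (tensor R A H) (coact A)"
  by (rule linear_map_cong[OF _ _ A_coact]) (simp_all add: T)

text \<open>
  In \<open>(\<rho> \<otimes> id) \<rho>\<close> the first leg is retracted and included again between the two coactions, which
  amounts to an application of \<open>e\<close> that can be dropped.
\<close>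

lemma semicomodule_A: "semicomodule A"
  unfolding semicomodule_def
proof (intro conjI ballI)
  note [simp] = T linear_map_apply[OF A_coact_linear] linear_map_closed[OF A_coact_linear]
  fix x assume x: "x \<in> carrier A"
  let ?Q = "tensor R A (tensor R H H)"
  have "tensor_assoc R A H H (tensor_map R (tensor R A H) H (coact A) (\<lambda>h. h) (coact A x)) =
      sweedler T H ?Q (\<lambda>a b. sweedler T H ?Q (\<lambda>c d. pure R A (tensor R H H) (retr c) (pure R H H d b))
        (coact T (e a))) (coact T (incl x))"
    using x by (simp add: tensor_map_sweedler[of A H] tensor_assoc_sweedler sweedler_sweedler
        A_coact pure_sweedler_left)
  also have "\<dots> = sweedler T H ?Q (\<lambda>a b. sweedler T H ?Q (\<lambda>c d.
      pure R A (tensor R H H) (retr c) (pure R H H d b)) (coact T a)) (coact T (incl x))"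
    by (rule sweedler_coact_e) (simp_all add: x)
  also have "\<dots> = sweedler T H ?Q (\<lambda>a b. sweedler H H ?Q (\<lambda>c d.
      pure R A (tensor R H H) (retr a) (pure R H H c d)) (comult H b)) (coact T (incl x))"
    by (rule coassoc_sweedler) (simp_all add: x)
  also have "\<dots> = tensor_map R A (tensor R H H) (\<lambda>a. a) (comult H) (coact A x)"
    using x by (simp add: tensor_map_sweedler[of A H] sweedler_sweedler A_coact
      flip: pure_sweedler_right)
  finally show "tensor_assoc R A H H (tensor_map R (tensor R A H) H (coact A) (\<lambda>h. h) (coact A x)) =
      tensor_map R A (tensor R H H) (\<lambda>a. a) (comult H) (coact A x)" .
qed (simp_all add: A_coact_linear)

lemma right_comodule_A: "right_comodule R H A"
  unfolding right_comodule_iff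
proof (intro conjI ballI)
  note [simp] = T
  fix x assume x: "x \<in> carrier A"
  have "retr (sweedler T H T (\<lambda>a b. counit H b \<odot>\<^bsub>T\<^esub> a) (coact T (incl x))) =
      sweedler T H A (\<lambda>a b. retr (counit H b \<odot>\<^bsub>T\<^esub> a)) (coact T (incl x))"
    by (rule linear_sweedler[OF _ _ _ _ retr_linear]) (simp_all add: x)
  also have "\<dots> = sweedler A H A (\<lambda>a b. counit H b \<odot>\<^bsub>A\<^esub> a) (coact A x)"
    using x by (simp add: A_coact sweedler_sweedler linear_map_smult[OF retr_linear])
  finally show "sweedler A H A (\<lambda>a b. counit H b \<odot>\<^bsub>A\<^esub> a) (coact A x) = x"
    using counit_e[of "incl x"] x by (simp add: counital_part_def phi_incl)
qed (rule semicomodule_A)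

lemma colinear_incl: "colinear A T incl"
proof (rule colinearI)
  note [simp] = T
  fix x assume x: "x \<in> carrier A"
  then show "coact T (incl x) = sweedler A H (tensor R T H) (\<lambda>a b. pure R T H (incl a) b) (coact A x)"
    using coact_e[of "incl x"] by (simp add: A_coact sweedler_sweedler)
qed (simp_all add: semicomodule_A incl_linear)

end

section \<open>The counital tensor product\<close>

context prebialgebra
begin

lemma counital_part_pure:
  assumes M: "semicomodule M" and N: "semicomodule N" and "m \<in> carrier M" "n \<in> carrier N"
  shows "counital_part (M \<otimes>\<^sub>H N) (pure R M N m n) =
    sweedler M H (tensor R M N) (\<lambda>m0 m1. sweedler N H (tensor R M N) (\<lambda>n0 n1.
      counit H (m1 \<cdot> n1) \<odot>\<^bsub>tensor R M N\<^esub> pure R M N m0 n0) (coact N n)) (coact M m)"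
  by (simp add: counital_part_def assms sweedler_sweedler)

lemma counital_part_tensor_closed [simp]:
  "semicomodule M \<Longrightarrow> semicomodule N \<Longrightarrow> t \<in> carrier (tensor R M N) \<Longrightarrow>
    counital_part (M \<otimes>\<^sub>H N) t \<in> carrier (tensor R M N)"
  using counital_part_closed[of "M \<otimes>\<^sub>H N" t] by simp

text \<open>
  The generators of \<open>M \<otimes>\<^sup>r N\<close> are the values of the counital part on pure tensors, and pure tensors
  span.
\<close>

lemma rtensor_carrier_eq:
  assumes M: "semicomodule M" and N: "semicomodule N"
  shows "rtensor_carrier R H M N =
    counital_part (M \<otimes>\<^sub>H N) ` carrier (tensor R M N)"
proof -
  let ?T = "tensor R M N" and ?p = "counital_part (M \<otimes>\<^sub>H N)"
  let ?g = "\<lambda>m n. tensor_lift ?T (\<lambda>m0 m1. tensor_lift ?T (\<lambda>n0 n1.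
      counit H (m1 \<cdot> n1) \<odot>\<^bsub>?T\<^esub> pure R M N m0 n0) (coact N n)) (coact M m)"
  let ?X = "{?g m n | m n. m \<in> carrier M \<and> n \<in> carrier N}"
  have gen: "?g m n = ?p (pure R M N m n)" if "m \<in> carrier M" "n \<in> carrier N" for m n
    using that
    by (simp add: M N counital_part_pure tensor_lift_sweedler[of M H] tensor_lift_sweedler[of N H])
  have X: "?X = {?p (pure R M N m n) | m n. m \<in> carrier M \<and> n \<in> carrier N}"
  proof (intro Collect_cong ex_cong1)
    fix u m n
    show "(u = ?g m n \<and> m \<in> carrier M \<and> n \<in> carrier N) \<longleftrightarrow>
      (u = ?p (pure R M N m n) \<and> m \<in> carrier M \<and> n \<in> carrier N)"
      using gen by blast
  qed
  have lin: "linear_map R ?T ?T ?p"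
    using counital_part_linear[OF semicomodule_tensor[OF M N]] by simp
  have sub: "submodule (?p ` carrier ?T) R ?T"
    by (rule submodule_image[OF _ _ lin]) (simp_all add: M N)
  have gens: "?X \<subseteq> ?p ` carrier ?T"
    unfolding X using M N by auto
  have least: "?p t \<in> S" if S: "submodule S R ?T" "?X \<subseteq> S" and t: "t \<in> carrier ?T" for S t
    using t
  proof (rule two_modules.tensor_induct[OF two_modulesI[OF semicomodule_module[OF M] semicomodule_module[OF N]]])
    fix m n assume "m \<in> carrier M" "n \<in> carrier N"
    then show "?p (pure R M N m n) \<in> S" using S(2) unfolding X by blast
  next
    fix x y assume "x \<in> carrier ?T" "y \<in> carrier ?T" "?p x \<in> S" "?p y \<in> S"
    then show "?p (x \<oplus>\<^bsub>?T\<^esub> y) \<in> S"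
      using module.submoduleE(5)[OF _ S(1)] M N by (simp add: linear_map_add[OF lin])
  qed
  show ?thesis
    unfolding rtensor_carrier_def generated_submodule_def Let_def
  proof (intro equalityI subsetI InterI)
    fix u S assume "u \<in> ?p ` carrier ?T" and S: "S \<in> {S. submodule S R ?T \<and> ?X \<subseteq> S}"
    then obtain t where "t \<in> carrier ?T" "u = ?p t" by (elim imageE)
    with least S show "u \<in> S" by simp
  next
    fix u assume "u \<in> \<Inter> {S. submodule S R ?T \<and> ?X \<subseteq> S}"
    moreover have "?p ` carrier ?T \<in> {S. submodule S R ?T \<and> ?X \<subseteq> S}"
      using sub gens by (intro CollectI conjI)
    ultimately show "u \<in> ?p ` carrier ?T" by (rule InterD)
  qed
qed

lemma inj_on_code:
  assumes "module R M" "module R N"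
  shows "inj_on code (carrier (tensor R M N))"
proof (rule inj_onI)
  interpret two_modules R M N using assms by (rule two_modulesI)
  fix t u assume t: "t \<in> carrier (tensor R M N)" and u: "u \<in> carrier (tensor R M N)"
    and "code t = code u"
  then have "cls (rep t) = cls (rep u)" by (simp only: code_def univ.inject)
  then show "t = u" by (simp only: class_rep[OF t] class_rep[OF u])
qed

lemma split_boxtimes:
  assumes M: "semicomodule M" and N: "semicomodule N"
  shows "split_subcomodule R H (M \<otimes>\<^sub>H N) (counital_part (M \<otimes>\<^sub>H N)) code"
proof (intro split_subcomodule.intro split_subcomodule_axioms.intro prebialgebra_axioms)
  let ?T = "M \<otimes>\<^sub>H N"
  show T: "semicomodule ?T" by (simp add: M N)
  show "linear_map R ?T ?T (counital_part ?T)"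
    by (rule counital_part_linear[OF T])
  have "counital_part ?T ` carrier ?T \<subseteq> carrier (tensor R M N)" using M N by auto
  then show "inj_on code (counital_part ?T ` carrier ?T)"
    by (rule inj_on_subset[OF inj_on_code, rotated 2]) (simp_all add: M N)
  fix t assume t: "t \<in> carrier ?T"
  show idem: "counital_part ?T (counital_part ?T t) = counital_part ?T t"
    by (rule counital_part_idem[OF T t])
  show "sweedler ?T H (tensor R ?T H) (\<lambda>a b. pure R ?T H (counital_part ?T a) b)
      (coact ?T (counital_part ?T t)) = coact ?T (counital_part ?T t)"
    by (rule counital_part_coact[OF T counital_part_closed[OF T t]])
  show "counital_part ?T (counital_part ?T t) = counital_part ?T t"
    by (rule idem)
qed

text \<open>The retraction of \<open>M \<otimes> N\<close> onto its counital part.\<close>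

definition corestrict ::
  "('k, 'h, ('h, 'a) univ) comodule \<Rightarrow> ('k, 'h, ('h, 'a) univ) comodule \<Rightarrow>
    (('h, 'a) univ \<times> ('h, 'a) univ) list set \<Rightarrow> ('h, 'a) univ"
  where "corestrict M N t = code (counital_part (M \<otimes>\<^sub>H N) t)"

context
  fixes M N :: "('k, 'h, 'a) ucomodule"
  assumes M: "semicomodule M" and N: "semicomodule N"
begin

interpretation B: split_subcomodule R H "M \<otimes>\<^sub>H N"
    "counital_part (M \<otimes>\<^sub>H N)" code
  by (rule split_boxtimes[OF M N])

lemma boxtimes_eq: "M \<boxtimes> N = B.image_comodule"
  by (simp add: boxtimes_def B.image_comodule_def rtensor_def rtensor_carrier_eq M N)

text \<open>
  \<open>decode\<close> inverts the coding on the whole of \<open>M \<otimes> N\<close>, the inclusion of the split subcomodule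
  only on the image of the idempotent; on codes from that image they agree.
\<close>

lemma decode_incl:
  assumes "x \<in> carrier (M \<boxtimes> N)"
  shows "decode R M N x = B.incl x"
proof -
  have "B.incl x \<in> carrier (tensor R M N)" "code (B.incl x) = x"
    using B.incl_closed[of x] B.phi_incl[of x] assms by (simp_all add: boxtimes_eq)
  then show ?thesis
    unfolding decode_def using M N by (intro inv_into_f_eq inj_on_code) simp_all
qed

lemma right_comodule_boxtimes: "right_comodule R H (M \<boxtimes> N)"
  unfolding boxtimes_eq by (rule B.right_comodule_A)

lemma colinear_decode: "colinear (M \<boxtimes> N) (M \<otimes>\<^sub>H N) (decode R M N)"
  using B.colinear_incl B.semicomodule_A decode_incl
  unfolding boxtimes_eq by (rule colinear_cong)

lemma colinear_corestrict: "colinear (M \<otimes>\<^sub>H N) (M \<boxtimes> N) (corestrict M N)"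
  unfolding boxtimes_eq corestrict_def[abs_def]
proof (rule colinearI[OF B.T])
  show "linear_map R (M \<otimes>\<^sub>H N) B.image_comodule
      (\<lambda>t. code (counital_part (M \<otimes>\<^sub>H N) t))"
    by (rule B.retr_linear)
  fix t assume t: "t \<in> carrier (M \<otimes>\<^sub>H N)"
  show "coact B.image_comodule (code (counital_part (M \<otimes>\<^sub>H N) t)) =
      sweedler (M \<otimes>\<^sub>H N) H (tensor R B.image_comodule H)
        (\<lambda>a b. pure R B.image_comodule H (code (counital_part (M \<otimes>\<^sub>H N) a)) b)
        (coact (M \<otimes>\<^sub>H N) t)"
    unfolding B.A_coact[OF B.retr_closed[OF t]] B.incl_retr[OF t] coact_counital_part[OF B.T t] ..
qed

lemma corestrict_decode:
  "x \<in> carrier (M \<boxtimes> N) \<Longrightarrow> corestrict M N (decode R M N x) = x"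
  using B.retr_incl[of x] by (simp add: decode_incl corestrict_def boxtimes_eq)

lemma decode_corestrict:
  "t \<in> carrier (tensor R M N) \<Longrightarrow>
    decode R M N (corestrict M N t) = counital_part (M \<otimes>\<^sub>H N) t"
  using B.incl_retr[of t] B.retr_closed[of t] decode_incl[of "corestrict M N t"]
  by (simp add: corestrict_def boxtimes_eq)

lemma counital_part_decode:
  "x \<in> carrier (M \<boxtimes> N) \<Longrightarrow>
    counital_part (M \<otimes>\<^sub>H N) (decode R M N x) = decode R M N x"
  using B.e_incl[of x] by (simp add: decode_incl boxtimes_eq)

end

end

section \<open>The unit object\<close>

context prebialgebra
begin

lemmas regular_comodule_simps [simp] = same_module_rewrite[OF same_module_regular_comodule]

lemma regular_comodule_coact [simp]: "coact (regular_comodule H) = comult H"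
  by (simp add: regular_comodule_def)

lemma semicomodule_regular: "semicomodule (regular_comodule H)"
  unfolding semicomodule_def by (simp add: comult_linear coassoc)

lemma eps_s_sweedler:
  "h \<in> carrier H \<Longrightarrow> eps_s H h = sweedler H H H (\<lambda>a b. counit H (h \<cdot> b) \<odot>\<^bsub>H\<^esub> a) (comult H \<one>\<^bsub>H\<^esub>)"
  by (simp add: eps_s_def tensor_lift_sweedler[of H H])

lemma eps_s_linear: "linear_map R H H (eps_s H)"
  by (rule linear_map_cong[OF _ _ eps_s_sweedler]) simp_all

lemma eps_s_closed [simp]: "h \<in> carrier H \<Longrightarrow> eps_s H h \<in> carrier H"
  by (rule linear_map_closed[OF eps_s_linear])

lemma linear_eps_s [simp]: "linear_map R X H f \<Longrightarrow> linear_map R X H (\<lambda>x. eps_s H (f x))"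
  by (rule linear_map_apply[OF eps_s_linear])

lemma eps_s_one: "eps_s H \<one>\<^bsub>H\<^esub> = \<one>\<^bsub>H\<^esub>"
  by (simp add: eps_s_sweedler counit_right_sweedler)

lemma sweedler_comult_mult:
  assumes "h \<in> carrier H" "k \<in> carrier H" "module R P" "bilinear_map R H H P f"
  shows "sweedler H H P f (comult H (h \<cdot> k)) =
    sweedler H H P (\<lambda>a b. sweedler H H P (\<lambda>c d. f (a \<cdot> c) (b \<cdot> d)) (comult H k)) (comult H h)"
  using assms by (simp add: comult_mult_sweedler sweedler_sweedler del: bilinear_mapI')

end

context comonoidal_prebialgebra
begin

text \<open>
  The axioms (lc) and (rc) are applied by testing both sides against a trilinear map, as for
  coassociativity.
\<close>

lemma left_comonoidal_sweedler:
  assumes P: "module R P"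
    and "\<And>b c. \<lbrakk>b \<in> carrier H; c \<in> carrier H\<rbrakk> \<Longrightarrow> linear_map R H P (\<lambda>a. f a b c)"
    and "\<And>a c. \<lbrakk>a \<in> carrier H; c \<in> carrier H\<rbrakk> \<Longrightarrow> linear_map R H P (\<lambda>b. f a b c)"
    and "\<And>a b. \<lbrakk>a \<in> carrier H; b \<in> carrier H\<rbrakk> \<Longrightarrow> linear_map R H P (\<lambda>c. f a b c)"
  shows "sweedler H H P (\<lambda>a b. sweedler H H P (\<lambda>c d. f c d b) (comult H a)) (comult H \<one>\<^bsub>H\<^esub>) =
    sweedler H H P (\<lambda>a b. sweedler H H P (\<lambda>c d. f a (b \<cdot> c) d) (comult H \<one>\<^bsub>H\<^esub>)) (comult H \<one>\<^bsub>H\<^esub>)"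
proof -
  let ?g = "sweedler (tensor R H H) H P (\<lambda>u c. sweedler H H P (\<lambda>a b. f a b c) u)"
  from arg_cong[OF left_comonoidal, of ?g] show ?thesis
    using assms linear_map_closed[OF assms(2)]
    by (simp add: Let_def comult2_def tensor_map_sweedler[of H H] tensor_lift_sweedler[of H H] sweedler_sweedler)
qed

lemma right_comonoidal_sweedler:
  assumes P: "module R P"
    and "\<And>b c. \<lbrakk>b \<in> carrier H; c \<in> carrier H\<rbrakk> \<Longrightarrow> linear_map R H P (\<lambda>a. f a b c)"
    and "\<And>a c. \<lbrakk>a \<in> carrier H; c \<in> carrier H\<rbrakk> \<Longrightarrow> linear_map R H P (\<lambda>b. f a b c)"
    and "\<And>a b. \<lbrakk>a \<in> carrier H; b \<in> carrier H\<rbrakk> \<Longrightarrow> linear_map R H P (\<lambda>c. f a b c)"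
  shows "sweedler H H P (\<lambda>a b. sweedler H H P (\<lambda>c d. f c d b) (comult H a)) (comult H \<one>\<^bsub>H\<^esub>) =
    sweedler H H P (\<lambda>a b. sweedler H H P (\<lambda>c d. f a (c \<cdot> b) d) (comult H \<one>\<^bsub>H\<^esub>)) (comult H \<one>\<^bsub>H\<^esub>)"
proof -
  let ?g = "sweedler (tensor R H H) H P (\<lambda>u c. sweedler H H P (\<lambda>a b. f a b c) u)"
  from arg_cong[OF right_comonoidal, of ?g] show ?thesis
    using assms linear_map_closed[OF assms(2)]
    by (simp add: Let_def comult2_def tensor_map_sweedler[of H H] tensor_lift_sweedler[of H H] sweedler_sweedler)
qed

lemma comult_eps_s_expand:
  assumes h: "h \<in> carrier H"
  shows "comult H (eps_s H h) = sweedler H H (tensor R H H) (\<lambda>a b. sweedler H H (tensor R H H)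
    (\<lambda>c d. counit H (h \<cdot> b) \<odot>\<^bsub>tensor R H H\<^esub> pure R H H c d) (comult H a)) (comult H \<one>\<^bsub>H\<^esub>)"
  by (simp add: h eps_s_sweedler comult_sweedler linear_map_smult[OF comult_linear] flip: sweedler_smult)

text \<open>
  For \<open>y = \<epsilon>\<^sub>s(h)\<close> the coproduct \<open>\<Delta>(y)\<close> is the sum of \<open>\<epsilon>(h 1(3)) 1(1) \<otimes> 1(2)\<close>, and (lc) splits the
  threefold coproduct of \<open>1\<close>: \<open>\<Delta>(y) = 1(1) \<otimes> 1(2) y\<close>. In the same way (rc) gives
  \<open>\<Delta>(y) = 1(1) \<otimes> y 1(2)\<close> in the lemma after this one.
\<close>

lemma comult_eps_s_left:
  assumes h: "h \<in> carrier H"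
  shows "comult H (eps_s H h) = sweedler H H (tensor R H H)
    (\<lambda>a b. pure R H H a (b \<cdot> eps_s H h)) (comult H \<one>\<^bsub>H\<^esub>)"
proof -
  have "comult H (eps_s H h) = sweedler H H (tensor R H H) (\<lambda>a b. sweedler H H (tensor R H H)
      (\<lambda>c d. counit H (h \<cdot> d) \<odot>\<^bsub>tensor R H H\<^esub> pure R H H a (b \<cdot> c)) (comult H \<one>\<^bsub>H\<^esub>)) (comult H \<one>\<^bsub>H\<^esub>)"
    unfolding comult_eps_s_expand[OF h] by (rule left_comonoidal_sweedler) (simp_all add: h)
  then show ?thesis
    by (simp add: h eps_s_sweedler mult_sweedler_right pure_sweedler_right smult_mult_right pure_smult_right)
qed

lemma comult_eps_s_right:
  assumes h: "h \<in> carrier H"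
  shows "comult H (eps_s H h) = sweedler H H (tensor R H H)
    (\<lambda>a b. pure R H H a (eps_s H h \<cdot> b)) (comult H \<one>\<^bsub>H\<^esub>)"
proof -
  have "comult H (eps_s H h) = sweedler H H (tensor R H H) (\<lambda>a b. sweedler H H (tensor R H H)
      (\<lambda>c d. counit H (h \<cdot> d) \<odot>\<^bsub>tensor R H H\<^esub> pure R H H a (c \<cdot> b)) (comult H \<one>\<^bsub>H\<^esub>)) (comult H \<one>\<^bsub>H\<^esub>)"
    unfolding comult_eps_s_expand[OF h] by (rule right_comonoidal_sweedler) (simp_all add: h)
  then show ?thesis
    by (simp add: h eps_s_sweedler mult_sweedler_left pure_sweedler_right smult_mult_left pure_smult_right)
qed

text \<open>
  Applying \<open>id \<otimes> \<epsilon>\<close> to \<open>\<Delta>(y) = 1(1) \<otimes> y 1(2)\<close> gives \<open>y = \<epsilon>\<^sub>s(y)\<close>.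
\<close>

lemma eps_s_idem:
  assumes h: "h \<in> carrier H"
  shows "eps_s H (eps_s H h) = eps_s H h"
proof -
  let ?y = "eps_s H h"
  have "?y = sweedler H H H (\<lambda>a b. counit H b \<odot>\<^bsub>H\<^esub> a) (comult H ?y)"
    using h by (simp add: counit_right_sweedler)
  also have "\<dots> = eps_s H ?y"
    using h by (simp add: comult_eps_s_right sweedler_sweedler eps_s_sweedler[of ?y])
  finally show ?thesis ..
qed

text \<open>
  This places \<open>\<Delta>(y)\<close> in \<open>H\<^sub>s \<otimes> H\<close>. When \<open>\<epsilon>\<^sub>s\<close> is applied to the left factor of
  \<open>1(1) \<otimes> 1(2) y\<close>, that factor becomes the sum of \<open>\<epsilon>(1(1) 1(2')) 1(1')\<close>. By (rc) this amounts to an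
  application of \<open>\<epsilon>\<close> to the middle leg of the threefold coproduct of \<open>1\<close>, where it disappears.
\<close>

lemma eps_s_coact:
  assumes h: "h \<in> carrier H"
  shows "sweedler H H (tensor R H H) (\<lambda>a b. pure R H H (eps_s H a) b) (comult H (eps_s H h)) =
    comult H (eps_s H h)"
proof -
  let ?T = "tensor R H H" and ?y = "eps_s H h"
  have "sweedler H H ?T (\<lambda>a b. pure R H H (eps_s H a) b) (comult H ?y) =
      sweedler H H ?T (\<lambda>a b. sweedler H H ?T (\<lambda>c d.
        counit H (a \<cdot> d) \<odot>\<^bsub>?T\<^esub> pure R H H c (b \<cdot> ?y)) (comult H \<one>\<^bsub>H\<^esub>)) (comult H \<one>\<^bsub>H\<^esub>)"
    using h by (simp add: comult_eps_s_left sweedler_sweedler)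
      (simp add: eps_s_sweedler[of "_ :: 'h"] pure_sweedler_left pure_smult_left cong: sweedler_cong)
  also have "\<dots> = sweedler H H ?T (\<lambda>a b. sweedler H H ?T (\<lambda>c d.
        counit H (c \<cdot> b) \<odot>\<^bsub>?T\<^esub> pure R H H a (d \<cdot> ?y)) (comult H \<one>\<^bsub>H\<^esub>)) (comult H \<one>\<^bsub>H\<^esub>)"
    by (rule sweedler_swap) (simp_all add: h)
  also have "\<dots> = sweedler H H ?T (\<lambda>a b. sweedler H H ?T (\<lambda>c d.
        counit H d \<odot>\<^bsub>?T\<^esub> pure R H H c (b \<cdot> ?y)) (comult H a)) (comult H \<one>\<^bsub>H\<^esub>)"
    by (rule right_comonoidal_sweedler[symmetric]) (simp_all add: h)
  also have "\<dots> = comult H ?y"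
    using h by (simp add: counit_right_sweedler comult_eps_s_left)
  finally show ?thesis .
qed

text \<open>
  Endomorphisms of \<open>H\<close> as a left comodule over itself. Multiplication by an element of \<open>H\<^sub>s\<close>, from
  either side, is of this kind, which governs the coaction on the values of the unit constraints.
\<close>

definition left_colinear :: "('h \<Rightarrow> 'h) \<Rightarrow> bool"
  where "left_colinear g \<longleftrightarrow> linear_map R H H g \<and> (\<forall>k\<in>carrier H. comult H (g k) =
    sweedler H H (tensor R H H) (\<lambda>a b. pure R H H a (g b)) (comult H k))"

text \<open>
  Write \<open>k = 1 k\<close> and use \<open>\<Delta>(y) = 1(1) \<otimes> y 1(2)\<close>: then \<open>\<Delta>(y k) = 1(1) k(1) \<otimes> y 1(2) k(2)\<close> is
  \<open>k(1) \<otimes> y k(2)\<close>. Multiplication from the right is symmetric, with the other formula for \<open>\<Delta>(y)\<close>.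
\<close>

lemma left_colinear_mult_left:
  assumes h: "h \<in> carrier H"
  shows "left_colinear (\<lambda>k. eps_s H h \<cdot> k)"
  unfolding left_colinear_def
proof (intro conjI ballI)
  let ?T = "tensor R H H" and ?y = "eps_s H h"
  fix k assume k: "k \<in> carrier H"
  have "sweedler H H ?T (\<lambda>a b. pure R H H a (?y \<cdot> b)) (comult H (\<one>\<^bsub>H\<^esub> \<cdot> k)) =
      sweedler H H ?T (\<lambda>a b. sweedler H H ?T (\<lambda>c d. pure R H H (a \<cdot> c) (?y \<cdot> (b \<cdot> d)))
        (comult H k)) (comult H \<one>\<^bsub>H\<^esub>)"
    by (rule sweedler_comult_mult) (simp_all add: h k)
  also have "\<dots> = comult H (?y \<cdot> k)"
    using h k by (simp add: comult_mult_sweedler comult_eps_s_right sweedler_sweedler mult_assoc)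
  finally show "comult H (?y \<cdot> k) = sweedler H H ?T (\<lambda>a b. pure R H H a (?y \<cdot> b)) (comult H k)"
    using k by simp
qed (simp add: h)

lemma left_colinear_mult_right:
  assumes h: "h \<in> carrier H"
  shows "left_colinear (\<lambda>k. k \<cdot> eps_s H h)"
  unfolding left_colinear_def
proof (intro conjI ballI)
  let ?T = "tensor R H H" and ?y = "eps_s H h"
  fix k assume k: "k \<in> carrier H"
  have "sweedler H H ?T (\<lambda>a b. pure R H H a (b \<cdot> ?y)) (comult H (k \<cdot> \<one>\<^bsub>H\<^esub>)) =
      sweedler H H ?T (\<lambda>a b. sweedler H H ?T (\<lambda>c d. pure R H H (a \<cdot> c) ((b \<cdot> d) \<cdot> ?y))
        (comult H \<one>\<^bsub>H\<^esub>)) (comult H k)"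
    by (rule sweedler_comult_mult) (simp_all add: h k)
  also have "\<dots> = comult H (k \<cdot> ?y)"
    using h k by (simp add: comult_mult_sweedler comult_eps_s_left sweedler_sweedler mult_assoc)
  finally show "comult H (k \<cdot> ?y) = sweedler H H ?T (\<lambda>a b. pure R H H a (b \<cdot> ?y)) (comult H k)"
    using k by simp
qed (simp add: h)

text \<open>
  The coaction of the sum of \<open>\<epsilon>(g m(1)) m(0)\<close> is the sum of \<open>\<epsilon>(g m(2)) m(0) \<otimes> m(1)\<close>, where
  \<open>m(1) \<epsilon>(g m(2))\<close> collapses to \<open>g m(1)\<close> by the counit axiom for \<open>\<Delta>(g m(1))\<close>.
\<close>

lemma coact_left_colinear:
  assumes M: "semicomodule M" and m: "m \<in> carrier M" and g: "left_colinear g"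
  shows "coact M (sweedler M H M (\<lambda>m0 m1. counit H (g m1) \<odot>\<^bsub>M\<^esub> m0) (coact M m)) =
    sweedler M H (tensor R M H) (\<lambda>m0 m1. pure R M H m0 (g m1)) (coact M m)"
proof -
  let ?P = "tensor R M H"
  have lin: "linear_map R H H g"
    and comult_g: "\<And>k. k \<in> carrier H \<Longrightarrow>
      comult H (g k) = sweedler H H (tensor R H H) (\<lambda>a b. pure R H H a (g b)) (comult H k)"
    using g unfolding left_colinear_def by blast+
  note [simp] = M m linear_map_apply[OF lin] linear_map_closed[OF lin]
  have "coact M (sweedler M H M (\<lambda>m0 m1. counit H (g m1) \<odot>\<^bsub>M\<^esub> m0) (coact M m)) =
      sweedler M H ?P (\<lambda>m0 m1. coact M (counit H (g m1) \<odot>\<^bsub>M\<^esub> m0)) (coact M m)"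
    by (simp add: coact_sweedler)
  also have "\<dots> = sweedler M H ?P (\<lambda>m0 m1. sweedler M H ?P
      (\<lambda>a b. counit H (g m1) \<odot>\<^bsub>?P\<^esub> pure R M H a b) (coact M m0)) (coact M m)"
    by (simp add: linear_map_smult[OF coact_linear[OF M]] flip: sweedler_smult)
  also have "\<dots> = sweedler M H ?P (\<lambda>m0 m1. sweedler H H ?P
      (\<lambda>b c. counit H (g c) \<odot>\<^bsub>?P\<^esub> pure R M H m0 b) (comult H m1)) (coact M m)"
    by (rule coassoc_sweedler) simp_all
  also have "\<dots> = sweedler M H ?P (\<lambda>m0 m1. pure R M H m0 (g m1)) (coact M m)"
  proof (rule sweedler_cong[OF HOL.refl])
    fix m0 m1 assume [simp]: "m0 \<in> carrier M" "m1 \<in> carrier H"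
    have "pure R M H m0 (g m1) =
        sweedler H H ?P (\<lambda>b c. counit H c \<odot>\<^bsub>?P\<^esub> pure R M H m0 b) (comult H (g m1))"
      by (simp add: counit_right_sweedler)
    then show "sweedler H H ?P (\<lambda>b c. counit H (g c) \<odot>\<^bsub>?P\<^esub> pure R M H m0 b) (comult H m1) =
        pure R M H m0 (g m1)"
      by (simp add: comult_g sweedler_sweedler)
  qed
  finally show ?thesis .
qed

end

context comonoidal_prebialgebra
begin

lemma split_unit: "split_subcomodule R H (regular_comodule H) (eps_s H) HElem"
proof (intro split_subcomodule.intro split_subcomodule_axioms.intro prebialgebra_axioms)
  show "semicomodule (regular_comodule H)" by (rule semicomodule_regular)
  show "linear_map R (regular_comodule H) (regular_comodule H) (eps_s H)"
    by (simp add: eps_s_linear)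
  show "inj_on HElem (eps_s H ` carrier (regular_comodule H))"
    by (simp add: inj_on_def)
  fix h assume "h \<in> carrier (regular_comodule H)"
  then have h: "h \<in> carrier H" by simp
  show "eps_s H (eps_s H h) = eps_s H h" by (rule eps_s_idem[OF h])
  show "sweedler (regular_comodule H) H (tensor R (regular_comodule H) H)
      (\<lambda>a b. pure R (regular_comodule H) H (eps_s H a) b) (coact (regular_comodule H) (eps_s H h)) =
      coact (regular_comodule H) (eps_s H h)"
    using eps_s_coact[OF h] by simp
  show "counital_part (regular_comodule H) (eps_s H h) = eps_s H h"
    using h by (simp add: counital_part_def counit_right_sweedler)
qed

interpretation U: split_subcomodule R H "regular_comodule H" "eps_s H" HElem
  by (rule split_unit)

abbreviation "unit_obj \<equiv> unit_comodule R H"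
abbreviation "unit_elem \<equiv> inv_into UNIV HElem"

lemma unit_eq: "unit_obj = U.image_comodule"
  by (simp add: unit_comodule_def U.image_comodule_def H_s_def)

lemma elem_HElem [simp]: "unit_elem (HElem h) = h"
  by (rule inv_into_f_f) (simp_all add: inj_on_def)

lemma elem_incl:
  assumes "u \<in> carrier unit_obj"
  shows "unit_elem u = U.incl u"
proof -
  have "HElem (U.incl u) = u" using U.phi_incl[of u] assms by (simp add: unit_eq)
  from arg_cong[OF this, of unit_elem] show ?thesis by simp
qed

lemma right_comodule_unit: "right_comodule R H unit_obj"
  unfolding unit_eq by (rule U.right_comodule_A)

lemma semicomodule_unit [simp]: "semicomodule unit_obj"
  using right_comodule_unit unfolding right_comodule_iff by (rule conjunct1)

lemma colinear_elem: "colinear unit_obj (regular_comodule H) unit_elem"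
  using U.colinear_incl U.semicomodule_A elem_incl
  unfolding unit_eq by (rule colinear_cong)

lemma elem_closed [simp]: "u \<in> carrier unit_obj \<Longrightarrow> unit_elem u \<in> carrier H"
  using colinear_closed[OF colinear_elem, of u] by simp

lemma elem_linear: "linear_map R unit_obj H unit_elem"
  using colinear_linear[OF colinear_elem] by simp

lemma linear_elem [simp]: "linear_map R X unit_obj f \<Longrightarrow> linear_map R X H (\<lambda>x. unit_elem (f x))"
  by (rule linear_map_apply[OF elem_linear])

lemma elem_cases:
  assumes "u \<in> carrier unit_obj"
  obtains h where "h \<in> carrier H" "u = HElem (eps_s H h)" "unit_elem u = eps_s H h"
proof -
  from assms obtain h where "h \<in> carrier H" "u = HElem (eps_s H h)"
    unfolding unit_eq U.A_carrier by auto
  then show ?thesis using that elem_HElem by metis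
qed

lemma unit_retract_linear [simp]:
  "linear_map R X H f \<Longrightarrow> linear_map R X unit_obj (\<lambda>x. HElem (eps_s H (f x)))"
  using U.linear_retr[of X f] by (simp add: unit_eq)

lemma unit_retract_closed [simp]: "h \<in> carrier H \<Longrightarrow> HElem (eps_s H h) \<in> carrier unit_obj"
  using U.retr_closed[of h] by (simp add: unit_eq)

lemma unit_coact:
  assumes "u \<in> carrier unit_obj"
  shows "coact unit_obj u =
    sweedler H H (tensor R unit_obj H) (\<lambda>a b. pure R unit_obj H (HElem (eps_s H a)) b) (comult H (unit_elem u))"
  using U.A_coact[of u] assms elem_incl[OF assms] by (simp add: unit_eq)

text \<open>
  Sums over the coaction of the unit object are sums over the coproduct of \<open>H\<close>, because the
  inclusion into \<open>H\<close> is colinear.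
\<close>

lemma sweedler_unit_coact:
  assumes u: "u \<in> carrier unit_obj" and P: "module R P" "bilinear_map R H H P f"
  shows "sweedler unit_obj H P (\<lambda>a b. f (unit_elem a) b) (coact unit_obj u) =
    sweedler H H P f (comult H (unit_elem u))"
proof -
  have "comult H (unit_elem u) =
      sweedler unit_obj H (tensor R H H) (\<lambda>a b. pure R H H (unit_elem a) b) (coact unit_obj u)"
    using colinear_coact[OF semicomodule_unit colinear_elem u] by simp
  then show ?thesis using assms by (simp add: sweedler_sweedler del: bilinear_mapI')
qed

abbreviation "unit_one \<equiv> HElem \<one>\<^bsub>H\<^esub>"

lemma unit_one_closed [simp]: "unit_one \<in> carrier unit_obj"
  using unit_retract_closed[of "\<one>\<^bsub>H\<^esub>"] by (simp add: eps_s_one)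

section \<open>The unit constraints on the full tensor product\<close>

text \<open>
  The formulas for \<open>l\<close> and \<open>r\<close> on all of \<open>H\<^sub>s \<otimes> M\<close> and \<open>M \<otimes> H\<^sub>s\<close>. They are colinear there, and
  this implies that restricting them to the counital part loses nothing.
\<close>

definition left_unit_map where
  "left_unit_map M = sweedler unit_obj M M (\<lambda>u m.
    sweedler M H M (\<lambda>m0 m1. counit H (unit_elem u \<cdot> m1) \<odot>\<^bsub>M\<^esub> m0) (coact M m))"

definition right_unit_map where
  "right_unit_map M = sweedler M unit_obj M (\<lambda>m u.
    sweedler M H M (\<lambda>m0 m1. counit H (m1 \<cdot> unit_elem u) \<odot>\<^bsub>M\<^esub> m0) (coact M m))"

lemma left_unit_map_linear: "semicomodule M \<Longrightarrow> linear_map R (tensor R unit_obj M) M (left_unit_map M)"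
  and right_unit_map_linear: "semicomodule M \<Longrightarrow> linear_map R (tensor R M unit_obj) M (right_unit_map M)"
  by (simp_all add: left_unit_map_def right_unit_map_def sweedler_linear)

lemma left_unit_map_pure:
  "semicomodule M \<Longrightarrow> u \<in> carrier unit_obj \<Longrightarrow> m \<in> carrier M \<Longrightarrow>
    left_unit_map M (pure R unit_obj M u m) =
    sweedler M H M (\<lambda>m0 m1. counit H (unit_elem u \<cdot> m1) \<odot>\<^bsub>M\<^esub> m0) (coact M m)"
  by (simp add: left_unit_map_def)

lemma right_unit_map_pure:
  "semicomodule M \<Longrightarrow> u \<in> carrier unit_obj \<Longrightarrow> m \<in> carrier M \<Longrightarrow>
    right_unit_map M (pure R M unit_obj m u) =
    sweedler M H M (\<lambda>m0 m1. counit H (m1 \<cdot> unit_elem u) \<odot>\<^bsub>M\<^esub> m0) (coact M m)"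
  by (simp add: right_unit_map_def)

text \<open>
  On \<open>y \<otimes> m\<close> the left constraint has coaction \<open>m(0) \<otimes> y m(1)\<close>; the right one, on \<open>m \<otimes> y\<close>, has
  \<open>m(0) \<otimes> m(1) y\<close>. These two formulas carry the colinearity of the constraints, their
  invertibility and the triangle.
\<close>

lemma coact_left_unit_map:
  assumes M: "semicomodule M" and u: "u \<in> carrier unit_obj" and m: "m \<in> carrier M"
  shows "coact M (left_unit_map M (pure R unit_obj M u m)) =
    sweedler M H (tensor R M H) (\<lambda>m0 m1. pure R M H m0 (unit_elem u \<cdot> m1)) (coact M m)"
proof -
  obtain h where h: "h \<in> carrier H" "unit_elem u = eps_s H h" using u by (rule elem_cases)
  show ?thesis
    using coact_left_colinear[OF M m left_colinear_mult_left[OF h(1)]] by (simp add: left_unit_map_pure M u m h)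
qed

lemma coact_right_unit_map:
  assumes M: "semicomodule M" and u: "u \<in> carrier unit_obj" and m: "m \<in> carrier M"
  shows "coact M (right_unit_map M (pure R M unit_obj m u)) =
    sweedler M H (tensor R M H) (\<lambda>m0 m1. pure R M H m0 (m1 \<cdot> unit_elem u)) (coact M m)"
proof -
  obtain h where h: "h \<in> carrier H" "unit_elem u = eps_s H h" using u by (rule elem_cases)
  show ?thesis
    using coact_left_colinear[OF M m left_colinear_mult_right[OF h(1)]] by (simp add: right_unit_map_pure M u m h)
qed

text \<open>
  The value of \<open>(l \<otimes> id) \<rho>\<close> on \<open>y \<otimes> m\<close> is the sum of
  \<open>\<epsilon>(y(1) m(1)) m(0) \<otimes> y(2) m(2)\<close>, which the counit axiom for \<open>y m(1)\<close> reduces to \<open>m(0) \<otimes> y m(1)\<close>. The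
  operation \<open>J\<close> stands for the multiplication in either order, so that \<open>r\<close> is covered too.
\<close>

lemma unit_sum:
  assumes M: "semicomodule M" and m: "m \<in> carrier M" and u: "u \<in> carrier unit_obj"
    and J: "bilinear_map R H H H J"
    and comult_J: "\<And>y k. \<lbrakk>y \<in> carrier H; k \<in> carrier H\<rbrakk> \<Longrightarrow> comult H (J y k) =
      sweedler H H (tensor R H H) (\<lambda>a b. sweedler H H (tensor R H H)
        (\<lambda>c d. pure R H H (J a c) (J b d)) (comult H k)) (comult H y)"
  shows "sweedler unit_obj H (tensor R M H) (\<lambda>u0 u1. sweedler M H (tensor R M H) (\<lambda>m0 m1.
      pure R M H (sweedler M H M (\<lambda>a b. counit H (J (unit_elem u0) b) \<odot>\<^bsub>M\<^esub> a) (coact M m0)) (J u1 m1))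
        (coact M m)) (coact unit_obj u) =
    sweedler M H (tensor R M H) (\<lambda>m0 m1. pure R M H m0 (J (unit_elem u) m1)) (coact M m)"
proof -
  let ?P = "tensor R M H" and ?y = "unit_elem u"
  note [simp] = M m u linear_map_apply[OF bilinear_map_left[OF J]]
    linear_map_apply[OF bilinear_map_right[OF J]] bilinear_map_closed[OF J]
  have "sweedler unit_obj H ?P (\<lambda>u0 u1. sweedler M H ?P (\<lambda>m0 m1.
      pure R M H (sweedler M H M (\<lambda>a b. counit H (J (unit_elem u0) b) \<odot>\<^bsub>M\<^esub> a) (coact M m0)) (J u1 m1))
        (coact M m)) (coact unit_obj u) =
      sweedler unit_obj H ?P (\<lambda>u0 u1. sweedler M H ?P (\<lambda>m0 m1. sweedler M H ?P (\<lambda>a b.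
        counit H (J (unit_elem u0) b) \<odot>\<^bsub>?P\<^esub> pure R M H a (J u1 m1)) (coact M m0)) (coact M m))
        (coact unit_obj u)"
    by (simp add: pure_sweedler_left pure_smult_left)
  also have "\<dots> = sweedler unit_obj H ?P (\<lambda>u0 u1. sweedler M H ?P (\<lambda>m0 m1. sweedler H H ?P (\<lambda>b c.
        counit H (J (unit_elem u0) b) \<odot>\<^bsub>?P\<^esub> pure R M H m0 (J u1 c)) (comult H m1)) (coact M m))
        (coact unit_obj u)"
    by (rule sweedler_cong[OF HOL.refl], rule coassoc_sweedler) simp_all
  also have "\<dots> = sweedler H H ?P (\<lambda>u0 u1. sweedler M H ?P (\<lambda>m0 m1. sweedler H H ?P (\<lambda>b c.
        counit H (J u0 b) \<odot>\<^bsub>?P\<^esub> pure R M H m0 (J u1 c)) (comult H m1)) (coact M m)) (comult H ?y)"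
    by (rule sweedler_unit_coact) simp_all
  also have "\<dots> = sweedler M H ?P (\<lambda>m0 m1. sweedler H H ?P (\<lambda>u0 u1. sweedler H H ?P (\<lambda>b c.
        counit H (J u0 b) \<odot>\<^bsub>?P\<^esub> pure R M H m0 (J u1 c)) (comult H m1)) (comult H ?y)) (coact M m)"
    by (rule sweedler_swap) simp_all
  also have "\<dots> = sweedler M H ?P (\<lambda>m0 m1. sweedler H H ?P
        (\<lambda>a b. counit H a \<odot>\<^bsub>?P\<^esub> pure R M H m0 b) (comult H (J ?y m1))) (coact M m)"
    by (simp add: comult_J sweedler_sweedler)
  also have "\<dots> = sweedler M H ?P (\<lambda>m0 m1. pure R M H m0 (J ?y m1)) (coact M m)"
    by (simp add: counit_left_sweedler)
  finally show ?thesis .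
qed

lemma colinear_left_unit_map:
  assumes M: "semicomodule M"
  shows "colinear (unit_obj \<otimes>\<^sub>H M) M (left_unit_map M)"
proof (rule colinearI)
  note lin = left_unit_map_linear[OF M]
  note [simp] = M linear_map_apply[OF lin] linear_map_closed[OF lin]
  show "linear_map R (unit_obj \<otimes>\<^sub>H M) M (left_unit_map M)" using lin by simp
  let ?T = "tensor R unit_obj M" and ?P = "tensor R M H"
  let ?r = "\<lambda>t. sweedler ?T H ?P (\<lambda>a b. pure R M H (left_unit_map M a) b)
    (coact (unit_obj \<otimes>\<^sub>H M) t)"
  fix t assume "t \<in> carrier (unit_obj \<otimes>\<^sub>H M)"
  then have t: "t \<in> carrier ?T" by simp
  have "coact M (left_unit_map M t) = ?r t"
  proof (rule tensor_eqI[OF _ _ _ _ _ t, where P = ?P])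
    fix u m assume u: "u \<in> carrier unit_obj" and m: "m \<in> carrier M"
    note [simp] = u m
    have "?r (pure R unit_obj M u m) = sweedler unit_obj H ?P (\<lambda>u0 u1. sweedler M H ?P (\<lambda>m0 m1.
          pure R M H (sweedler M H M (\<lambda>a b. counit H (unit_elem u0 \<cdot> b) \<odot>\<^bsub>M\<^esub> a) (coact M m0)) (u1 \<cdot> m1))
          (coact M m)) (coact unit_obj u)"
      by (simp add: sweedler_sweedler left_unit_map_pure)
    also have "\<dots> = coact M (left_unit_map M (pure R unit_obj M u m))"
      unfolding coact_left_unit_map[OF M u m] by (rule unit_sum) (simp_all add: comult_mult_sweedler)
    finally show "coact M (left_unit_map M (pure R unit_obj M u m)) = ?r (pure R unit_obj M u m)" ..
  qed simp_all
  then show "coact M (left_unit_map M t) = sweedler (unit_obj \<otimes>\<^sub>H M) H ?P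
      (\<lambda>a b. pure R M H (left_unit_map M a) b) (coact (unit_obj \<otimes>\<^sub>H M) t)"
    by simp
qed (simp add: M)

lemma colinear_right_unit_map:
  assumes M: "semicomodule M"
  shows "colinear (M \<otimes>\<^sub>H unit_obj) M (right_unit_map M)"
proof (rule colinearI)
  note lin = right_unit_map_linear[OF M]
  note [simp] = M linear_map_apply[OF lin] linear_map_closed[OF lin]
  show "linear_map R (M \<otimes>\<^sub>H unit_obj) M (right_unit_map M)" using lin by simp
  let ?T = "tensor R M unit_obj" and ?P = "tensor R M H"
  let ?r = "\<lambda>t. sweedler ?T H ?P (\<lambda>a b. pure R M H (right_unit_map M a) b)
    (coact (M \<otimes>\<^sub>H unit_obj) t)"
  fix t assume "t \<in> carrier (M \<otimes>\<^sub>H unit_obj)"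
  then have t: "t \<in> carrier ?T" by simp
  have "coact M (right_unit_map M t) = ?r t"
  proof (rule tensor_eqI[OF _ _ _ _ _ t, where P = ?P])
    fix m u assume m: "m \<in> carrier M" and u: "u \<in> carrier unit_obj"
    note [simp] = u m
    have "?r (pure R M unit_obj m u) = sweedler M H ?P (\<lambda>m0 m1. sweedler unit_obj H ?P (\<lambda>u0 u1.
          pure R M H (sweedler M H M (\<lambda>a b. counit H (b \<cdot> unit_elem u0) \<odot>\<^bsub>M\<^esub> a) (coact M m0)) (m1 \<cdot> u1))
          (coact unit_obj u)) (coact M m)"
      by (simp add: sweedler_sweedler right_unit_map_pure)
    also have "\<dots> = sweedler unit_obj H ?P (\<lambda>u0 u1. sweedler M H ?P (\<lambda>m0 m1.
          pure R M H (sweedler M H M (\<lambda>a b. counit H (b \<cdot> unit_elem u0) \<odot>\<^bsub>M\<^esub> a) (coact M m0)) (m1 \<cdot> u1))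
          (coact M m)) (coact unit_obj u)"
      by (rule sweedler_swap) simp_all
    also have "\<dots> = coact M (right_unit_map M (pure R M unit_obj m u))"
      unfolding coact_right_unit_map[OF M u m]
      by (rule unit_sum[where J = "\<lambda>y k. k \<cdot> y"])
        (simp_all add: comult_mult_sweedler, rule sweedler_swap, simp_all)
    finally show "coact M (right_unit_map M (pure R M unit_obj m u)) = ?r (pure R M unit_obj m u)" ..
  qed simp_all
  then show "coact M (right_unit_map M t) = sweedler (M \<otimes>\<^sub>H unit_obj) H ?P
      (\<lambda>a b. pure R M H (right_unit_map M a) b) (coact (M \<otimes>\<^sub>H unit_obj) t)"
    by simp
qed (simp add: M)

lemma left_unit_map_one:
  assumes "right_comodule R H M" "m \<in> carrier M"
  shows "left_unit_map M (pure R unit_obj M unit_one m) = m"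
  using assms by (simp add: right_comodule_iff left_unit_map_pure)

lemma right_unit_map_one:
  assumes "right_comodule R H M" "m \<in> carrier M"
  shows "right_unit_map M (pure R M unit_obj m unit_one) = m"
  using assms by (simp add: right_comodule_iff right_unit_map_pure)

text \<open>
  Both \<open>1 \<otimes> l(y \<otimes> m)\<close> and \<open>y \<otimes> m\<close> have the coaction \<open>1(1) \<otimes> m(0) \<otimes> 1(2) y m(1)\<close>: the first
  by the coaction of \<open>l(y \<otimes> m)\<close>, the second by \<open>\<Delta>(y) = 1(1) \<otimes> 1(2) y\<close>. Hence they have the
  same counital part, and \<open>m \<mapsto> 1 \<otimes> m\<close> induces the inverse of \<open>l\<close>. For \<open>r\<close> the formula
  \<open>\<Delta>(y) = 1(1) \<otimes> y 1(2)\<close> plays this part.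
\<close>

lemma counital_part_left_unit:
  assumes M: "semicomodule M" and t: "t \<in> carrier (tensor R unit_obj M)"
  shows "counital_part (unit_obj \<otimes>\<^sub>H M) (pure R unit_obj M unit_one (left_unit_map M t)) =
    counital_part (unit_obj \<otimes>\<^sub>H M) t"
proof -
  let ?T = "tensor R unit_obj M"
  note lin = left_unit_map_linear[OF M]
  have linp: "linear_map R ?T ?T (counital_part (unit_obj \<otimes>\<^sub>H M))"
    using counital_part_linear[OF semicomodule_tensor[OF semicomodule_unit M]] by simp
  note [simp] = M linear_map_apply[OF lin] linear_map_closed[OF lin] linear_map_apply[OF linp]
  show ?thesis
  proof (rule tensor_eqI[OF _ _ _ _ _ t, where P = ?T])
    fix u m assume u [simp]: "u \<in> carrier unit_obj" and [simp]: "m \<in> carrier M"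
    obtain h where h: "h \<in> carrier H" "unit_elem u = eps_s H h" using u by (rule elem_cases)
    show "counital_part (unit_obj \<otimes>\<^sub>H M)
        (pure R unit_obj M unit_one (left_unit_map M (pure R unit_obj M u m))) =
      counital_part (unit_obj \<otimes>\<^sub>H M) (pure R unit_obj M u m)"
      by (simp add: counital_part_pure coact_left_unit_map unit_coact h sweedler_sweedler
          comult_eps_s_left mult_assoc)
  qed simp_all
qed

lemma counital_part_right_unit:
  assumes M: "semicomodule M" and t: "t \<in> carrier (tensor R M unit_obj)"
  shows "counital_part (M \<otimes>\<^sub>H unit_obj) (pure R M unit_obj (right_unit_map M t) unit_one) =
    counital_part (M \<otimes>\<^sub>H unit_obj) t"
proof -
  let ?T = "tensor R M unit_obj"
  note lin = right_unit_map_linear[OF M]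
  have linp: "linear_map R ?T ?T (counital_part (M \<otimes>\<^sub>H unit_obj))"
    using counital_part_linear[OF semicomodule_tensor[OF M semicomodule_unit]] by simp
  note [simp] = M linear_map_apply[OF lin] linear_map_closed[OF lin] linear_map_apply[OF linp]
  show ?thesis
  proof (rule tensor_eqI[OF _ _ _ _ _ t, where P = ?T])
    fix m u assume [simp]: "m \<in> carrier M" and u [simp]: "u \<in> carrier unit_obj"
    obtain h where h: "h \<in> carrier H" "unit_elem u = eps_s H h" using u by (rule elem_cases)
    show "counital_part (M \<otimes>\<^sub>H unit_obj)
        (pure R M unit_obj (right_unit_map M (pure R M unit_obj m u)) unit_one) =
      counital_part (M \<otimes>\<^sub>H unit_obj) (pure R M unit_obj m u)"
      by (simp add: counital_part_pure coact_right_unit_map unit_coact h sweedler_sweedler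
          comult_eps_s_right mult_assoc)
  qed simp_all
qed

text \<open>
  On \<open>(m \<otimes> y) \<otimes> n\<close> both sides are the sum of \<open>\<epsilon>(m(1) y n(1)) m(0) \<otimes> n(0)\<close>.
\<close>

lemma counital_part_triangle:
  assumes M: "semicomodule M" and N: "semicomodule N"
    and t: "t \<in> carrier (tensor R (tensor R M unit_obj) N)"
  shows "counital_part (M \<otimes>\<^sub>H N) (tensor_map R M N (\<lambda>m. m) (left_unit_map N)
      (tensor_assoc R M unit_obj N t)) =
    counital_part (M \<otimes>\<^sub>H N) (tensor_map R M N (right_unit_map M) (\<lambda>n. n) t)"
proof -
  let ?T = "tensor R M N"
  note linl = left_unit_map_linear[OF N] and linr = right_unit_map_linear[OF M]
  have linp: "linear_map R ?T ?T (counital_part (M \<otimes>\<^sub>H N))"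
    using counital_part_linear[OF semicomodule_tensor[OF M N]] by simp
  have lina: "linear_map R (tensor R (tensor R M unit_obj) N) (tensor R M (tensor R unit_obj N))
      (tensor_assoc R M unit_obj N)"
    by (rule tensor_assoc_linear) (simp_all add: M N)
  have linL: "linear_map R (tensor R M (tensor R unit_obj N)) ?T (tensor_map R M N (\<lambda>m. m) (left_unit_map N))"
    by (rule tensor_map_linear) (simp_all add: M N linl)
  have linR: "linear_map R (tensor R (tensor R M unit_obj) N) ?T (tensor_map R M N (right_unit_map M) (\<lambda>n. n))"
    by (rule tensor_map_linear) (simp_all add: M N linr)
  note [simp] = M N linear_map_apply[OF linl] linear_map_closed[OF linl] linear_map_apply[OF linr]
    linear_map_closed[OF linr] linear_map_apply[OF linp] linear_map_apply[OF lina]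
    linear_map_apply[OF linL] linear_map_apply[OF linR]
  show ?thesis
    by (rule tensor3_eqI[OF _ _ _ _ _ _ _ t, where Q = ?T])
      (simp_all add: tensor_assoc_pure tensor_map_pure[of M "tensor R unit_obj N"]
        tensor_map_pure[of "tensor R M unit_obj" N] linl linr counital_part_pure
        coact_left_unit_map coact_right_unit_map sweedler_sweedler mult_assoc)
qed

lemma left_unit_map_natural:
  assumes M: "semicomodule M" and N: "semicomodule N" and f: "colinear M N f"
    and t: "t \<in> carrier (tensor R unit_obj M)"
  shows "left_unit_map N (tensor_map R unit_obj N (\<lambda>u. u) f t) = f (left_unit_map M t)"
proof -
  note lf = colinear_linear[OF f] and lM = left_unit_map_linear[OF M] and lN = left_unit_map_linear[OF N]
  have lt: "linear_map R (tensor R unit_obj M) (tensor R unit_obj N) (tensor_map R unit_obj N (\<lambda>u. u) f)"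
    by (rule tensor_map_linear) (simp_all add: M N lf)
  show ?thesis
  proof (rule tensor_eqI[OF _ _ linear_map_compose[OF lt lN] linear_map_compose[OF lM lf] _ t])
    fix u m assume [simp]: "u \<in> carrier unit_obj" "m \<in> carrier M"
    have "f (left_unit_map M (pure R unit_obj M u m)) =
        sweedler M H N (\<lambda>m0 m1. f (counit H (unit_elem u \<cdot> m1) \<odot>\<^bsub>M\<^esub> m0)) (coact M m)"
      by (simp add: left_unit_map_pure M, rule linear_sweedler[OF _ _ _ _ lf]) (simp_all add: M N)
    then show "left_unit_map N (tensor_map R unit_obj N (\<lambda>u. u) f (pure R unit_obj M u m)) =
        f (left_unit_map M (pure R unit_obj M u m))"
      by (simp add: tensor_map_pure[of unit_obj M] M N lf left_unit_map_pure linear_map_closed[OF lf]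
          linear_map_apply[OF lf] linear_map_smult[OF lf] colinear_coact[OF M f] sweedler_sweedler)
  qed (simp_all add: M)
qed

lemma right_unit_map_natural:
  assumes M: "semicomodule M" and N: "semicomodule N" and f: "colinear M N f"
    and t: "t \<in> carrier (tensor R M unit_obj)"
  shows "right_unit_map N (tensor_map R N unit_obj f (\<lambda>u. u) t) = f (right_unit_map M t)"
proof -
  note lf = colinear_linear[OF f] and lM = right_unit_map_linear[OF M] and lN = right_unit_map_linear[OF N]
  have lt: "linear_map R (tensor R M unit_obj) (tensor R N unit_obj) (tensor_map R N unit_obj f (\<lambda>u. u))"
    by (rule tensor_map_linear) (simp_all add: M N lf)
  show ?thesis
  proof (rule tensor_eqI[OF _ _ linear_map_compose[OF lt lN] linear_map_compose[OF lM lf] _ t])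
    fix m u assume [simp]: "m \<in> carrier M" "u \<in> carrier unit_obj"
    have "f (right_unit_map M (pure R M unit_obj m u)) =
        sweedler M H N (\<lambda>m0 m1. f (counit H (m1 \<cdot> unit_elem u) \<odot>\<^bsub>M\<^esub> m0)) (coact M m)"
      by (simp add: right_unit_map_pure M, rule linear_sweedler[OF _ _ _ _ lf]) (simp_all add: M N)
    then show "right_unit_map N (tensor_map R N unit_obj f (\<lambda>u. u) (pure R M unit_obj m u)) =
        f (right_unit_map M (pure R M unit_obj m u))"
      by (simp add: tensor_map_pure[of M unit_obj] M N lf right_unit_map_pure linear_map_closed[OF lf]
          linear_map_apply[OF lf] linear_map_smult[OF lf] colinear_coact[OF M f] sweedler_sweedler)
  qed (simp_all add: M)
qed

end

section \<open>Counital tensor products of colinear maps\<close>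

context prebialgebra
begin

lemma right_comodule_semicomodule [simp]: "right_comodule R H M \<Longrightarrow> semicomodule M"
  by (simp add: right_comodule_iff)

lemma counital_part_comodule: "right_comodule R H M \<Longrightarrow> m \<in> carrier M \<Longrightarrow> counital_part M m = m"
  unfolding right_comodule_iff counital_part_def by blast

lemma semicomodule_boxtimes [simp]:
  "semicomodule M \<Longrightarrow> semicomodule N \<Longrightarrow> semicomodule (M \<boxtimes> N)"
  by (rule right_comodule_semicomodule[OF right_comodule_boxtimes])

lemma colinear_inverse:
  assumes M: "semicomodule M" and N: "semicomodule N" and f: "colinear M N f"
    and closed: "\<And>y. y \<in> carrier N \<Longrightarrow> g y \<in> carrier M"
    and gf: "\<And>x. x \<in> carrier M \<Longrightarrow> g (f x) = x"
    and fg: "\<And>y. y \<in> carrier N \<Longrightarrow> f (g y) = y"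
  shows "colinear N M g"
proof (rule colinearI[OF N])
  note lf = colinear_linear[OF f]
  interpret M: module R M using M by simp
  show lg: "linear_map R N M g"
  proof (rule linear_mapI)
    fix x assume x: "x \<in> carrier N"
    then show "g x \<in> carrier M" by (rule closed)
    fix y assume y: "y \<in> carrier N"
    have "g (x \<oplus>\<^bsub>N\<^esub> y) = g (f (g x \<oplus>\<^bsub>M\<^esub> g y))"
      using x y by (simp add: linear_map_add[OF lf] closed fg)
    then show "g (x \<oplus>\<^bsub>N\<^esub> y) = g x \<oplus>\<^bsub>M\<^esub> g y" using x y by (simp add: gf closed)
  next
    fix r x assume r: "r \<in> carrier R" and x: "x \<in> carrier N"
    have "g (r \<odot>\<^bsub>N\<^esub> x) = g (f (r \<odot>\<^bsub>M\<^esub> g x))"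
      using x r by (simp add: linear_map_smult[OF lf] closed fg)
    then show "g (r \<odot>\<^bsub>N\<^esub> x) = r \<odot>\<^bsub>M\<^esub> g x" using x r by (simp add: gf closed)
  qed
  fix y assume y: "y \<in> carrier N"
  have "coact N y = sweedler M H (tensor R N H) (\<lambda>a b. pure R N H (f a) b) (coact M (g y))"
    using colinear_coact[OF M f closed[OF y]] by (simp add: fg y)
  then show "coact M (g y) = sweedler N H (tensor R M H) (\<lambda>a b. pure R M H (g a) b) (coact N y)"
    by (simp add: sweedler_sweedler M N y closed linear_map_closed[OF lf] linear_map_apply[OF lg] gf)
qed

lemma decode_closed [simp]:
  "semicomodule M \<Longrightarrow> semicomodule N \<Longrightarrow> x \<in> carrier (M \<boxtimes> N) \<Longrightarrow>
    decode R M N x \<in> carrier (tensor R M N)"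
  using colinear_closed[OF colinear_decode, of M N x] by simp

lemma corestrict_closed [simp]:
  "semicomodule M \<Longrightarrow> semicomodule N \<Longrightarrow> t \<in> carrier (tensor R M N) \<Longrightarrow>
    corestrict M N t \<in> carrier (M \<boxtimes> N)"
  using colinear_closed[OF colinear_corestrict, of M N t] by simp

text \<open>
  \<open>f \<otimes> g\<close> is colinear, so it commutes with the counital parts and maps \<open>M \<otimes>\<^sup>r N\<close> into
  \<open>M' \<otimes>\<^sup>r N'\<close>; the projection onto \<open>M' \<otimes>\<^sup>r N'\<close> on the right hand side does nothing, but makes
  colinearity evident.
\<close>

lemma boxtimes_map_eq:
  assumes M: "semicomodule M" "semicomodule M'" and N: "semicomodule N" "semicomodule N'"
    and f: "colinear M M' f" and g: "colinear N N' g" and x: "x \<in> carrier (M \<boxtimes> N)"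
  shows "boxtimes_map R H M M' N N' f g x = corestrict M' N' (tensor_map R M' N' f g (decode R M N x))"
proof -
  have "counital_part (M' \<otimes>\<^sub>H N') (tensor_map R M' N' f g (decode R M N x)) =
      tensor_map R M' N' f g (counital_part (M \<otimes>\<^sub>H N) (decode R M N x))"
    by (rule counital_part_natural) (simp_all add: colinear_tensor_map M N f g x)
  then show ?thesis
    using x by (simp add: boxtimes_map_def corestrict_def counital_part_decode M N)
qed

lemma boxtimes_map_colinear:
  assumes M: "semicomodule M" "semicomodule M'" and N: "semicomodule N" "semicomodule N'"
    and f: "colinear M M' f" and g: "colinear N N' g"
  shows "colinear (M \<boxtimes> N) (M' \<boxtimes> N') (boxtimes_map R H M M' N N' f g)"
proof (rule colinear_cong)
  show "colinear (M \<boxtimes> N) (M' \<boxtimes> N')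
      (\<lambda>x. corestrict M' N' (tensor_map R M' N' f g (decode R M N x)))"
    by (rule colinear_compose[OF _ _ _ colinear_compose[OF _ _ _ colinear_decode colinear_tensor_map]
        colinear_corestrict]) (simp_all add: M N f g)
qed (simp_all add: boxtimes_map_eq assms)

lemma boxtimes_map_closed:
  assumes "semicomodule M" "semicomodule M'" "semicomodule N" "semicomodule N'"
    and "colinear M M' f" "colinear N N' g" "x \<in> carrier (M \<boxtimes> N)"
  shows "boxtimes_map R H M M' N N' f g x \<in> carrier (M' \<boxtimes> N')"
  by (rule colinear_closed[OF boxtimes_map_colinear[OF assms(1-6)] assms(7)])

lemma decode_boxtimes_map:
  assumes M: "semicomodule M" "semicomodule M'" and N: "semicomodule N" "semicomodule N'"
    and f: "colinear M M' f" and g: "colinear N N' g" and x: "x \<in> carrier (M \<boxtimes> N)"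
  shows "decode R M' N' (boxtimes_map R H M M' N N' f g x) = tensor_map R M' N' f g (decode R M N x)"
proof -
  have t: "tensor_map R M' N' f g (decode R M N x) \<in> carrier (tensor R M' N')"
    using colinear_closed[OF colinear_tensor_map[OF assms(1-6)], of "decode R M N x"] assms by simp
  have "counital_part (M' \<otimes>\<^sub>H N') (tensor_map R M' N' f g (decode R M N x)) =
      tensor_map R M' N' f g (counital_part (M \<otimes>\<^sub>H N) (decode R M N x))"
    by (rule counital_part_natural) (simp_all add: colinear_tensor_map M N f g x)
  then show ?thesis
    by (simp add: boxtimes_map_eq assms decode_corestrict t counital_part_decode)
qed

section \<open>Iterated products and the associativity constraint\<close>

text \<open>
  A comodule \<open>A\<close> presented, through \<open>i\<close>, as the counital part of a comodule \<open>T\<close> without counit.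
  Every iterated product is presented in this way by the corresponding iterated tensor product of
  modules. As \<open>i\<close> is injective, arrows between products are determined by the maps between full
  tensor products that they are restrictions of, and identities between them are inherited from
  there.
\<close>

definition counital_embedding :: "('k, 'h, 'm) comodule \<Rightarrow> ('k, 'h, 'n) comodule \<Rightarrow> ('m \<Rightarrow> 'n) \<Rightarrow> bool"
  where "counital_embedding A T i \<longleftrightarrow> semicomodule A \<and> semicomodule T \<and> colinear A T i \<and>
    (\<exists>q. colinear T A q \<and> (\<forall>x\<in>carrier A. q (i x) = x) \<and>
      (\<forall>t\<in>carrier T. i (q t) = counital_part T t))"

lemma counital_embedding_source [simp]: "counital_embedding A T i \<Longrightarrow> semicomodule A"
  and counital_embedding_target: "counital_embedding A T i \<Longrightarrow> semicomodule T"
  and counital_embedding_colinear: "counital_embedding A T i \<Longrightarrow> colinear A T i"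
  by (simp_all add: counital_embedding_def)

lemma counital_embedding_closed:
  "counital_embedding A T i \<Longrightarrow> x \<in> carrier A \<Longrightarrow> i x \<in> carrier T"
  by (rule colinear_closed[OF counital_embedding_colinear])

lemma counital_embedding_inject:
  assumes "counital_embedding A T i" and x: "x \<in> carrier A" and y: "y \<in> carrier A" and eq: "i x = i y"
  shows "x = y"
proof -
  obtain q where q: "\<And>x. x \<in> carrier A \<Longrightarrow> q (i x) = x" using assms(1) unfolding counital_embedding_def by blast
  have "x = q (i x)" by (rule q[OF x, symmetric])
  also have "\<dots> = y" unfolding eq by (rule q[OF y])
  finally show ?thesis .
qed

lemma counital_part_embedding:
  assumes "counital_embedding A T i" and x: "x \<in> carrier A"
  shows "counital_part T (i x) = i x"
proof -
  obtain q where q: "\<And>x. x \<in> carrier A \<Longrightarrow> q (i x) = x" "\<And>t. t \<in> carrier T \<Longrightarrow> i (q t) = counital_part T t"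
    using assms(1) unfolding counital_embedding_def by blast
  show ?thesis
    using q(2)[of "i x"] counital_embedding_closed[OF assms] by (simp add: q(1)[OF x])
qed

lemma counital_embedding_id:
  "right_comodule R H M \<Longrightarrow> counital_embedding M M (\<lambda>m. m)"
  unfolding counital_embedding_def
  by (intro conjI exI[of _ "\<lambda>m. m"]) (simp_all add: colinear_id counital_part_comodule)

text \<open>
  The embedding of \<open>A \<otimes>\<^sup>r B\<close> into \<open>T \<otimes> S\<close> made from embeddings of the factors. Its retraction
  projects the factors and then takes the counital part.
\<close>

definition tensor_embed where
  "tensor_embed A B T S i j x = tensor_map R T S i j (decode R A B x)"

lemma counital_embedding_boxtimes:
  fixes A B :: "('k, 'h, 'a) ucomodule"
  assumes A: "counital_embedding A T i" and B: "counital_embedding B S j"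
  shows "counital_embedding (A \<boxtimes> B) (T \<otimes>\<^sub>H S) (tensor_embed A B T S i j)"
proof -
  obtain q where q: "colinear T A q" "\<And>x. x \<in> carrier A \<Longrightarrow> q (i x) = x"
    "\<And>t. t \<in> carrier T \<Longrightarrow> i (q t) = counital_part T t" using A unfolding counital_embedding_def by blast
  obtain r where r: "colinear S B r" "\<And>x. x \<in> carrier B \<Longrightarrow> r (j x) = x"
    "\<And>t. t \<in> carrier S \<Longrightarrow> j (r t) = counital_part S t" using B unfolding counital_embedding_def by blast
  note [simp] = counital_embedding_source[OF A] counital_embedding_source[OF B]
    counital_embedding_target[OF A] counital_embedding_target[OF B]
  note i = counital_embedding_colinear[OF A] and j = counital_embedding_colinear[OF B]
  note lin = i[THEN colinear_linear] j[THEN colinear_linear] q(1)[THEN colinear_linear]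
    r(1)[THEN colinear_linear]
  let ?e = "tensor_map R T S i j" and ?q = "tensor_map R A B q r"
  have e: "colinear (A \<otimes>\<^sub>H B) (T \<otimes>\<^sub>H S) ?e"
    by (rule colinear_tensor_map) (simp_all add: i j)
  have ce: "colinear (A \<boxtimes> B) (T \<otimes>\<^sub>H S) (tensor_embed A B T S i j)"
    unfolding tensor_embed_def[abs_def] by (rule colinear_compose[OF _ _ _ colinear_decode e]) simp_all
  have cq: "colinear (T \<otimes>\<^sub>H S) (A \<boxtimes> B) (\<lambda>t. corestrict A B (?q t))"
    by (rule colinear_compose[OF _ _ _ colinear_tensor_map colinear_corestrict]) (simp_all add: q r)
  have qe: "corestrict A B (?q (tensor_embed A B T S i j x)) = x" if x: "x \<in> carrier (A \<boxtimes> B)" for x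
  proof -
    have "?q (tensor_embed A B T S i j x) = tensor_map R A B (\<lambda>a. q (i a)) (\<lambda>b. r (j b)) (decode R A B x)"
      unfolding tensor_embed_def by (rule tensor_map_compose[OF _ _ _ _ _ _ lin]) (simp_all add: x)
    also have "\<dots> = decode R A B x"
      by (rule tensor_map_id) (simp_all add: x q(2) r(2))
    finally show ?thesis by (simp add: x corestrict_decode)
  qed
  have eq: "tensor_embed A B T S i j (corestrict A B (?q t)) = counital_part (T \<otimes>\<^sub>H S) t"
    if t: "t \<in> carrier (tensor R T S)" for t
  proof -
    have qt: "?q t \<in> carrier (tensor R A B)"
      by (rule tensor_map_closed[OF _ _ _ _ lin(3,4)]) (simp_all add: t)
    have "tensor_embed A B T S i j (corestrict A B (?q t)) =
        counital_part (T \<otimes>\<^sub>H S) (?e (?q t))"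
      unfolding tensor_embed_def decode_corestrict[OF counital_embedding_source[OF A] counital_embedding_source[OF B] qt]
      by (rule counital_part_natural[OF _ _ e, symmetric]) (simp_all add: qt)
    also have "?e (?q t) = tensor_map R T S (\<lambda>s. i (q s)) (\<lambda>s. j (r s)) t"
      by (rule tensor_map_compose[OF _ _ _ _ _ _ lin(3,4,1,2)]) (simp_all add: t)
    also have "\<dots> = tensor_map R T S (counital_part T) (counital_part S) t"
      by (rule tensor_map_cong[of T S]) (simp_all add: t q(3) r(3))
    also have "counital_part (T \<otimes>\<^sub>H S) \<dots> = counital_part (T \<otimes>\<^sub>H S) t"
      by (rule counital_part_tensor) (simp_all add: t)
    finally show ?thesis .
  qed
  show ?thesis
    unfolding counital_embedding_def
    by (intro conjI exI[of _ "\<lambda>t. corestrict A B (?q t)"] ballI) (simp_all add: ce cq qe eq)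
qed

text \<open>
  Colinear maps preserve counital parts, hence restrict to the comodules presented by them.
\<close>

lemma counital_embedding_lift:
  assumes A: "counital_embedding A T i" and B: "counital_embedding B S j" and F: "colinear T S F"
  obtains f where "colinear A B f" "\<And>x. x \<in> carrier A \<Longrightarrow> j (f x) = F (i x)"
proof -
  obtain q where q: "colinear S B q" "\<And>t. t \<in> carrier S \<Longrightarrow> j (q t) = counital_part S t"
    using B unfolding counital_embedding_def by blast
  note s = counital_embedding_source[OF A] counital_embedding_target[OF A]
    counital_embedding_target[OF B] counital_embedding_source[OF B]
  have "colinear A B (\<lambda>x. q (F (i x)))"
    by (rule colinear_compose[OF s(1,3,4)
        colinear_compose[OF s(1-3) counital_embedding_colinear[OF A] F] q(1)])
  moreover have "j (q (F (i x))) = F (i x)" if x: "x \<in> carrier A" for x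
    using counital_embedding_closed[OF A x] counital_part_natural[OF s(2,3) F]
      counital_part_embedding[OF A x] by (simp add: q(2) colinear_closed[OF F])
  ultimately show ?thesis by (rule that)
qed

text \<open>
  If \<open>f\<close> and \<open>g\<close> are restrictions of \<open>F\<close> and \<open>G\<close>, then their product is a restriction of
  \<open>F \<otimes> G\<close>. Together with \<open>embed_assoc_constraint\<close> below this translates any composite of
  products and associativity constraints into the same composite for modules.
\<close>

lemma embed_boxtimes_map:
  assumes A: "counital_embedding A T i" "counital_embedding A' T' i'"
    and B: "counital_embedding B S j" "counital_embedding B' S' j'"
    and f: "colinear A A' f" and F: "linear_map R T T' F" "\<And>x. x \<in> carrier A \<Longrightarrow> i' (f x) = F (i x)"
    and g: "colinear B B' g" and G: "linear_map R S S' G" "\<And>x. x \<in> carrier B \<Longrightarrow> j' (g x) = G (j x)"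
    and x: "x \<in> carrier (A \<boxtimes> B)"
  shows "tensor_embed A' B' T' S' i' j' (boxtimes_map R H A A' B B' f g x) =
    tensor_map R T' S' F G (tensor_embed A B T S i j x)"
proof -
  note [simp] = A[THEN counital_embedding_source] B[THEN counital_embedding_source]
    A[THEN counital_embedding_target] B[THEN counital_embedding_target]
  note lin = A[THEN counital_embedding_colinear, THEN colinear_linear]
    B[THEN counital_embedding_colinear, THEN colinear_linear]
  have "tensor_embed A' B' T' S' i' j' (boxtimes_map R H A A' B B' f g x) =
      tensor_map R T' S' i' j' (tensor_map R A' B' f g (decode R A B x))"
    by (simp add: tensor_embed_def decode_boxtimes_map f g x)
  also have "\<dots> = tensor_map R T' S' (\<lambda>a. i' (f a)) (\<lambda>b. j' (g b)) (decode R A B x)"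
    by (rule tensor_map_compose[OF _ _ _ _ _ _ colinear_linear[OF f] colinear_linear[OF g] lin(2,4)])
      (simp_all add: x)
  also have "\<dots> = tensor_map R T' S' (\<lambda>a. F (i a)) (\<lambda>b. G (j b)) (decode R A B x)"
    by (rule tensor_map_cong[of A B]) (simp_all add: x F(2) G(2))
  also have "\<dots> = tensor_map R T' S' F G (tensor_embed A B T S i j x)"
    unfolding tensor_embed_def
    by (rule tensor_map_compose[OF _ _ _ _ _ _ lin(1,3) F(1) G(1), symmetric]) (simp_all add: x)
  finally show ?thesis .
qed

lemma colinear_tensor_unassoc:
  assumes "semicomodule M" "semicomodule N" "semicomodule P"
  shows "colinear (M \<otimes>\<^sub>H (N \<otimes>\<^sub>H P))
    ((M \<otimes>\<^sub>H N) \<otimes>\<^sub>H P) (tensor_unassoc M N P)"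
  by (rule colinear_inverse[OF _ _ colinear_tensor_assoc[OF assms]])
    (simp_all add: assms tensor_unassoc_assoc tensor_assoc_unassoc)

context
  fixes M N P :: "('k, 'h, 'a) ucomodule"
  assumes M: "right_comodule R H M" and N: "right_comodule R H N" and P: "right_comodule R H P"
begin

abbreviation "embed_left \<equiv> tensor_embed (M \<boxtimes> N) P (M \<otimes>\<^sub>H N) P
  (tensor_embed M N M N (\<lambda>m. m) (\<lambda>n. n)) (\<lambda>p. p)"
abbreviation "embed_right \<equiv> tensor_embed M (N \<boxtimes> P) M (N \<otimes>\<^sub>H P)
  (\<lambda>m. m) (tensor_embed N P N P (\<lambda>n. n) (\<lambda>p. p))"

lemma embedding_left: "counital_embedding ((M \<boxtimes> N) \<boxtimes> P)
    ((M \<otimes>\<^sub>H N) \<otimes>\<^sub>H P) embed_left"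
  and embedding_right: "counital_embedding (M \<boxtimes> (N \<boxtimes> P))
    (M \<otimes>\<^sub>H (N \<otimes>\<^sub>H P)) embed_right"
  by (intro counital_embedding_boxtimes counital_embedding_id M N P)+

text \<open>
  The maps in the definition of the associativity constraint are embeddings of threefold products,
  up to factors \<open>id \<otimes> id\<close>.
\<close>

lemma assoc_constraint_THE:
  assumes x: "x \<in> carrier ((M \<boxtimes> N) \<boxtimes> P)"
  shows "assoc_constraint R H M N P x = (THE y. y \<in> carrier (M \<boxtimes> (N \<boxtimes> P)) \<and>
    embed_right y = tensor_assoc R M N P (embed_left x))"
proof -
  note [simp] = M N P
  have "embed_left x = tensor_map R (tensor R M N) P (decode R M N) (\<lambda>p. p) (decode R (M \<boxtimes> N) P x)"
    unfolding tensor_embed_def using x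
    by (simp, intro tensor_map_cong[of "M \<boxtimes> N" P]) (simp_all add: tensor_embed_def tensor_map_id)
  moreover have "embed_right y = tensor_map R M (tensor R N P) (\<lambda>m. m) (decode R N P) (decode R M (N \<boxtimes> P) y)"
    if "y \<in> carrier (M \<boxtimes> (N \<boxtimes> P))" for y
    unfolding tensor_embed_def using that
    by (simp, intro tensor_map_cong[of M "N \<boxtimes> P"]) (simp_all add: tensor_embed_def tensor_map_id)
  ultimately show ?thesis
    using x by (simp add: assoc_constraint_def cong: conj_cong)
qed

lemma assoc_constraint_eqI:
  assumes "x \<in> carrier ((M \<boxtimes> N) \<boxtimes> P)" "y \<in> carrier (M \<boxtimes> (N \<boxtimes> P))"
    and "embed_right y = tensor_assoc R M N P (embed_left x)"
  shows "assoc_constraint R H M N P x = y"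
  unfolding assoc_constraint_THE[OF assms(1)]
  using assms(2,3) by (intro the_equality conjI counital_embedding_inject[OF embedding_right]) simp_all

text \<open>
  The associativity map of modules and its inverse are both colinear, so both restrict to the
  threefold products, and the restrictions are inverse to each other by injectivity of the
  embeddings.
\<close>

lemma assoc_constraint_iso:
  "colinear ((M \<boxtimes> N) \<boxtimes> P) (M \<boxtimes> (N \<boxtimes> P))
      (assoc_constraint R H M N P) \<and>
    (\<forall>x\<in>carrier ((M \<boxtimes> N) \<boxtimes> P).
      embed_right (assoc_constraint R H M N P x) = tensor_assoc R M N P (embed_left x)) \<and>
    (\<exists>g. (\<forall>y\<in>carrier (M \<boxtimes> (N \<boxtimes> P)).
        g y \<in> carrier ((M \<boxtimes> N) \<boxtimes> P) \<and> assoc_constraint R H M N P (g y) = y) \<and>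
      (\<forall>x\<in>carrier ((M \<boxtimes> N) \<boxtimes> P). g (assoc_constraint R H M N P x) = x))"
proof -
  note [simp] = M N P
  let ?A = "(M \<boxtimes> N) \<boxtimes> P" and ?B = "M \<boxtimes> (N \<boxtimes> P)"
  obtain f where f: "colinear ?A ?B f"
    "\<And>x. x \<in> carrier ?A \<Longrightarrow> embed_right (f x) = tensor_assoc R M N P (embed_left x)"
    by (rule counital_embedding_lift[OF embedding_left embedding_right colinear_tensor_assoc])
      simp_all
  obtain g where g: "colinear ?B ?A g"
    "\<And>y. y \<in> carrier ?B \<Longrightarrow> embed_left (g y) = tensor_unassoc M N P (embed_right y)"
    by (rule counital_embedding_lift[OF embedding_right embedding_left colinear_tensor_unassoc])
      simp_all
  have a: "assoc_constraint R H M N P x = f x" if x: "x \<in> carrier ?A" for x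
    by (rule assoc_constraint_eqI[OF x colinear_closed[OF f(1) x] f(2)[OF x]])
  have l: "embed_left x \<in> carrier (tensor R (tensor R M N) P)" if "x \<in> carrier ?A" for x
    using counital_embedding_closed[OF embedding_left that] by simp
  have r: "embed_right y \<in> carrier (tensor R M (tensor R N P))" if "y \<in> carrier ?B" for y
    using counital_embedding_closed[OF embedding_right that] by simp
  have gf: "g (f x) = x" if x: "x \<in> carrier ?A" for x
    by (rule counital_embedding_inject[OF embedding_left])
      (simp_all add: x colinear_closed[OF f(1)] colinear_closed[OF g(1)] f(2) g(2) tensor_unassoc_assoc l)
  have fg: "f (g y) = y" if y: "y \<in> carrier ?B" for y
    by (rule counital_embedding_inject[OF embedding_right])
      (simp_all add: y colinear_closed[OF f(1)] colinear_closed[OF g(1)] f(2) g(2) tensor_assoc_unassoc r)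
  have "colinear ?A ?B (assoc_constraint R H M N P)"
    by (rule colinear_cong[OF f(1) _ a]) simp_all
  then show ?thesis
    by (intro conjI exI[of _ g] ballI)
      (simp_all add: a f(2) gf fg colinear_closed[OF f(1)] colinear_closed[OF g(1)])
qed

lemma colinear_assoc_constraint: "colinear ((M \<boxtimes> N) \<boxtimes> P)
    (M \<boxtimes> (N \<boxtimes> P)) (assoc_constraint R H M N P)"
  by (rule conjunct1[OF assoc_constraint_iso])

lemma assoc_constraint_closed [simp]:
  "x \<in> carrier ((M \<boxtimes> N) \<boxtimes> P) \<Longrightarrow>
    assoc_constraint R H M N P x \<in> carrier (M \<boxtimes> (N \<boxtimes> P))"
  by (rule colinear_closed[OF colinear_assoc_constraint])

text \<open>
  The constraint is a restriction of the associativity map not only for the tensor products of its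
  own arguments, but also when these are embedded further; naturality of the associativity map
  passes from one to the other. The pentagon needs this, since its arguments are products.
\<close>

lemma embed_assoc_constraint:
  assumes T: "counital_embedding M T i" and S: "counital_embedding N S j" and V: "counital_embedding P V k"
    and x: "x \<in> carrier ((M \<boxtimes> N) \<boxtimes> P)"
  shows "tensor_embed M (N \<boxtimes> P) T (S \<otimes>\<^sub>H V) i (tensor_embed N P S V j k)
      (assoc_constraint R H M N P x) =
    tensor_assoc R T S V
      (tensor_embed (M \<boxtimes> N) P (T \<otimes>\<^sub>H S) V (tensor_embed M N T S i j) k x)"
    (is "?l = ?r")
proof -
  note [simp] = M N P T[THEN counital_embedding_target] S[THEN counital_embedding_target]
    V[THEN counital_embedding_target]
  note lin = T[THEN counital_embedding_colinear, THEN colinear_linear]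
    S[THEN counital_embedding_colinear, THEN colinear_linear]
    V[THEN counital_embedding_colinear, THEN colinear_linear]
  have lij: "linear_map R (tensor R M N) (tensor R T S) (tensor_map R T S i j)"
    and ljk: "linear_map R (tensor R N P) (tensor R S V) (tensor_map R S V j k)"
    by (rule tensor_map_linear; simp add: lin)+
  have idd: "linear_map R (N \<boxtimes> P) (tensor R N P) (tensor_embed N P N P (\<lambda>n. n) (\<lambda>p. p))"
    and ddi: "linear_map R (M \<boxtimes> N) (tensor R M N) (tensor_embed M N M N (\<lambda>n. n) (\<lambda>p. p))"
    using colinear_linear[OF counital_embedding_colinear[OF counital_embedding_boxtimes[OF
          counital_embedding_id[OF N] counital_embedding_id[OF P]]]]
      colinear_linear[OF counital_embedding_colinear[OF counital_embedding_boxtimes[OF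
          counital_embedding_id[OF M] counital_embedding_id[OF N]]]]
    by simp_all
  let ?x = "assoc_constraint R H M N P x"
  have "?l = tensor_map R T (tensor R S V) i
      (\<lambda>y. tensor_map R S V j k (tensor_embed N P N P (\<lambda>n. n) (\<lambda>p. p) y)) (decode R M (N \<boxtimes> P) ?x)"
    unfolding tensor_embed_def using x
    by (simp, intro tensor_map_cong[of M "N \<boxtimes> P"]) (simp_all add: tensor_embed_def tensor_map_id)
  also have "\<dots> = tensor_map R T (tensor R S V) i (tensor_map R S V j k) (embed_right ?x)"
    unfolding tensor_embed_def[of M]
    using tensor_map_compose[OF _ _ _ _ _ _ linear_id idd lin(1) ljk] x by simp
  also have "embed_right ?x = tensor_assoc R M N P (embed_left x)"
    using conjunct1[OF conjunct2[OF assoc_constraint_iso]] x by (rule bspec)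
  also have "tensor_map R T (tensor R S V) i (tensor_map R S V j k) \<dots> =
      tensor_assoc R T S V (tensor_map R (tensor R T S) V (tensor_map R T S i j) k (embed_left x))"
    using counital_embedding_closed[OF embedding_left x]
    by (intro tensor_assoc_natural[symmetric]) (simp_all add: lin)
  also have "tensor_map R (tensor R T S) V (tensor_map R T S i j) k (embed_left x) =
      tensor_map R (tensor R T S) V (\<lambda>y. tensor_map R T S i j (tensor_embed M N M N (\<lambda>m. m) (\<lambda>n. n) y)) k
        (decode R (M \<boxtimes> N) P x)"
    unfolding tensor_embed_def[of "M \<boxtimes> N"]
    using tensor_map_compose[OF _ _ _ _ _ _ ddi linear_id lij lin(3)] x by simp
  also have "\<dots> = tensor_embed (M \<boxtimes> N) P (T \<otimes>\<^sub>H S) V (tensor_embed M N T S i j) k x"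
    unfolding tensor_embed_def[of "M \<boxtimes> N"] using x
    by (simp, intro tensor_map_cong[of "M \<boxtimes> N" P]) (simp_all add: tensor_embed_def tensor_map_id)
  finally show ?thesis .
qed

end

end

section \<open>Naturality and the pentagon\<close>

context prebialgebra
begin

lemma tensor_map_colinear_linear:
  assumes "semicomodule M" "semicomodule N" "semicomodule M'" "semicomodule N'"
    and "colinear M M' f" "colinear N N' g"
  shows "linear_map R (tensor R M N) (tensor R M' N') (tensor_map R M' N' f g)"
  by (rule tensor_map_linear) (simp_all add: assms colinear_linear)

text \<open>
  After embedding into the threefold tensor products this is naturality of the associativity map of
  modules.
\<close>

lemma assoc_constraint_natural:
  fixes M N P :: "('k, 'h, 'a) ucomodule"
  assumes s: "right_comodule R H M" "right_comodule R H N" "right_comodule R H P"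
      "right_comodule R H M'" "right_comodule R H N'" "right_comodule R H P'"
    and f: "colinear M M' f" and g: "colinear N N' g" and h: "colinear P P' h"
    and x: "x \<in> carrier ((M \<boxtimes> N) \<boxtimes> P)"
  shows "assoc_constraint R H M' N' P'
      (boxtimes_map R H (M \<boxtimes> N) (M' \<boxtimes> N') P P' (boxtimes_map R H M M' N N' f g) h x) =
    boxtimes_map R H M M' (N \<boxtimes> P) (N' \<boxtimes> P') f (boxtimes_map R H N N' P P' g h)
      (assoc_constraint R H M N P x)"
    (is "assoc_constraint R H M' N' P' ?l = ?r")
proof (rule assoc_constraint_eqI[OF s(4-6)])
  note [simp] = s
  note e = s[THEN counital_embedding_id]
  note box = counital_embedding_boxtimes
  note lf = f[THEN colinear_linear] g[THEN colinear_linear] h[THEN colinear_linear]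
  have fg: "colinear (M \<boxtimes> N) (M' \<boxtimes> N') (boxtimes_map R H M M' N N' f g)"
    and gh: "colinear (N \<boxtimes> P) (N' \<boxtimes> P') (boxtimes_map R H N N' P P' g h)"
    by (rule boxtimes_map_colinear; simp add: f g h)+
  have lfg: "linear_map R (M \<otimes>\<^sub>H N) (M' \<otimes>\<^sub>H N') (tensor_map R M' N' f g)"
    and lgh: "linear_map R (N \<otimes>\<^sub>H P) (N' \<otimes>\<^sub>H P') (tensor_map R N' P' g h)"
    using tensor_map_colinear_linear[OF _ _ _ _ f g] tensor_map_colinear_linear[OF _ _ _ _ g h] by simp_all
  note map_fg = embed_boxtimes_map[OF e(1,4,2,5) f lf(1) HOL.refl g lf(2) HOL.refl]
    and map_gh = embed_boxtimes_map[OF e(2,5,3,6) g lf(2) HOL.refl h lf(3) HOL.refl]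
  show "?l \<in> carrier ((M' \<boxtimes> N') \<boxtimes> P')"
    by (rule boxtimes_map_closed) (simp_all add: fg h x)
  show "?r \<in> carrier (M' \<boxtimes> (N' \<boxtimes> P'))"
    by (rule boxtimes_map_closed) (simp_all add: gh f x)
  have "embed_right M' N' P' ?r = tensor_map R M' (tensor R N' P') f (tensor_map R N' P' g h)
      (embed_right M N P (assoc_constraint R H M N P x))"
    using embed_boxtimes_map[OF e(1,4) box[OF e(2,3)] box[OF e(5,6)] f lf(1) HOL.refl gh lgh map_gh] x by simp
  also have "\<dots> = tensor_map R M' (tensor R N' P') f (tensor_map R N' P' g h)
      (tensor_assoc R M N P (embed_left M N P x))"
    by (simp only: embed_assoc_constraint[OF s(1-3) e(1-3) x])
  also have "\<dots> = tensor_assoc R M' N' P'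
      (tensor_map R (tensor R M' N') P' (tensor_map R M' N' f g) h (embed_left M N P x))"
    using counital_embedding_closed[OF embedding_left[OF s(1-3)] x]
    by (intro tensor_assoc_natural[symmetric]) (simp_all add: lf)
  also have "tensor_map R (tensor R M' N') P' (tensor_map R M' N' f g) h (embed_left M N P x) =
      embed_left M' N' P' ?l"
    using embed_boxtimes_map[OF box[OF e(1,2)] box[OF e(4,5)] e(3,6) fg lfg map_fg h lf(3) HOL.refl x] by simp
  finally show "embed_right M' N' P' ?r = tensor_assoc R M' N' P' (embed_left M' N' P' ?l)" .
qed

text \<open>
  Embed the target into \<open>M \<otimes> (N \<otimes> (P \<otimes> Q))\<close>. Each arrow of the pentagon is then exchanged for the
  corresponding map of modules and the embedding of the next corner, until both sides start from
  the embedding of the source into \<open>((M \<otimes> N) \<otimes> P) \<otimes> Q\<close>, and the pentagon for modules applies.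
\<close>

lemma assoc_constraint_pentagon:
  fixes M N P Q :: "('k, 'h, 'a) ucomodule"
  assumes s: "right_comodule R H M" "right_comodule R H N" "right_comodule R H P" "right_comodule R H Q"
    and x: "x \<in> carrier (((M \<boxtimes> N) \<boxtimes> P) \<boxtimes> Q)"
  shows "boxtimes_map R H M M ((N \<boxtimes> P) \<boxtimes> Q) (N \<boxtimes> (P \<boxtimes> Q))
      (\<lambda>m. m) (assoc_constraint R H N P Q)
      (assoc_constraint R H M (N \<boxtimes> P) Q
        (boxtimes_map R H ((M \<boxtimes> N) \<boxtimes> P) (M \<boxtimes> (N \<boxtimes> P)) Q Q
          (assoc_constraint R H M N P) (\<lambda>q. q) x)) =
    assoc_constraint R H M N (P \<boxtimes> Q) (assoc_constraint R H (M \<boxtimes> N) P Q x)"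
    (is "?l = ?r")
proof -
  let ?MN = "M \<boxtimes> N" and ?NP = "N \<boxtimes> P" and ?PQ = "P \<boxtimes> Q"
  let ?tMN = "M \<otimes>\<^sub>H N" and ?tNP = "N \<otimes>\<^sub>H P" and ?tPQ = "P \<otimes>\<^sub>H Q"
  let ?eMN = "tensor_embed M N M N (\<lambda>m. m) (\<lambda>n. n)" and ?eNP = "tensor_embed N P N P (\<lambda>n. n) (\<lambda>p. p)"
    and ?ePQ = "tensor_embed P Q P Q (\<lambda>p. p) (\<lambda>q. q)"
  note e = s[THEN counital_embedding_id]
  note box = counital_embedding_boxtimes
  have b: "right_comodule R H ?MN" "right_comodule R H ?NP" "right_comodule R H ?PQ"
    by (simp_all add: right_comodule_boxtimes s)
  note [simp] = s b
  note eMN = box[OF e(1,2)] and eNP = box[OF e(2,3)] and ePQ = box[OF e(3,4)]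
  let ?w = "boxtimes_map R H (?MN \<boxtimes> P) (M \<boxtimes> ?NP) Q Q
    (assoc_constraint R H M N P) (\<lambda>q. q) x"
  let ?v = "assoc_constraint R H ?MN P Q x"
  note a1 = colinear_assoc_constraint[OF s(1-3)] and a2 = colinear_assoc_constraint[OF s(2-4)]
  have la: "linear_map R (?tMN \<otimes>\<^sub>H P) (M \<otimes>\<^sub>H ?tNP) (tensor_assoc R M N P)"
    "linear_map R (?tNP \<otimes>\<^sub>H Q) (N \<otimes>\<^sub>H ?tPQ) (tensor_assoc R N P Q)"
    by (simp_all add: tensor_assoc_linear)
  have w: "?w \<in> carrier ((M \<boxtimes> ?NP) \<boxtimes> Q)"
    by (rule boxtimes_map_closed) (simp_all add: a1 colinear_id x)
  have z: "assoc_constraint R H M ?NP Q ?w \<in> carrier (M \<boxtimes> (?NP \<boxtimes> Q))"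
    by (rule assoc_constraint_closed) (simp_all add: w)
  have v: "?v \<in> carrier (?MN \<boxtimes> ?PQ)"
    by (rule assoc_constraint_closed) (simp_all add: x)
  have l: "?l \<in> carrier (M \<boxtimes> (N \<boxtimes> ?PQ))"
    by (rule boxtimes_map_closed) (simp_all add: a2 colinear_id z)
  have r: "?r \<in> carrier (M \<boxtimes> (N \<boxtimes> ?PQ))"
    by (rule assoc_constraint_closed) (simp_all add: v)
  let ?E = "tensor_embed M (N \<boxtimes> ?PQ) M (N \<otimes>\<^sub>H ?tPQ) (\<lambda>m. m)
    (tensor_embed N ?PQ N ?tPQ (\<lambda>n. n) ?ePQ)"
  let ?E' = "tensor_embed (?MN \<boxtimes> P) Q (?tMN \<otimes>\<^sub>H P) Q
    (tensor_embed ?MN P ?tMN P ?eMN (\<lambda>p. p)) (\<lambda>q. q)"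
  have E': "?E' x \<in> carrier (tensor R (tensor R (tensor R M N) P) Q)"
    using counital_embedding_closed[OF box[OF box[OF eMN e(3)] e(4)] x] by simp
  have "?E ?l = tensor_map R M (tensor R N (tensor R P Q)) (\<lambda>m. m) (tensor_assoc R N P Q)
      (tensor_embed M (?NP \<boxtimes> Q) M (?tNP \<otimes>\<^sub>H Q) (\<lambda>m. m)
        (tensor_embed ?NP Q ?tNP Q ?eNP (\<lambda>q. q)) (assoc_constraint R H M ?NP Q ?w))"
    using embed_boxtimes_map[OF e(1,1) box[OF eNP e(4)] box[OF e(2) ePQ] colinear_id linear_id HOL.refl
        a2 la(2) embed_assoc_constraint[OF s(2-4) e(2-4)] z] by simp
  also have "\<dots> = tensor_map R M (tensor R N (tensor R P Q)) (\<lambda>m. m) (tensor_assoc R N P Q)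
      (tensor_assoc R M (tensor R N P) Q (tensor_embed (M \<boxtimes> ?NP) Q (M \<otimes>\<^sub>H ?tNP) Q
        (tensor_embed M ?NP M ?tNP (\<lambda>m. m) ?eNP) (\<lambda>q. q) ?w))"
    using embed_assoc_constraint[OF s(1) b(2) s(4) e(1) eNP e(4) w] by simp
  also have "tensor_embed (M \<boxtimes> ?NP) Q (M \<otimes>\<^sub>H ?tNP) Q
        (tensor_embed M ?NP M ?tNP (\<lambda>m. m) ?eNP) (\<lambda>q. q) ?w =
      tensor_map R (tensor R M (tensor R N P)) Q (tensor_assoc R M N P) (\<lambda>q. q) (?E' x)"
    using embed_boxtimes_map[OF box[OF eMN e(3)] box[OF e(1) eNP] e(4,4) a1 la(1)
        embed_assoc_constraint[OF s(1-3) e(1-3)] colinear_id linear_id HOL.refl x] by simp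
  also have "tensor_map R M (tensor R N (tensor R P Q)) (\<lambda>m. m) (tensor_assoc R N P Q)
      (tensor_assoc R M (tensor R N P) Q
        (tensor_map R (tensor R M (tensor R N P)) Q (tensor_assoc R M N P) (\<lambda>q. q) (?E' x))) =
      tensor_assoc R M N (tensor R P Q) (tensor_assoc R (tensor R M N) P Q (?E' x))"
    by (rule tensor_assoc_pentagon) (simp_all add: E')
  also have "tensor_assoc R (tensor R M N) P Q (?E' x) =
      tensor_embed ?MN ?PQ ?tMN ?tPQ ?eMN ?ePQ ?v"
    using embed_assoc_constraint[OF b(1) s(3,4) eMN e(3,4) x] by simp
  also have "tensor_assoc R M N (tensor R P Q) \<dots> = ?E ?r"
    using embed_assoc_constraint[OF s(1,2) b(3) e(1,2) ePQ v] by simp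
  finally show ?thesis
    by (rule counital_embedding_inject[OF box[OF e(1) box[OF e(2) ePQ]] l r])
qed

end

section \<open>The unit constraints\<close>

context comonoidal_prebialgebra
begin

lemma left_unit_constraint_eq:
  "right_comodule R H M \<Longrightarrow> x \<in> carrier (unit_obj \<boxtimes> M) \<Longrightarrow>
    left_unit_constraint R H M x = left_unit_map M (decode R unit_obj M x)"
  by (simp add: left_unit_constraint_def left_unit_map_def tensor_lift_sweedler[of unit_obj M]
      tensor_lift_sweedler[of M H])

lemma right_unit_constraint_eq:
  "right_comodule R H M \<Longrightarrow> x \<in> carrier (M \<boxtimes> unit_obj) \<Longrightarrow>
    right_unit_constraint R H M x = right_unit_map M (decode R M unit_obj x)"
  by (simp add: right_unit_constraint_def right_unit_map_def tensor_lift_sweedler[of M unit_obj]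
      tensor_lift_sweedler[of M H])

lemma colinear_left_unit_constraint:
  assumes M: "right_comodule R H M"
  shows "colinear (unit_obj \<boxtimes> M) M (left_unit_constraint R H M)"
  by (rule colinear_cong[OF colinear_compose[OF _ _ _ colinear_decode colinear_left_unit_map]])
    (simp_all add: M left_unit_constraint_eq)

lemma colinear_right_unit_constraint:
  assumes M: "right_comodule R H M"
  shows "colinear (M \<boxtimes> unit_obj) M (right_unit_constraint R H M)"
  by (rule colinear_cong[OF colinear_compose[OF _ _ _ colinear_decode colinear_right_unit_map]])
    (simp_all add: M right_unit_constraint_eq)

text \<open>
  The inverse of \<open>l\<close> is \<open>m \<mapsto> \<epsilon>(1(2) m(1)) 1(1) \<otimes> m(0)\<close>, the counital part of \<open>1 \<otimes> m\<close>.
\<close>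

definition left_unit_inverse where
  "left_unit_inverse M m = corestrict unit_obj M (pure R unit_obj M unit_one m)"

definition right_unit_inverse where
  "right_unit_inverse M m = corestrict M unit_obj (pure R M unit_obj m unit_one)"

lemma left_unit_inverse_closed:
  "right_comodule R H M \<Longrightarrow> m \<in> carrier M \<Longrightarrow> left_unit_inverse M m \<in> carrier (unit_obj \<boxtimes> M)"
  by (simp add: left_unit_inverse_def)

lemma right_unit_inverse_closed:
  "right_comodule R H M \<Longrightarrow> m \<in> carrier M \<Longrightarrow> right_unit_inverse M m \<in> carrier (M \<boxtimes> unit_obj)"
  by (simp add: right_unit_inverse_def)

lemma left_unit_inverse_left:
  assumes M: "right_comodule R H M" and x: "x \<in> carrier (unit_obj \<boxtimes> M)"
  shows "left_unit_inverse M (left_unit_constraint R H M x) = x"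
proof -
  have "left_unit_inverse M (left_unit_constraint R H M x) = corestrict unit_obj M (decode R unit_obj M x)"
    by (simp add: left_unit_inverse_def left_unit_constraint_eq M x corestrict_def counital_part_left_unit)
  then show ?thesis using M x by (simp add: corestrict_decode)
qed

lemma right_unit_inverse_left:
  assumes M: "right_comodule R H M" and x: "x \<in> carrier (M \<boxtimes> unit_obj)"
  shows "right_unit_inverse M (right_unit_constraint R H M x) = x"
proof -
  have "right_unit_inverse M (right_unit_constraint R H M x) = corestrict M unit_obj (decode R M unit_obj x)"
    by (simp add: right_unit_inverse_def right_unit_constraint_eq M x corestrict_def counital_part_right_unit)
  then show ?thesis using M x by (simp add: corestrict_decode)
qed

text \<open>
  \<open>l\<close> is colinear on all of \<open>H\<^sub>s \<otimes> M\<close>, so it takes the counital part of \<open>1 \<otimes> m\<close> to that of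
  \<open>l(1 \<otimes> m) = m\<close>, which is \<open>m\<close>.
\<close>

lemma left_unit_inverse_right:
  fixes M :: "('k, 'h, 'a) ucomodule"
  assumes M: "right_comodule R H M" and m: "m \<in> carrier M"
  shows "left_unit_constraint R H M (left_unit_inverse M m) = m"
proof -
  let ?U = "unit_comodule R H :: ('k, 'h, 'a) ucomodule"
  have "left_unit_constraint R H M (left_unit_inverse M m) =
      left_unit_map M (counital_part (?U \<otimes>\<^sub>H M) (pure R ?U M unit_one m))"
    by (simp add: left_unit_constraint_eq left_unit_inverse_closed M m)
      (simp add: left_unit_inverse_def decode_corestrict M m)
  also have "\<dots> = counital_part M (left_unit_map M (pure R ?U M unit_one m))"
    by (rule counital_part_natural[symmetric]) (simp_all add: M m colinear_left_unit_map)
  also have "\<dots> = m"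
    by (simp only: left_unit_map_one[OF M m] counital_part_comodule[OF M m])
  finally show ?thesis .
qed

lemma right_unit_inverse_right:
  fixes M :: "('k, 'h, 'a) ucomodule"
  assumes M: "right_comodule R H M" and m: "m \<in> carrier M"
  shows "right_unit_constraint R H M (right_unit_inverse M m) = m"
proof -
  let ?U = "unit_comodule R H :: ('k, 'h, 'a) ucomodule"
  have "right_unit_constraint R H M (right_unit_inverse M m) =
      right_unit_map M (counital_part (M \<otimes>\<^sub>H ?U) (pure R M ?U m unit_one))"
    by (simp add: right_unit_constraint_eq right_unit_inverse_closed M m)
      (simp add: right_unit_inverse_def decode_corestrict M m)
  also have "\<dots> = counital_part M (right_unit_map M (pure R M ?U m unit_one))"
    by (rule counital_part_natural[symmetric]) (simp_all add: M m colinear_right_unit_map)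
  also have "\<dots> = m"
    by (simp only: right_unit_map_one[OF M m] counital_part_comodule[OF M m])
  finally show ?thesis .
qed

lemma left_unit_constraint_natural:
  assumes M: "right_comodule R H M" and N: "right_comodule R H N" and f: "colinear M N f"
    and x: "x \<in> carrier (unit_obj \<boxtimes> M)"
  shows "left_unit_constraint R H N (boxtimes_map R H unit_obj unit_obj M N (\<lambda>u. u) f x) =
    f (left_unit_constraint R H M x)"
proof -
  note [simp] = M N f x colinear_id
  have "boxtimes_map R H unit_obj unit_obj M N (\<lambda>u. u) f x \<in> carrier (unit_obj \<boxtimes> N)"
    by (rule boxtimes_map_closed) simp_all
  then show ?thesis
    by (simp add: left_unit_constraint_eq decode_boxtimes_map left_unit_map_natural[of M N])
qed

lemma right_unit_constraint_natural:
  assumes M: "right_comodule R H M" and N: "right_comodule R H N" and f: "colinear M N f"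
    and x: "x \<in> carrier (M \<boxtimes> unit_obj)"
  shows "right_unit_constraint R H N (boxtimes_map R H M N unit_obj unit_obj f (\<lambda>u. u) x) =
    f (right_unit_constraint R H M x)"
proof -
  note [simp] = M N f x colinear_id
  have "boxtimes_map R H M N unit_obj unit_obj f (\<lambda>u. u) x \<in> carrier (N \<boxtimes> unit_obj)"
    by (rule boxtimes_map_closed) simp_all
  then show ?thesis
    by (simp add: right_unit_constraint_eq decode_boxtimes_map right_unit_map_natural[of M N])
qed

text \<open>
  The maps of which both sides are restrictions agree up to counital parts, by
  \<open>counital_part_triangle\<close>. This is enough, because embedded elements are their own counital part.
\<close>

lemma unit_constraint_triangle:
  assumes M: "right_comodule R H M" and N: "right_comodule R H N"
    and x: "x \<in> carrier ((M \<boxtimes> unit_obj) \<boxtimes> N)"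
  shows "boxtimes_map R H M M (unit_obj \<boxtimes> N) N (\<lambda>m. m) (left_unit_constraint R H N)
      (assoc_constraint R H M unit_obj N x) =
    boxtimes_map R H (M \<boxtimes> unit_obj) M N N (right_unit_constraint R H M) (\<lambda>n. n) x"
    (is "?l = ?r")
proof -
  let ?U = "unit_comodule R H :: ('k, 'h, 'a) ucomodule"
  let ?MU = "M \<boxtimes> ?U" and ?UN = "?U \<boxtimes> N"
  let ?tMU = "M \<otimes>\<^sub>H ?U" and ?tUN = "?U \<otimes>\<^sub>H N"
  let ?eMU = "tensor_embed M ?U M ?U (\<lambda>m. m) (\<lambda>u. u)" and ?eUN = "tensor_embed ?U N ?U N (\<lambda>u. u) (\<lambda>n. n)"
  let ?e = "tensor_embed M N M N (\<lambda>m. m) (\<lambda>n. n)" and ?E = "tensor_embed ?MU N ?tMU N ?eMU (\<lambda>n. n)"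
  let ?p = "counital_part (M \<otimes>\<^sub>H N)"
  note U = right_comodule_unit
  note [simp] = M N colinear_id
  note e = M[THEN counital_embedding_id] U[THEN counital_embedding_id] N[THEN counital_embedding_id]
  note box = counital_embedding_boxtimes
  note cl = colinear_left_unit_constraint[OF N] and cr = colinear_right_unit_constraint[OF M]
  have lin: "linear_map R ?tUN N (left_unit_map N)" "linear_map R ?tMU M (right_unit_map M)"
    by (simp_all add: left_unit_map_linear right_unit_map_linear)
  have unit: "left_unit_constraint R H N y = left_unit_map N (?eUN y)" if "y \<in> carrier ?UN" for y
    using that by (simp add: left_unit_constraint_eq tensor_embed_def tensor_map_id)
  have unit': "right_unit_constraint R H M y = right_unit_map M (?eMU y)" if "y \<in> carrier ?MU" for y
    using that by (simp add: right_unit_constraint_eq tensor_embed_def tensor_map_id)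
  have z: "assoc_constraint R H M ?U N x \<in> carrier (M \<boxtimes> ?UN)"
    by (rule assoc_constraint_closed[OF M U N x])
  have l: "?l \<in> carrier (M \<boxtimes> N)" and r: "?r \<in> carrier (M \<boxtimes> N)"
    by (rule boxtimes_map_closed; simp add: cl cr x z)+
  have "?e ?l = tensor_map R M N (\<lambda>m. m) (left_unit_map N) (tensor_assoc R M ?U N (?E x))"
    by (simp only: embed_boxtimes_map[OF e(1,1) box[OF e(2,3)] e(3) colinear_id[OF right_comodule_semicomodule[OF M]]
        linear_id HOL.refl cl lin(1) unit z] embed_assoc_constraint[OF M U N e x])
  moreover have "?e ?r = tensor_map R M N (right_unit_map M) (\<lambda>n. n) (?E x)"
    by (rule embed_boxtimes_map[OF box[OF e(1,2)] e(1,3,3) cr lin(2) unit' _ linear_id HOL.refl x]) simp_all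
  moreover have "?E x \<in> carrier (tensor R (tensor R M ?U) N)"
    using counital_embedding_closed[OF box[OF box[OF e(1,2)] e(3)] x] by simp
  ultimately have "?p (?e ?l) = ?p (?e ?r)"
    by (simp only: counital_part_triangle right_comodule_semicomodule M N)
  then have "?e ?l = ?e ?r"
    by (simp only: counital_part_embedding[OF box[OF e(1,3)] l] counital_part_embedding[OF box[OF e(1,3)] r])
  then show ?thesis
    by (rule counital_embedding_inject[OF box[OF e(1,3)] l r])
qed

section \<open>The monoidal category of comodules\<close>

lemma moncat_simps [simp]:
  "Obj (comodule_moncat R H) = {M. right_comodule R H M}"
  "Hom (comodule_moncat R H) = comodule_hom R H"
  "Ident (comodule_moncat R H) = (\<lambda>M. \<lambda>x\<in>carrier M. x)"
  "Comp (comodule_moncat R H) A B C g f = compose (carrier A) g f"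
  "TensObj (comodule_moncat R H) = boxtimes R H"
  "TensArr (comodule_moncat R H) = boxtimes_map R H"
  "UnitObj (comodule_moncat R H) = unit_comodule R H"
  "Assoc (comodule_moncat R H) = assoc_constraint R H"
  "LUnit (comodule_moncat R H) = left_unit_constraint R H"
  "RUnit (comodule_moncat R H) = right_unit_constraint R H"
  by (simp_all add: comodule_moncat_def)

lemma compose_eqI:
  "(\<And>x. x \<in> A \<Longrightarrow> g (f x) = g' (f' x)) \<Longrightarrow> compose A g f = compose A g' f'"
  unfolding compose_def by (rule restrict_ext)

lemma comodule_homI: "f \<in> extensional (carrier M) \<Longrightarrow> colinear M N f \<Longrightarrow> f \<in> comodule_hom R H M N"
  by (simp add: comodule_hom_iff)

lemma hom_colinear: "f \<in> comodule_hom R H M N \<Longrightarrow> colinear M N f"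
  and hom_extensional: "f \<in> comodule_hom R H M N \<Longrightarrow> f \<in> extensional (carrier M)"
  by (simp_all add: comodule_hom_iff)

lemma hom_closed: "f \<in> comodule_hom R H M N \<Longrightarrow> m \<in> carrier M \<Longrightarrow> f m \<in> carrier N"
  by (rule colinear_closed[OF hom_colinear])

lemma ident_colinear: "semicomodule M \<Longrightarrow> colinear M M (\<lambda>x\<in>carrier M. x)"
  by (rule colinear_cong[OF colinear_id]) simp_all

lemma compose_hom:
  assumes "semicomodule L" "semicomodule M" "semicomodule N" "colinear L M f" "colinear M N g"
  shows "compose (carrier L) g f \<in> comodule_hom R H L N"
  by (intro comodule_homI compose_extensional colinear_cong[OF colinear_compose[OF assms]])
    (simp_all add: assms compose_eq)

lemma boxtimes_map_extensional: "boxtimes_map R H M M' N N' f g \<in> extensional (carrier (M \<boxtimes> N))"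
  by (simp add: boxtimes_map_def)

lemma boxtimes_map_cong:
  assumes "semicomodule M" "semicomodule N"
    and "\<And>m. m \<in> carrier M \<Longrightarrow> f m = f' m" "\<And>n. n \<in> carrier N \<Longrightarrow> g n = g' n"
  shows "boxtimes_map R H M M' N N' f g = boxtimes_map R H M M' N N' f' g'"
  unfolding boxtimes_map_def
proof (rule restrict_ext)
  fix x assume "x \<in> carrier (M \<boxtimes> N)"
  then have "tensor_map R M' N' f g (decode R M N x) = tensor_map R M' N' f' g' (decode R M N x)"
    by (intro tensor_map_cong[of M N]) (simp_all add: assms)
  then show "code (tensor_map R M' N' f g (decode R M N x)) = code (tensor_map R M' N' f' g' (decode R M N x))"
    by simp
qed

lemma boxtimes_map_hom:
  assumes "semicomodule M" "semicomodule M'" "semicomodule N" "semicomodule N'"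
    and "colinear M M' f" "colinear N N' g"
  shows "boxtimes_map R H M M' N N' f g \<in> comodule_hom R H (M \<boxtimes> N) (M' \<boxtimes> N')"
  by (intro comodule_homI boxtimes_map_extensional boxtimes_map_colinear assms)

lemma boxtimes_map_id:
  assumes "semicomodule M" "semicomodule N"
  shows "boxtimes_map R H M M N N (\<lambda>m. m) (\<lambda>n. n) = (\<lambda>x\<in>carrier (M \<boxtimes> N). x)"
proof (rule extensionalityI[OF boxtimes_map_extensional restrict_extensional])
  fix x assume x: "x \<in> carrier (M \<boxtimes> N)"
  then show "boxtimes_map R H M M N N (\<lambda>m. m) (\<lambda>n. n) x = (\<lambda>x\<in>carrier (M \<boxtimes> N). x) x"
    using assms by (simp add: boxtimes_map_eq colinear_id tensor_map_id corestrict_decode)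
qed

lemma boxtimes_map_compose:
  assumes s: "semicomodule M" "semicomodule M'" "semicomodule M''"
      "semicomodule N" "semicomodule N'" "semicomodule N''"
    and f: "colinear M M' f" "colinear M' M'' f'" and g: "colinear N N' g" "colinear N' N'' g'"
    and x: "x \<in> carrier (M \<boxtimes> N)"
  shows "boxtimes_map R H M M'' N N'' (\<lambda>m. f' (f m)) (\<lambda>n. g' (g n)) x =
    boxtimes_map R H M' M'' N' N'' f' g' (boxtimes_map R H M M' N N' f g x)"
proof -
  note [simp] = s
  have fg: "colinear M M'' (\<lambda>m. f' (f m))" "colinear N N'' (\<lambda>n. g' (g n))"
    using colinear_compose[OF s(1-3) f] colinear_compose[OF s(4-6) g] .
  have y: "boxtimes_map R H M M' N N' f g x \<in> carrier (M' \<boxtimes> N')"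
    by (rule boxtimes_map_closed) (simp_all add: f g x)
  show ?thesis
    by (simp add: boxtimes_map_eq[OF _ _ _ _ fg x] boxtimes_map_eq[OF _ _ _ _ f(2) g(2) y]
        decode_boxtimes_map f g x tensor_map_compose[OF _ _ _ _ _ _ colinear_linear[OF f(1)]
          colinear_linear[OF g(1)] colinear_linear[OF f(2)] colinear_linear[OF g(2)]])
qed

lemma isomorphismI:
  assumes M: "right_comodule R H M" and N: "right_comodule R H N"
    and f: "f \<in> extensional (carrier M)" "colinear M N f"
    and closed: "\<And>y. y \<in> carrier N \<Longrightarrow> g y \<in> carrier M"
    and gf: "\<And>x. x \<in> carrier M \<Longrightarrow> g (f x) = x"
    and fg: "\<And>y. y \<in> carrier N \<Longrightarrow> f (g y) = y"
  shows "isomorphism (comodule_moncat R H :: (('k, 'h, 'a) ucomodule, _) moncat) M N f"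
  unfolding isomorphism_def
proof (intro conjI bexI)
  show "f \<in> Hom (comodule_moncat R H) M N" using f by (simp add: comodule_hom_iff)
  have "colinear N M g"
    by (rule colinear_inverse[OF _ _ f(2) closed gf fg]) (simp_all add: M N)
  then have "colinear N M (restrict g (carrier N))"
    by (rule colinear_cong) (simp_all add: N)
  then show "restrict g (carrier N) \<in> Hom (comodule_moncat R H) N M" by (simp add: comodule_hom_iff)
  show "Comp (comodule_moncat R H) M N M (restrict g (carrier N)) f = Ident (comodule_moncat R H) M"
    unfolding moncat_simps compose_def
    by (rule restrict_ext) (simp add: colinear_closed[OF f(2)] gf)
  show "Comp (comodule_moncat R H) N M N f (restrict g (carrier N)) = Ident (comodule_moncat R H) N"
    unfolding moncat_simps compose_def
    by (rule restrict_ext) (simp add: fg)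
qed

lemma category_comodules:
  "category (comodule_moncat R H :: (('k, 'h, 'a) ucomodule, ('h, 'a) univ \<Rightarrow> ('h, 'a) univ) moncat)"
proof (unfold_locales, unfold moncat_simps mem_Collect_eq)
  fix A B C D :: "('k, 'h, 'a) ucomodule" and f g h :: "('h, 'a) univ \<Rightarrow> ('h, 'a) univ"
  assume A: "right_comodule R H A"
  then show "(\<lambda>x\<in>carrier A. x) \<in> comodule_hom R H A A"
    by (intro comodule_homI ident_colinear) simp_all
  assume B: "right_comodule R H B" 
  show "compose (carrier A) (\<lambda>x\<in>carrier B. x) f = f" "compose (carrier A) f (\<lambda>x\<in>carrier A. x) = f"
    if f: "f \<in> comodule_hom R H A B"
    using f by (auto intro!: extensionalityI[of _ "carrier A"] hom_extensional[OF f]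
        simp: compose_eq hom_closed[OF f])
  assume C: "right_comodule R H C"
  assume f: "f \<in> comodule_hom R H A B" and g: "g \<in> comodule_hom R H B C"
  show "compose (carrier A) g f \<in> comodule_hom R H A C"
    by (rule compose_hom[OF _ _ _ hom_colinear[OF f] hom_colinear[OF g]]) (simp_all add: A B C)
  show "compose (carrier A) h (compose (carrier A) g f) = compose (carrier A) (compose (carrier B) h g) f"
    by (rule compose_eqI) (simp add: compose_eq hom_closed[OF f])
qed

lemma constraints_extensional:
  "left_unit_constraint R H M \<in> extensional (carrier (unit_obj \<boxtimes> M))"
  "right_unit_constraint R H M \<in> extensional (carrier (M \<boxtimes> unit_obj))"
  "assoc_constraint R H M N P \<in> extensional (carrier ((M \<boxtimes> N) \<boxtimes> P))"
  unfolding left_unit_constraint_def right_unit_constraint_def assoc_constraint_def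
  by (rule restrict_extensional)+

text \<open>
  The identity morphisms of the category are restricted to carriers, while the preceding lemmas use
  plain identity functions; \<open>boxtimes_map_cong\<close> mediates between them.
\<close>

lemma monoidal_category_comodules:
  "monoidal_category (comodule_moncat R H :: (('k, 'h, 'a) ucomodule, ('h, 'a) univ \<Rightarrow> ('h, 'a) univ) moncat)"
proof (rule monoidal_category.intro[OF category_comodules], unfold_locales,
    unfold moncat_simps mem_Collect_eq)
  note semi = right_comodule_semicomodule
  let ?U = "unit_comodule R H :: ('k, 'h, 'a) ucomodule"
  show U: "right_comodule R H ?U" by (rule right_comodule_unit)
  fix A A' A'' B B' B'' C C' D :: "('k, 'h, 'a) ucomodule" and f f' g g' h
  assume A: "right_comodule R H A"
  note [simp] = A
  show "isomorphism (comodule_moncat R H) (?U \<boxtimes> A) A (left_unit_constraint R H A)"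
    by (rule isomorphismI[OF right_comodule_boxtimes A _ colinear_left_unit_constraint
        left_unit_inverse_closed left_unit_inverse_left left_unit_inverse_right])
      (simp_all add: constraints_extensional)
  show "isomorphism (comodule_moncat R H) (A \<boxtimes> ?U) A (right_unit_constraint R H A)"
    by (rule isomorphismI[OF right_comodule_boxtimes A _ colinear_right_unit_constraint
        right_unit_inverse_closed right_unit_inverse_left right_unit_inverse_right])
      (simp_all add: constraints_extensional)
  {
    assume B: "right_comodule R H B"
    note [simp] = B
    show "right_comodule R H (A \<boxtimes> B)" by (rule right_comodule_boxtimes) simp_all
    have "boxtimes_map R H A A B B (\<lambda>x\<in>carrier A. x) (\<lambda>x\<in>carrier B. x) =
        boxtimes_map R H A A B B (\<lambda>a. a) (\<lambda>b. b)"
      by (rule boxtimes_map_cong) simp_all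
    then show "boxtimes_map R H A A B B (\<lambda>x\<in>carrier A. x) (\<lambda>x\<in>carrier B. x) =
        (\<lambda>x\<in>carrier (A \<boxtimes> B). x)"
      by (simp add: boxtimes_map_id)
    show "compose (carrier ((A \<boxtimes> ?U) \<boxtimes> B))
        (boxtimes_map R H A A (?U \<boxtimes> B) B (\<lambda>x\<in>carrier A. x) (left_unit_constraint R H B))
        (assoc_constraint R H A ?U B) =
      boxtimes_map R H (A \<boxtimes> ?U) A B B (right_unit_constraint R H A) (\<lambda>x\<in>carrier B. x)"
    proof (rule extensionalityI[OF compose_extensional boxtimes_map_extensional])
      fix x assume x: "x \<in> carrier ((A \<boxtimes> ?U) \<boxtimes> B)"
      have "boxtimes_map R H A A (?U \<boxtimes> B) B (\<lambda>x\<in>carrier A. x) (left_unit_constraint R H B) =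
          boxtimes_map R H A A (?U \<boxtimes> B) B (\<lambda>a. a) (left_unit_constraint R H B)"
        "boxtimes_map R H (A \<boxtimes> ?U) A B B (right_unit_constraint R H A) (\<lambda>x\<in>carrier B. x) =
          boxtimes_map R H (A \<boxtimes> ?U) A B B (right_unit_constraint R H A) (\<lambda>b. b)"
        by (rule boxtimes_map_cong; simp)+
      then show "compose (carrier ((A \<boxtimes> ?U) \<boxtimes> B))
          (boxtimes_map R H A A (?U \<boxtimes> B) B (\<lambda>x\<in>carrier A. x) (left_unit_constraint R H B))
          (assoc_constraint R H A ?U B) x =
        boxtimes_map R H (A \<boxtimes> ?U) A B B (right_unit_constraint R H A) (\<lambda>x\<in>carrier B. x) x"
        using x by (simp add: compose_eq unit_constraint_triangle)
    qed
    assume C: "right_comodule R H C"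
    note [simp] = C
    show "isomorphism (comodule_moncat R H) ((A \<boxtimes> B) \<boxtimes> C)
        (A \<boxtimes> (B \<boxtimes> C)) (assoc_constraint R H A B C)"
    proof -
      obtain k where "\<forall>y\<in>carrier (A \<boxtimes> (B \<boxtimes> C)).
          k y \<in> carrier ((A \<boxtimes> B) \<boxtimes> C) \<and> assoc_constraint R H A B C (k y) = y"
        "\<forall>x\<in>carrier ((A \<boxtimes> B) \<boxtimes> C). k (assoc_constraint R H A B C x) = x"
        using assoc_constraint_iso[OF A B C] by blast
      then show ?thesis
        by (intro isomorphismI[where g = k] right_comodule_boxtimes colinear_assoc_constraint)
          (simp_all add: constraints_extensional)
    qed
    assume D: "right_comodule R H D"
    note [simp] = D
    let ?l = "boxtimes_map R H A A ((B \<boxtimes> C) \<boxtimes> D) (B \<boxtimes> (C \<boxtimes> D))"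
      and ?r = "boxtimes_map R H ((A \<boxtimes> B) \<boxtimes> C) (A \<boxtimes> (B \<boxtimes> C)) D D
        (assoc_constraint R H A B C)"
    have "?l (\<lambda>x\<in>carrier A. x) (assoc_constraint R H B C D) = ?l (\<lambda>a. a) (assoc_constraint R H B C D)"
      "?r (\<lambda>x\<in>carrier D. x) = ?r (\<lambda>d. d)"
      by (rule boxtimes_map_cong; simp)+
    then show "compose (carrier (((A \<boxtimes> B) \<boxtimes> C) \<boxtimes> D))
        (?l (\<lambda>x\<in>carrier A. x) (assoc_constraint R H B C D))
        (compose (carrier (((A \<boxtimes> B) \<boxtimes> C) \<boxtimes> D))
          (assoc_constraint R H A (B \<boxtimes> C) D) (?r (\<lambda>x\<in>carrier D. x))) =
      compose (carrier (((A \<boxtimes> B) \<boxtimes> C) \<boxtimes> D))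
        (assoc_constraint R H A B (C \<boxtimes> D)) (assoc_constraint R H (A \<boxtimes> B) C D)"
      by (intro compose_eqI) (simp add: compose_eq assoc_constraint_pentagon)
  }
  assume A': "right_comodule R H A'"
  note [simp] = A'
  {
    assume f: "f \<in> comodule_hom R H A A'"
    have idf: "boxtimes_map R H ?U ?U A A' (\<lambda>x\<in>carrier ?U. x) f = boxtimes_map R H ?U ?U A A' (\<lambda>u. u) f"
      "boxtimes_map R H A A' ?U ?U f (\<lambda>x\<in>carrier ?U. x) = boxtimes_map R H A A' ?U ?U f (\<lambda>u. u)"
      by (rule boxtimes_map_cong; simp)+
    show "compose (carrier (?U \<boxtimes> A)) (left_unit_constraint R H A')
        (boxtimes_map R H ?U ?U A A' (\<lambda>x\<in>carrier ?U. x) f) =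
      compose (carrier (?U \<boxtimes> A)) f (left_unit_constraint R H A)"
      unfolding idf by (rule compose_eqI) (simp add: left_unit_constraint_natural hom_colinear[OF f])
    show "compose (carrier (A \<boxtimes> ?U)) (right_unit_constraint R H A')
        (boxtimes_map R H A A' ?U ?U f (\<lambda>x\<in>carrier ?U. x)) =
      compose (carrier (A \<boxtimes> ?U)) f (right_unit_constraint R H A)"
      unfolding idf by (rule compose_eqI) (simp add: right_unit_constraint_natural hom_colinear[OF f])
  }
  {
    assume B: "right_comodule R H B" and B': "right_comodule R H B'"
      and f: "f \<in> comodule_hom R H A A'" and g: "g \<in> comodule_hom R H B B'"
    note [simp] = B B' hom_colinear[OF f] hom_colinear[OF g]
    show "boxtimes_map R H A A' B B' f g \<in> comodule_hom R H (A \<boxtimes> B) (A' \<boxtimes> B')"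
      by (rule boxtimes_map_hom) simp_all
    {
      assume C: "right_comodule R H C" and C': "right_comodule R H C'" and h: "h \<in> comodule_hom R H C C'"
      show "compose (carrier ((A \<boxtimes> B) \<boxtimes> C)) (assoc_constraint R H A' B' C')
          (boxtimes_map R H (A \<boxtimes> B) (A' \<boxtimes> B') C C' (boxtimes_map R H A A' B B' f g) h) =
        compose (carrier ((A \<boxtimes> B) \<boxtimes> C))
          (boxtimes_map R H A A' (B \<boxtimes> C) (B' \<boxtimes> C') f (boxtimes_map R H B B' C C' g h))
          (assoc_constraint R H A B C)"
        by (rule compose_eqI) (simp add: assoc_constraint_natural C C' hom_colinear[OF h])
    next
      assume A'': "right_comodule R H A''" and B'': "right_comodule R H B''"
        and f': "f' \<in> comodule_hom R H A' A''" and g': "g' \<in> comodule_hom R H B' B''"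
      have "boxtimes_map R H A A'' B B'' (compose (carrier A) f' f) (compose (carrier B) g' g) =
          boxtimes_map R H A A'' B B'' (\<lambda>a. f' (f a)) (\<lambda>b. g' (g b))"
        by (rule boxtimes_map_cong) (simp_all add: compose_eq)
      also have "\<dots> = compose (carrier (A \<boxtimes> B)) (boxtimes_map R H A' A'' B' B'' f' g')
          (boxtimes_map R H A A' B B' f g)"
        by (rule extensionalityI[OF boxtimes_map_extensional compose_extensional])
          (simp add: compose_eq boxtimes_map_compose[of A A' A'' B B' B''] A'' B''
            hom_colinear[OF f'] hom_colinear[OF g'])
      finally show "boxtimes_map R H A A'' B B'' (compose (carrier A) f' f) (compose (carrier B) g' g) =
          compose (carrier (A \<boxtimes> B)) (boxtimes_map R H A' A'' B' B'' f' g')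
          (boxtimes_map R H A A' B B' f g)" .
    }
  }
qed

end

theorem theorem3p1:
  fixes R :: "('k, 'r) ring_scheme" and H :: "('k, 'h, 'x) prebialg_scheme"
  assumes "comonoidal_prebialgebra R H"
  shows "monoidal_category
    (comodule_moncat R H :: (('k, 'h, 'a) ucomodule, ('h, 'a) univ \<Rightarrow> ('h, 'a) univ) moncat)"
  by (rule comonoidal_prebialgebra.monoidal_category_comodules[OF assms])

end
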